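(* Let $m\ge3$, let $\Omega\subset\mathbb{R}^m$ be a (connected, open) domain, $\vec F$ a $C^1$ vector field on $\Omega$, and $u,v$ real-valued $C^2$ functions on $\Omega$ with $v\ge u$ in $\Omega$. Let $(w,w')=(u,v)$ (respectively, $(w,w')=(v,u)$). Suppose $\Omega\cap S_{\vec F}(w)=\{p_0\}$ and $v=u$ at $p_0$. Suppose $\mathcal{H}_{m-1}(\overline{S_{\vec F}(w')})=0$ and $\operatorname{div}\vec F^{\,b}>0$ (or $\operatorname{div}\vec F^{\,b}<0$). Assume $H_{\vec F}(v)\le H_{\vec F}(u)$ in $\Omega\setminus(\{p_0\}\cup S_{\vec F}(w'))$, and that each point of $\Omega\setminus\{p_0\}$ has a neighborhood in which there exists an orthonormal basis $N_1^\perp(w),\dots,N_{m-1}^\perp(w)$ (of $C^\infty$ vector fields) of the space perpendicular to $N_{\vec F}(w)$ such that the rank of $\mathcal{L}(N_1^\perp(w),\dots,N_{m-1}^\perp(w))$ is constant $m$. Then $v\equiv u$ in $\Omega$.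
   Context: $S_{\vec F}(u):=\{\nabla u+\vec F=0\}$ is the set of singular points of $u$; off it, $N_{\vec F}(u):=\frac{\nabla u+\vec F}{|\nabla u+\vec F|}$ and $H_{\vec F}(u):=\operatorname{div}N_{\vec F}(u)$ (Euclidean); similarly for $v$. $\mathcal{H}_{m-1}$ is $(m-1)$-dimensional Hausdorff measure. For $\vec G=(G_1,\dots,G_m)$, $\vec G^{\,b}:=(\sum_ka^{1k}G_k,\dots,\sum_ka^{mk}G_k)$, where $a^{jk}$ are (fixed) real constants with $a^{jk}+a^{kj}=0$ for $1\le j,k\le m$. For $C^\infty$ vector fields $X_1,\dots,X_r$, $\mathcal{L}(X_1,\dots,X_r)$ is the smallest $C^\infty$-module of vector fields containing $X_1,\dots,X_r$ and closed under the Lie bracket; its rank at $q$ is the dimension of the span of $\{Z(q):Z\in\mathcal{L}(X_1,\dots,X_r)\}$. *)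

theory Defs
  imports "HOL-Analysis.Analysis"
begin

(* Functions and vector fields on an open set are total functions; every notion below only
   reads their values on that set, since derivatives at its points are local. *)

(* For open U: f is differentiable on U and its first partial derivatives are of class C^k. *)
primrec Ck_on :: "nat \<Rightarrow> ('a::euclidean_space \<Rightarrow> 'b::real_normed_vector) \<Rightarrow> 'a set \<Rightarrow> bool" where
  "Ck_on 0 f U \<longleftrightarrow> continuous_on U f"
| "Ck_on (Suc k) f U \<longleftrightarrow> (\<forall>x\<in>U. f differentiable (at x)) \<and>
     (\<forall>b\<in>Basis. Ck_on k (\<lambda>x. frechet_derivative f (at x) b) U)"

definition smooth_on :: "('a::euclidean_space \<Rightarrow> 'b::real_normed_vector) \<Rightarrow> 'a set \<Rightarrow> bool" where
  "smooth_on f U \<longleftrightarrow> (\<forall>k. Ck_on k f U)"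

definition grad :: "(real ^ 'm \<Rightarrow> real) \<Rightarrow> real ^ 'm \<Rightarrow> real ^ 'm" where
  "grad u x = (\<chi> i. frechet_derivative u (at x) (axis i 1))"

definition divergence :: "(real ^ 'm \<Rightarrow> real ^ 'm) \<Rightarrow> real ^ 'm \<Rightarrow> real" where
  "divergence X x = (\<Sum>i\<in>UNIV. frechet_derivative X (at x) (axis i 1) $ i)"

definition singular_set ::
    "(real ^ 'm) set \<Rightarrow> (real ^ 'm \<Rightarrow> real ^ 'm) \<Rightarrow> (real ^ 'm \<Rightarrow> real) \<Rightarrow> (real ^ 'm) set" where
  "singular_set \<Omega> F u = {x\<in>\<Omega>. grad u x + F x = 0}"

(* Only meaningful off the singular set (it is 0 there, by the convention inverse 0 = 0). *)
definition normal_field ::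
    "(real ^ 'm \<Rightarrow> real ^ 'm) \<Rightarrow> (real ^ 'm \<Rightarrow> real) \<Rightarrow> real ^ 'm \<Rightarrow> real ^ 'm" where
  "normal_field F u x = (grad u x + F x) /\<^sub>R norm (grad u x + F x)"

definition mean_curvature ::
    "(real ^ 'm \<Rightarrow> real ^ 'm) \<Rightarrow> (real ^ 'm \<Rightarrow> real) \<Rightarrow> real ^ 'm \<Rightarrow> real" where
  "mean_curvature F u x = divergence (normal_field F u) x"

definition flat_field ::
    "real ^ 'm ^ 'm \<Rightarrow> (real ^ 'm \<Rightarrow> real ^ 'm) \<Rightarrow> real ^ 'm \<Rightarrow> real ^ 'm" where
  "flat_field a G x = (\<chi> j. \<Sum>k\<in>UNIV. a $ j $ k * G x $ k)"

(* The case distinction on the empty set makes the formula the counting measure for d = 0;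
   boundedness is required because the library's diameter is unspecified on unbounded sets. *)
definition hausdorff_premeasure :: "nat \<Rightarrow> real \<Rightarrow> 'a::metric_space set \<Rightarrow> ennreal" where
  "hausdorff_premeasure d \<delta> A =
     (INF C \<in> {C :: nat \<Rightarrow> 'a set. A \<subseteq> (\<Union>n. C n) \<and> (\<forall>n. bounded (C n) \<and> diameter (C n) \<le> \<delta>)}.
        \<Sum>n. ennreal (if C n = {} then 0 else unit_ball_vol (real d) * (diameter (C n) / 2) ^ d))"

definition hausdorff_measure :: "nat \<Rightarrow> 'a::metric_space set \<Rightarrow> ennreal" where
  "hausdorff_measure d A = (SUP \<delta>\<in>{0<..}. hausdorff_premeasure d \<delta> A)"

(* Components: [X, Y]_i = (sum over j) X_j d_j Y_i - Y_j d_j X_i. *)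
definition lie_bracket ::
    "(real ^ 'm \<Rightarrow> real ^ 'm) \<Rightarrow> (real ^ 'm \<Rightarrow> real ^ 'm) \<Rightarrow> real ^ 'm \<Rightarrow> real ^ 'm" where
  "lie_bracket X Y x = frechet_derivative Y (at x) (X x) - frechet_derivative X (at x) (Y x)"

inductive_set lie_module ::
    "(real ^ 'm) set \<Rightarrow> (real ^ 'm \<Rightarrow> real ^ 'm) set \<Rightarrow> (real ^ 'm \<Rightarrow> real ^ 'm) set"
  for U :: "(real ^ 'm) set" and \<X> :: "(real ^ 'm \<Rightarrow> real ^ 'm) set" where
  gen: "X \<in> \<X> \<Longrightarrow> X \<in> lie_module U \<X>"
| zero: "(\<lambda>x. 0) \<in> lie_module U \<X>"
| add: "\<lbrakk>X \<in> lie_module U \<X>; Y \<in> lie_module U \<X>\<rbrakk> \<Longrightarrow> (\<lambda>x. X x + Y x) \<in> lie_module U \<X>"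
| smult: "\<lbrakk>smooth_on (f :: real ^ 'm \<Rightarrow> real) U; X \<in> lie_module U \<X>\<rbrakk>
    \<Longrightarrow> (\<lambda>x. f x *\<^sub>R X x) \<in> lie_module U \<X>"
| bracket: "\<lbrakk>X \<in> lie_module U \<X>; Y \<in> lie_module U \<X>\<rbrakk> \<Longrightarrow> lie_bracket X Y \<in> lie_module U \<X>"

definition lie_rank :: "(real ^ 'm) set \<Rightarrow> (real ^ 'm \<Rightarrow> real ^ 'm) set \<Rightarrow> real ^ 'm \<Rightarrow> nat" where
  "lie_rank U \<X> q = dim (span {Z q |Z. Z \<in> lie_module U \<X>})"

definition smooth_orthonormal_perp_frame ::
    "(real ^ 'm) set \<Rightarrow> (real ^ 'm \<Rightarrow> real ^ 'm) \<Rightarrow> (nat \<Rightarrow> real ^ 'm \<Rightarrow> real ^ 'm) \<Rightarrow> bool" where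
  "smooth_orthonormal_perp_frame U \<nu> N \<longleftrightarrow>
     (\<forall>i\<in>{1..CARD('m) - 1}. smooth_on (N i) U) \<and>
     (\<forall>x\<in>U. (\<forall>i\<in>{1..CARD('m) - 1}. \<forall>j\<in>{1..CARD('m) - 1}. N i x \<bullet> N j x = (if i = j then 1 else 0)) \<and>
            span {N i x |i. i \<in> {1..CARD('m) - 1}} = orthogonal_comp {\<nu> x})"

end

theory Submission
  imports Defs
begin

text \<open>Away from \<open>p\<^sub>0\<close>, the Hopf lemma shows that every proximal normal of the coincidence set
  \<open>Z = {v = u}\<close> is parallel to \<open>N(w)\<close>, i.e. that all \<open>N\<^sub>i\<^sup>\<bottom>(w)\<close> are tangent to \<open>Z\<close> in Bony's
  sense. Tangency is preserved by Lie brackets, so by the rank condition \<open>Z\<close> has no proximal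
  normals and is open; since a punctured domain is connected, one coincidence point other than
  \<open>p\<^sub>0\<close> suffices. If there were none, the sets \<open>{v - u \<le> \<epsilon>}\<close> near \<open>p\<^sub>0\<close> would be compact; the
  comparison principle gives \<open>N(u) = N(v)\<close> on them, so \<open>(\<nabla>u + F)\<^sup>b\<close> is orthogonal to
  \<open>\<nabla>(v - u)\<close>, and integrating its divergence \<open>div F\<^sup>b\<close> against a function of \<open>v - u\<close> is
  contradictory.\<close>

section \<open>Functions of class C^k\<close>

text \<open>The curvature operator is elliptic only orthogonally to \<open>\<nabla>u + F\<close>.
  Since nothing is known about the regularity of \<open>Z\<close>, tangency is expressed through
  nearest points, and second-order displacements replace flows and their commutators. Singular
  points of \<open>w'\<close> are harmless away from \<open>p0\<close>: at a coincidence point the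
  two gradients agree, so \<open>w'\<close> is regular near it whenever \<open>w\<close> is. At
  \<open>p0\<close> both fields vanish, no ellipticity is left, and only an integral argument
  remains. Skewness of \<open>a\<close> does two jobs there: a field is orthogonal to its own
  rotation, and the Hessian of \<open>u\<close> drops out of the divergence of the rotated
  field.\<close>

lemma Ck_on_cong:
  assumes "open U" and "\<And>x. x \<in> U \<Longrightarrow> f x = g x"
  shows "Ck_on k f U \<longleftrightarrow> Ck_on k g U"
  using assms(2)
proof (induction k arbitrary: f g)
  case 0
  then show ?case using continuous_on_cong by (metis Ck_on.simps(1))
next
  case (Suc k)
  have step: "Ck_on (Suc k) g U"
    if fg: "\<And>x. x \<in> U \<Longrightarrow> f x = g x" and f: "Ck_on (Suc k) f U" for f g :: "'a \<Rightarrow> 'b"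
  proof -
    have "g differentiable (at x)" if x: "x \<in> U" for x
    proof -
      obtain D where "(f has_derivative D) (at x)"
        using f x unfolding Ck_on.simps differentiable_def by blast
      then have "(g has_derivative D) (at x)"
        by (rule has_derivative_transform_within_open[OF _ assms(1) x fg])
      then show ?thesis by (rule differentiableI)
    qed
    moreover have "Ck_on k (\<lambda>x. frechet_derivative g (at x) b) U" if b: "b \<in> Basis" for b
    proof -
      have "Ck_on k (\<lambda>x. frechet_derivative f (at x) b) U"
        using f b by simp
      moreover have "frechet_derivative f (at x) b = frechet_derivative g (at x) b" if x: "x \<in> U" for x
        using frechet_derivative_transform_within_open[OF _ assms(1) x fg] f x by simp
      ultimately show ?thesis
        using Suc.IH[of "\<lambda>x. frechet_derivative f (at x) b" "\<lambda>x. frechet_derivative g (at x) b"] by blast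
    qed
    ultimately show ?thesis by simp
  qed
  show ?case
    by (intro iffI) (erule step[rotated], simp add: Suc.prems)+
qed

lemma Ck_on_subset: "Ck_on k f U \<Longrightarrow> V \<subseteq> U \<Longrightarrow> Ck_on k f V"
  by (induction k arbitrary: f) (auto intro: continuous_on_subset)

lemma Ck_on_Suc_imp: "Ck_on (Suc k) f U \<Longrightarrow> Ck_on k f U"
proof (induction k arbitrary: f)
  case 0
  then show ?case
    by (auto intro!: continuous_at_imp_continuous_on differentiable_imp_continuous_within)
next
  case (Suc k)
  then show ?case by simp
qed

lemma Ck_on_continuous: "Ck_on k f U \<Longrightarrow> continuous_on U f"
  using Ck_on_Suc_imp[of _ f U] by (induction k) (simp, blast)

lemma Ck_on_const: "Ck_on k (\<lambda>x. c) U"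
  by (induction k arbitrary: c) auto

lemma Ck_on_Suc_intro:
  assumes "open U"
    and "\<And>x. x \<in> U \<Longrightarrow> (f has_derivative f' x) (at x)"
    and "\<And>b. b \<in> Basis \<Longrightarrow> Ck_on k (\<lambda>x. f' x b) U"
  shows "Ck_on (Suc k) f U"
proof -
  have "frechet_derivative f (at x) = f' x" if "x \<in> U" for x
    using assms(2)[OF that] by (metis frechet_derivative_at)
  then have "Ck_on k (\<lambda>x. frechet_derivative f (at x) b) U" if "b \<in> Basis" for b
    using assms(3)[OF that] Ck_on_cong[OF assms(1), of "\<lambda>x. f' x b" "\<lambda>x. frechet_derivative f (at x) b"]
    by simp
  then show ?thesis
    using assms(2) by (auto simp: differentiable_def)
qed

lemma Ck_on_Suc_has_derivative:
  "Ck_on (Suc k) f U \<Longrightarrow> x \<in> U \<Longrightarrow> (f has_derivative frechet_derivative f (at x)) (at x)"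
  using frechet_derivative_works by auto

lemma Ck_on_add:
  assumes "open U" "Ck_on k f U" "Ck_on k g U"
  shows "Ck_on k (\<lambda>x. f x + g x) U"
  using assms(2,3)
proof (induction k arbitrary: f g)
  case 0
  then show ?case by (simp add: continuous_on_add)
next
  case (Suc k)
  show ?case
    by (rule Ck_on_Suc_intro[OF assms(1), where f' = "\<lambda>x h. frechet_derivative f (at x) h + frechet_derivative g (at x) h"])
       (use Suc in \<open>auto intro!: has_derivative_add simp: frechet_derivative_works[symmetric]\<close>)
qed

lemma Ck_on_bilinear:
  fixes f :: "'a::euclidean_space \<Rightarrow> 'b::real_normed_vector"
    and g :: "'a \<Rightarrow> 'c::real_normed_vector"
    and pr :: "'b \<Rightarrow> 'c \<Rightarrow> 'd::real_normed_vector"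
  assumes "bounded_bilinear pr" "open U" "Ck_on k f U" "Ck_on k g U"
  shows "Ck_on k (\<lambda>x. pr (f x) (g x)) U"
  using assms(3,4)
proof (induction k arbitrary: f g)
  case 0
  then show ?case using bounded_bilinear.continuous_on[OF assms(1)] by auto
next
  case (Suc k)
  show ?case
  proof (rule Ck_on_Suc_intro[OF assms(2), where f' = "\<lambda>x h. pr (f x) (frechet_derivative g (at x) h) + pr (frechet_derivative f (at x) h) (g x)"])
    fix x assume "x \<in> U"
    then show "((\<lambda>x. pr (f x) (g x)) has_derivative
         (\<lambda>h. pr (f x) (frechet_derivative g (at x) h) + pr (frechet_derivative f (at x) h) (g x))) (at x)"
      using Suc.prems by (auto intro!: bounded_bilinear.FDERIV[OF assms(1)] simp: frechet_derivative_works[symmetric])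
  next
    fix b :: 'a assume "b \<in> Basis"
    then show "Ck_on k (\<lambda>x. pr (f x) (frechet_derivative g (at x) b) + pr (frechet_derivative f (at x) b) (g x)) U"
      using Suc Ck_on_Suc_imp[OF Suc.prems(1)] Ck_on_Suc_imp[OF Suc.prems(2)]
      by (intro Ck_on_add[OF assms(2)]) auto
  qed
qed

lemmas Ck_on_scaleR = Ck_on_bilinear[OF bounded_bilinear_scaleR]
lemmas Ck_on_mult = Ck_on_bilinear[OF bounded_bilinear_mult]
lemmas Ck_on_inner = Ck_on_bilinear[OF bounded_bilinear_inner]

lemma Ck_on_minus: "open U \<Longrightarrow> Ck_on k f U \<Longrightarrow> Ck_on k (\<lambda>x. - f x) U"
  using Ck_on_scaleR[OF _ Ck_on_const[of k "-1"]] by fastforce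

lemma Ck_on_diff: "open U \<Longrightarrow> Ck_on k f U \<Longrightarrow> Ck_on k g U \<Longrightarrow> Ck_on k (\<lambda>x. f x - g x) U"
  using Ck_on_add[of U k f "\<lambda>x. - g x"] Ck_on_minus by auto

lemma Ck_on_sum: "open U \<Longrightarrow> (\<And>i. i \<in> I \<Longrightarrow> Ck_on k (f i) U) \<Longrightarrow> Ck_on k (\<lambda>x. \<Sum>i\<in>I. f i x) U"
  by (induction I rule: infinite_finite_induct) (auto intro!: Ck_on_add Ck_on_const)

text \<open>A gluing tool for functions that are given by a formula on one open set and vanish on
  another.\<close>

lemma Ck_on_Un:
  "open U \<Longrightarrow> open V \<Longrightarrow> Ck_on k f U \<Longrightarrow> Ck_on k f V \<Longrightarrow> Ck_on k f (U \<union> V)"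
  by (induction k arbitrary: f) (auto intro: continuous_on_open_Un)

lemma linear_Basis_expansion:
  fixes f :: "'a::euclidean_space \<Rightarrow> 'b::real_vector"
  assumes "linear f"
  shows "f h = (\<Sum>b\<in>Basis. (h \<bullet> b) *\<^sub>R f b)"
proof -
  have "f h = f (\<Sum>b\<in>Basis. (h \<bullet> b) *\<^sub>R b)"
    by (simp only: euclidean_representation)
  also have "\<dots> = (\<Sum>b\<in>Basis. (h \<bullet> b) *\<^sub>R f b)"
    by (simp only: linear_sum[OF assms] linear_cmul[OF assms])
  finally show ?thesis .
qed

lemma Ck_on_frechet_apply:
  fixes X :: "'a::euclidean_space \<Rightarrow> 'b::real_normed_vector"
  assumes "open U" "Ck_on (Suc k) X U" "Ck_on k Y U"
  shows "Ck_on k (\<lambda>x. frechet_derivative X (at x) (Y x)) U"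
proof -
  have "frechet_derivative X (at x) (Y x) = (\<Sum>b\<in>Basis. (Y x \<bullet> b) *\<^sub>R frechet_derivative X (at x) b)"
    if "x \<in> U" for x
  proof -
    have "linear (frechet_derivative X (at x))"
      using assms(2) that by (simp add: linear_frechet_derivative)
    then show ?thesis
      by (rule linear_Basis_expansion)
  qed
  moreover have "Ck_on k (\<lambda>x. \<Sum>b\<in>Basis. (Y x \<bullet> b) *\<^sub>R frechet_derivative X (at x) b) U"
    by (intro Ck_on_sum Ck_on_scaleR Ck_on_inner Ck_on_const assms) (use assms(2) in auto)
  ultimately show ?thesis
    by (subst Ck_on_cong[OF assms(1)])
qed

lemma smooth_on_lie_bracket:
  assumes "open U" "smooth_on X U" "smooth_on Y U"
  shows "smooth_on (lie_bracket X Y) U"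
proof -
  have "Ck_on k (lie_bracket X Y) U" for k
    unfolding lie_bracket_def using assms unfolding smooth_on_def
    by (intro Ck_on_diff Ck_on_frechet_apply) blast+
  then show ?thesis
    by (simp add: smooth_on_def)
qed

text \<open>The mean value inequality is applied to \<open>X\<close> minus its linearization at
  \<open>x\<close>, on a ball where the derivative stays within \<open>e\<close> of its value at
  \<open>x\<close>. Both \<open>y\<close> and \<open>z\<close> are free, unlike in plain
  differentiability at \<open>x\<close>; later the base points move along \<open>Z\<close>.\<close>

lemma C1_strict_derivative:
  fixes X :: "'a::euclidean_space \<Rightarrow> 'b::real_normed_vector"
  assumes "open U" "Ck_on 1 X U" "x \<in> U" "e > 0"
  shows "\<exists>d>0. ball x d \<subseteq> U \<and> (\<forall>y\<in>ball x d. \<forall>z\<in>ball x d.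
      norm (X y - X z - frechet_derivative X (at x) (y - z)) \<le> e * norm (y - z))"
proof -
  let ?D = "\<lambda>y. frechet_derivative X (at y)"
  \<comment> \<open>The derivative is compared on basis vectors only; each of the
    \<open>DIM('a)\<close> of them contributes at most \<open>e'\<close> to the operator
    norm.\<close>
  define e' where "e' = e / (real DIM('a))"
  have e': "e' > 0" using assms(4) by (simp add: e'_def)
  have "continuous_on U (\<lambda>y. ?D y b)" if "b \<in> Basis" for b
    using assms(2) that by simp
  then have "isCont (\<lambda>y. ?D y b) x" if "b \<in> Basis" for b
    using that assms(1,3) continuous_on_eq_continuous_at by blast
  then have "\<exists>d>0. \<forall>y. dist y x < d \<longrightarrow> dist (?D y b) (?D x b) < e'" if "b \<in> Basis" for b
    using that e' unfolding continuous_at_eps_delta by blast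
  then have "\<forall>b\<in>Basis. \<exists>d>0. \<forall>y. dist y x < d \<longrightarrow> dist (?D y b) (?D x b) < e'"
    by blast
  from bchoice[OF this] obtain d1 where d1: "\<And>b. b \<in> Basis \<Longrightarrow> d1 b > 0"
    "\<And>b y. b \<in> Basis \<Longrightarrow> dist y x < d1 b \<Longrightarrow> dist (?D y b) (?D x b) < e'"
    by blast
  obtain d2 where d2: "d2 > 0" "ball x d2 \<subseteq> U"
    using assms(1,3) openE by blast
  define d where "d = Min (insert d2 (d1 ` Basis))"
  have d: "d > 0" "d \<le> d2"
    unfolding d_def using d1 d2 by auto
  have d_le: "d \<le> d1 b" if "b \<in> Basis" for b
    unfolding d_def using that by (intro Min_le) auto
  have der: "(X has_derivative ?D y) (at y)" if "y \<in> ball x d" for y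
  proof -
    have "y \<in> U"
      using that d d2 by auto
    then show ?thesis
      using Ck_on_Suc_has_derivative[of 0 X U] assms(2) by simp
  qed
  have lin: "linear (?D y)" if "y \<in> ball x d" for y
    using der[OF that] has_derivative_linear by blast
  have xd: "x \<in> ball x d" using d by simp
  have bl: "bounded_linear (?D x)"
    using der[OF xd] by (rule has_derivative_bounded_linear)
  have on: "onorm (\<lambda>h. ?D y h - ?D x h) \<le> e" if y: "y \<in> ball x d" for y
  proof (rule onorm_le)
    fix h
    have l: "linear (\<lambda>h. ?D y h - ?D x h)"
      using lin[OF y] lin[OF xd] by (intro linear_compose_sub)
    have "norm (?D y h - ?D x h) = norm (\<Sum>b\<in>Basis. (h \<bullet> b) *\<^sub>R (?D y b - ?D x b))"
      using linear_Basis_expansion[OF l, of h] by simp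
    also have "\<dots> \<le> (\<Sum>b\<in>(Basis::'a set). norm h * e')"
    proof (rule sum_norm_le)
      fix b :: 'a assume b: "b \<in> Basis"
      have "norm (?D y b - ?D x b) \<le> e'"
        using d1(2)[OF b, of y] d_le[OF b] y by (force simp: dist_norm norm_minus_commute)
      then show "norm ((h \<bullet> b) *\<^sub>R (?D y b - ?D x b)) \<le> norm h * e'"
        using Basis_le_norm[OF b, of h] by (auto intro!: mult_mono)
    qed
    also have "\<dots> = e * norm h"
      by (simp add: e'_def)
    finally show "norm (?D y h - ?D x h) \<le> e * norm h" .
  qed
  have "norm (X y - X z - ?D x (y - z)) \<le> e * norm (y - z)"
    if y: "y \<in> ball x d" "z \<in> ball x d" for y z
  proof -
    have "norm ((X y - ?D x y) - (X z - ?D x z)) \<le> e * norm (y - z)"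
    proof (rule differentiable_bound[where S = "ball x d" and f = "\<lambda>y. X y - ?D x y"])
      fix p assume p: "p \<in> ball x d"
      show "((\<lambda>y. X y - ?D x y) has_derivative (\<lambda>h. ?D p h - ?D x h)) (at p within ball x d)"
        by (intro has_derivative_diff has_derivative_at_withinI[OF der[OF p]]
            bounded_linear_imp_has_derivative[OF bl])
    qed (use y on in auto)
    then show ?thesis
      by (simp add: linear_diff[OF lin[OF xd]] algebra_simps)
  qed
  moreover have "ball x d \<subseteq> U"
    using d d2 by auto
  ultimately show ?thesis
    using d(1) by blast
qed

section \<open>Vector fields tangent to a closed set\<close>

text \<open>A Gronwall argument for a function that need not be differentiable: the distance to
  \<open>Z\<close> is bounded above by the distance to one fixed point \<open>p\<close> nearest at a
  given time, whose square is differentiable. The hypothesis on \<open>c'\<close> bounds half the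
  derivative of that square.\<close>

lemma infdist_curve_bound:
  fixes Z :: "'a::euclidean_space set" and c c' :: "real \<Rightarrow> 'a"
  assumes "closed Z" "c 0 \<in> Z" "L \<ge> 0" "e \<ge> 0"
    and der: "\<And>t. 0 \<le> t \<Longrightarrow> t \<le> T \<Longrightarrow> (c has_vector_derivative c' t) (at t)"
    and bd: "\<And>t p. 0 \<le> t \<Longrightarrow> t \<le> T \<Longrightarrow> p \<in> Z \<Longrightarrow> (\<forall>z\<in>Z. dist (c t) p \<le> dist (c t) z) \<Longrightarrow>
        c' t \<bullet> (c t - p) \<le> L * (norm (c t - p))\<^sup>2 + e * t * norm (c t - p)"
    and T: "0 \<le> T"
  shows "infdist (c T) Z \<le> exp ((L + 1) * T) * (e * T\<^sup>2)"
proof -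
  have Zne: "Z \<noteq> {}" using assms(2) by auto
  have cont: "continuous_on {0..T} c"
    by (intro continuous_at_imp_continuous_on ballI has_vector_derivative_continuous[OF der]) auto
  have main: "infdist (c T) Z \<le> exp ((L + 1) * T) * (\<eta> + e * T\<^sup>2)" if \<eta>: "\<eta> > 0" for \<eta>
  proof (rule ccontr)
    \<comment> \<open>The barrier grows at rate at least \<open>(L + 1) * M\<close>, more than the
      hypothesis permits, and \<eta> > 0 keeps it positive; this makes the comparison strict.
      Finally \<eta> tends to 0.\<close>
    define M where "M t = exp ((L + 1) * t) * (\<eta> + e * t\<^sup>2)" for t
    assume "\<not> ?thesis"
    then have hT: "infdist (c T) Z > M T"
      by (simp add: M_def)
    have M_pos: "M t > 0" for t
      using \<eta> assms(4) by (simp add: M_def add_pos_nonneg)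
    have M_der: "(M has_real_derivative ((L + 1) * M t + exp ((L + 1) * t) * (2 * e * t))) (at t)" for t
      unfolding M_def by (auto intro!: derivative_eq_intros simp: algebra_simps power2_eq_square)
    have M_cont: "continuous_on {0..T} M"
      unfolding M_def by (intro continuous_intros)
    define S where "S = {t\<in>{0..T}. infdist (c t) Z \<le> M t}"
    have "closed S"
      unfolding S_def
      by (intro continuous_on_closed_Collect_le continuous_on_infdist cont M_cont) auto
    moreover have S0: "0 \<in> S"
      using T assms(2) M_pos[of 0] by (simp add: S_def less_imp_le)
    moreover have bdd: "bdd_above S"
      unfolding S_def by (intro bdd_aboveI[of _ T]) auto
    ultimately have "Sup S \<in> S"
      by (intro closed_contains_Sup) auto
    \<comment> \<open>The last time at which the bound holds; the distance exceeds the barrier right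
      afterwards.\<close>
    define t where "t = Sup S"
    have t: "0 \<le> t" "t \<le> T" "infdist (c t) Z \<le> M t"
      using \<open>Sup S \<in> S\<close> by (auto simp: S_def t_def)
    have "t < T"
      using t hT by (cases "t = T") auto
    have above: "infdist (c s) Z > M s" if "t < s" "s \<le> T" for s
    proof (rule ccontr)
      assume "\<not> ?thesis"
      then have "s \<in> S"
        using that t by (auto simp: S_def)
      then show False
        using cSup_upper[OF _ bdd, of s] that by (simp add: t_def)
    qed
    obtain p where p: "p \<in> Z" "infdist (c t) Z = dist (c t) p"
      using infdist_attains_inf[OF assms(1) Zne] by blast
    have p': "\<forall>z\<in>Z. dist (c t) p \<le> dist (c t) z"
      using infdist_le p by metis
    \<comment> \<open>With \<open>p\<close> frozen at its choice for time \<open>t\<close>,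
      \<open>g t \<le> 0\<close>, while \<open>g > 0\<close> just after \<open>t\<close> because the
      distance to \<open>p\<close> dominates the distance to \<open>Z\<close>. A negative derivative
      at \<open>t\<close> contradicts this.\<close>
    define g where "g s = (c s - p) \<bullet> (c s - p) - (M s)\<^sup>2" for s
    define g' where "g' = 2 * (c' t \<bullet> (c t - p)) - 2 * M t * ((L + 1) * M t + exp ((L + 1) * t) * (2 * e * t))"
    have cp: "((\<lambda>s. (c s - p) \<bullet> (c s - p)) has_real_derivative 2 * (c' t \<bullet> (c t - p))) (at t)"
      using der[OF t(1,2)] unfolding has_vector_derivative_def has_field_derivative_def
      by (auto intro!: derivative_eq_intros ext simp: inner_commute algebra_simps)
    have "(g has_real_derivative g') (at t)"
      unfolding g_def g'_def
      by (rule DERIV_diff[OF cp]) (auto intro!: derivative_eq_intros M_der)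
    moreover have "g' < 0"
    proof -
      let ?h = "norm (c t - p)"
      have h: "0 \<le> ?h" "?h \<le> M t"
        using t(3) p(2) by (auto simp: dist_norm)
      have 1: "L * ?h\<^sup>2 \<le> L * (M t)\<^sup>2"
        using h assms(3) by (intro mult_left_mono power_mono) auto
      have 2: "e * t * ?h \<le> e * t * M t"
        using h assms(4) t by (intro mult_left_mono) auto
      have "1 \<le> exp ((L + 1) * t)"
        using assms(3) t by simp
      then have 3: "e * t * M t \<le> exp ((L + 1) * t) * (e * t * M t)"
        using M_pos[of t] assms(4) t(1) mult_right_mono[of 1 "exp ((L + 1) * t)" "e * t * M t"] by simp
      have 4: "0 \<le> exp ((L + 1) * t) * (e * t * M t)"
        using M_pos[of t] assms(4) t(1) by auto
      have "c' t \<bullet> (c t - p) \<le> L * (M t)\<^sup>2 + exp ((L + 1) * t) * (e * t * M t)"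
        using bd[OF t(1,2) p(1) p'] 1 2 3 by linarith
      moreover have "g' = 2 * (c' t \<bullet> (c t - p)) - 2 * (L * (M t)\<^sup>2) - 2 * (M t)\<^sup>2 - 4 * (exp ((L + 1) * t) * (e * t * M t))"
        unfolding g'_def by (simp add: algebra_simps power2_eq_square)
      moreover have "(M t)\<^sup>2 > 0"
        using M_pos[of t] by simp
      ultimately show ?thesis
        using 4 by linarith
    qed
    ultimately obtain d where d: "d > 0" "\<And>h. h > 0 \<Longrightarrow> h < d \<Longrightarrow> g (t + h) < g t"
      using DERIV_neg_dec_right by blast
    define h where "h = min (d / 2) (T - t)"
    have h: "h > 0" "h < d" "t + h \<le> T" "t < t + h"
      using d(1) \<open>t < T\<close> by (auto simp: h_def)
    have "M (t + h) < norm (c (t + h) - p)"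
      using above[OF h(4,3)] infdist_le[OF p(1), of "c (t + h)"] by (simp add: dist_norm)
    then have "(M (t + h))\<^sup>2 < (norm (c (t + h) - p))\<^sup>2"
      using M_pos[of "t + h"] by (intro power_strict_mono) auto
    then have "g (t + h) > 0"
      by (simp add: g_def power2_norm_eq_inner)
    moreover have "(norm (c t - p))\<^sup>2 \<le> (M t)\<^sup>2"
      using t(3) p(2) by (intro power_mono) (auto simp: dist_norm)
    then have "g t \<le> 0"
      by (simp add: g_def power2_norm_eq_inner)
    ultimately show False
      using d(2)[OF h(1,2)] by simp
  qed
  have "((\<lambda>\<eta>. exp ((L + 1) * T) * (\<eta> + e * T\<^sup>2)) \<longlongrightarrow> exp ((L + 1) * T) * (0 + e * T\<^sup>2)) (at_right 0)"
    by (intro tendsto_intros)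
  then have "infdist (c T) Z \<le> exp ((L + 1) * T) * (0 + e * T\<^sup>2)"
    by (rule tendsto_lowerbound) (use main in \<open>auto simp: eventually_at_right_less eventually_at_filter\<close>)
  then show ?thesis by simp
qed

text \<open>The vectors \<open>c - y\<close> are the proximal normals of \<open>Z\<close> at \<open>y\<close>.\<close>
definition tangential :: "'a::real_inner set \<Rightarrow> 'a set \<Rightarrow> ('a \<Rightarrow> 'a) \<Rightarrow> bool" where
  "tangential Z W X \<longleftrightarrow> (\<forall>y\<in>Z \<inter> W. \<forall>c. (\<forall>z\<in>Z. dist c y \<le> dist c z) \<longrightarrow> X y \<bullet> (c - y) = 0)"

text \<open>\<open>Z\<close> contains points \<open>y + t p(y) + t\<^sup>2 q + o(t\<^sup>2)\<close>, uniformly for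
  \<open>y\<close> in \<open>Z\<close> near \<open>x\<close>; phrasing this with sequences makes the
  expansions compose.\<close>
definition second_order :: "'a::real_inner set \<Rightarrow> 'a \<Rightarrow> ('a \<Rightarrow> 'a) \<Rightarrow> 'a \<Rightarrow> bool" where
  "second_order Z x p q \<longleftrightarrow> (\<forall>xs ts. (\<forall>n. xs n \<in> Z) \<and> xs \<longlonglongrightarrow> x \<and> (\<forall>n. ts n > (0::real)) \<and> ts \<longlonglongrightarrow> 0 \<longrightarrow>
     (\<exists>zs. (\<forall>n. zs n \<in> Z) \<and> (\<lambda>n. (zs n - xs n - ts n *\<^sub>R p (xs n)) /\<^sub>R (ts n)\<^sup>2) \<longlonglongrightarrow> q))"

text \<open>No flow of \<open>X\<close> is needed: its second-order Taylor curve stays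
  \<open>o(t\<^sup>2)\<close>-close to \<open>Z\<close> by a Gronwall argument for the distance to \<open>Z\<close>.\<close>
lemma tangential_imp_infdist:
  fixes X :: "'a::euclidean_space \<Rightarrow> 'a"
  assumes "closed Z" "open W" "x \<in> Z \<inter> W" "Ck_on 1 X W" "tangential Z W X" "e > 0"
  defines "A \<equiv> (1/2) *\<^sub>R frechet_derivative X (at x) (X x)"
  obtains \<rho> \<tau> where "\<rho> > 0" "\<tau> > 0"
    "\<And>y t. y \<in> Z \<Longrightarrow> y \<in> ball x \<rho> \<Longrightarrow> 0 < t \<Longrightarrow> t < \<tau> \<Longrightarrow>
       infdist (y + t *\<^sub>R X y + t\<^sup>2 *\<^sub>R A) Z \<le> e * t\<^sup>2"
proof -
  define D where "D = frechet_derivative X (at x)"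
  have blD: "bounded_linear D"
    unfolding D_def using assms(3,4) has_derivative_bounded_linear Ck_on_Suc_has_derivative
    by (metis IntD2 One_nat_def)
  obtain B where B: "B > 0" "\<And>h. norm (D h) \<le> B * norm h"
    using bounded_linear.pos_bounded[OF blD] by (metis mult.commute)
  \<comment> \<open>Three error terms of size \<open>e1 * s\<close> arise in the velocity below, and
    the exponential factor costs at most 2, hence the 6.\<close>
  define e1 where "e1 = e / 6"
  define M where "M = norm (X x) + 1"
  define e' where "e' = e1 / (M + 1)"
  have pos: "e1 > 0" "M > 0"
    using assms(6) by (auto simp: e1_def M_def add_nonneg_pos)
  then have pos: "e1 > 0" "M > 0" "e' > 0"
    by (auto simp: e'_def)
  obtain d where d: "d > 0" "ball x d \<subseteq> W"
    "\<And>y z. y \<in> ball x d \<Longrightarrow> z \<in> ball x d \<Longrightarrow> norm (X y - X z - D (y - z)) \<le> e' * norm (y - z)"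
    using C1_strict_derivative[OF assms(2,4) _ pos(3), of x] assms(3) unfolding D_def by blast
  define L where "L = B + e'"
  have L: "L > 0" using B pos by (simp add: L_def)
  have lip: "norm (X y - X z) \<le> L * norm (y - z)" if "y \<in> ball x d" "z \<in> ball x d" for y z
    using norm_triangle_sub[of "X y - X z" "D (y - z)"] d(3)[OF that] B(2)[of "y - z"]
    by (simp add: L_def algebra_simps)
  \<comment> \<open>\<rho> keeps \<open>X y\<close> close to \<open>X x\<close> for all base points.
    \<tau> keeps the curve and its nearest points inside \<open>ball x d\<close>, and makes
    \<open>exp ((L + 1) * t) \<le> 2\<close> and \<open>t * norm (D A) \<le> e1\<close>.\<close>
  define \<rho> where "\<rho> = min (d / 4) (min (1 / L) (e1 / (B * L)))"
  define \<tau> where "\<tau> = min (min 1 (ln 2 / (L + 1))) (min (d / (4 * (M + norm A))) (min (1 / (norm A + 1)) (e1 / (B * (norm A + 1)))))"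
  have MA: "M + norm A > 0" "norm A + 1 > 0"
    using pos by (auto simp: add_pos_nonneg add_nonneg_pos)
  have \<rho>: "\<rho> > 0" "\<rho> \<le> d / 4" "L * \<rho> \<le> 1" "B * (L * \<rho>) \<le> e1"
  proof -
    show "\<rho> > 0" using d pos L B by (simp add: \<rho>_def)
    show "\<rho> \<le> d / 4" unfolding \<rho>_def by (rule min.cobounded1)
    have "L * \<rho> \<le> L * (1 / L)" "(B * L) * \<rho> \<le> (B * L) * (e1 / (B * L))"
      unfolding \<rho>_def using L B by (intro mult_left_mono; simp)+
    then show "L * \<rho> \<le> 1" "B * (L * \<rho>) \<le> e1"
      using L B by (auto simp: mult.assoc)
  qed
  have \<tau>0: "\<tau> > 0"
    using d pos L B MA by (auto simp: \<tau>_def)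
  have \<tau>: "t < 1" "(L + 1) * t < ln 2" "t * (M + norm A) < d / 4" "t * norm A \<le> 1" "t * (B * norm A) \<le> e1"
    if "0 < t" "t < \<tau>" for t
  proof -
    have *: "t < 1" "t < ln 2 / (L + 1)" "t < d / (4 * (M + norm A))" "t < 1 / (norm A + 1)" "t < e1 / (B * (norm A + 1))"
      using that by (auto simp: \<tau>_def)
    then show "t < 1" "(L + 1) * t < ln 2" "t * (M + norm A) < d / 4"
      using L MA by (auto simp: pos_less_divide_eq algebra_simps)
    have "t * (norm A + 1) < 1" "t * (B * (norm A + 1)) < e1"
      using *(4,5) MA B by (auto simp: pos_less_divide_eq)
    moreover have "t * norm A \<le> t * (norm A + 1)" "t * (B * norm A) \<le> t * (B * (norm A + 1))"
      using that B by (auto intro!: mult_left_mono)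
    ultimately show "t * norm A \<le> 1" "t * (B * norm A) \<le> e1"
      by linarith+
  qed
  have "infdist (y + t *\<^sub>R X y + t\<^sup>2 *\<^sub>R A) Z \<le> e * t\<^sup>2"
    if y: "y \<in> Z" "y \<in> ball x \<rho>" and t: "0 < t" "t < \<tau>" for y t
  proof -
    define c where "c s = y + s *\<^sub>R X y + s\<^sup>2 *\<^sub>R A" for s
    define c' where "c' s = X y + (2 * s) *\<^sub>R A" for s
    have yd: "y \<in> ball x d" using y \<rho> d(1) by auto
    have Xyx: "norm (X y - X x) \<le> L * \<rho>"
    proof -
      have "norm (X y - X x) \<le> L * norm (y - x)"
        using lip[OF yd] d(1) by auto
      also have "\<dots> \<le> L * \<rho>"
        using y L by (intro mult_left_mono) (auto simp: dist_norm norm_minus_commute)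
      finally show ?thesis .
    qed
    then have Xy: "norm (X y) \<le> M"
      using \<rho>(3) norm_triangle_sub[of "X y" "X x"] by (simp add: M_def)
    have key: "c' s \<bullet> (c s - p) \<le> L * (norm (c s - p))\<^sup>2 + (3 * e1) * s * norm (c s - p)"
      if s: "0 \<le> s" "s \<le> t" and p: "p \<in> Z" "\<forall>z\<in>Z. dist (c s) p \<le> dist (c s) z" for s p
    proof (cases "s = 0")
      case True
      then have "dist (c s) p \<le> dist (c s) y" "c s = y"
        using p y by (auto simp: c_def)
      then show ?thesis by simp
    next
      case False
      then have s0: "0 < s" "s < \<tau>" using s t by auto
      have cy: "c s - y = s *\<^sub>R (X y + s *\<^sub>R A)"
        by (simp add: c_def algebra_simps power2_eq_square)
      have "norm (X y + s *\<^sub>R A) \<le> M + s * norm A"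
        using Xy s0 norm_triangle_ineq[of "X y" "s *\<^sub>R A"] by simp
      moreover have "s * norm A \<le> norm A" "s * norm A \<le> 1"
        using \<tau>[OF s0] s0 by (auto intro: mult_left_le_one_le)
      ultimately have n1: "norm (X y + s *\<^sub>R A) \<le> M + 1" "norm (X y + s *\<^sub>R A) \<le> M + norm A"
        by auto
      have cy1: "norm (c s - y) \<le> s * (M + 1)"
        unfolding cy using n1(1) s0 by simp
      have cy2: "norm (c s - y) < d / 4"
      proof -
        have "norm (c s - y) \<le> s * (M + norm A)"
          unfolding cy using mult_left_mono[OF n1(2), of s] s0 by simp
        then show ?thesis
          using \<tau>(3)[OF s0] by linarith
      qed
      have csd: "c s \<in> ball x d" "p \<in> ball x d"
      proof -
        have "dist x (c s) < d / 2"
          using dist_triangle[of x "c s" y] y(2) \<rho>(2) cy2 by (simp add: dist_norm norm_minus_commute)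
        moreover have "dist (c s) p < d / 4"
          using p(2) y(1) cy2 by (metis dist_norm le_less_trans)
        ultimately show "c s \<in> ball x d" "p \<in> ball x d"
          using dist_triangle[of x p "c s"] d(1) by auto
      qed
      have tang: "X p \<bullet> (c s - p) = 0"
        using assms(5) p csd(2) d(2) unfolding tangential_def by blast
      define R where "R = X (c s) - X y - D (c s - y)"
      have R: "norm R \<le> s * e1"
      proof -
        have "norm R \<le> e' * norm (c s - y)"
          unfolding R_def using d(3) csd yd by blast
        also have "\<dots> \<le> e' * (s * (M + 1))"
          using cy1 pos by (intro mult_left_mono) auto
        also have "\<dots> = s * e1"
          using pos by (simp add: e'_def)
        finally show ?thesis .
      qed
      have Dlin: "linear D" using blD bounded_linear.linear by blast
      have DA: "2 *\<^sub>R A = D (X x)"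
        by (simp add: A_def D_def)
      \<comment> \<open>The defect of the curve as an integral curve: the base point
        \<open>y\<close> in place of \<open>x\<close>, the \<open>A\<close> term carried through
        \<open>D\<close>, and the linearization remainder. Each is at most \<open>s * e1\<close>;
        the choice of \<open>A\<close> removes everything else of order \<open>s\<close>.\<close>
      have Delta: "c' s - X (c s) = s *\<^sub>R D (X x - X y) - (s * s) *\<^sub>R D A - R"
      proof -
        have "D (c s - y) = s *\<^sub>R D (X y) + (s * s) *\<^sub>R D A"
          unfolding cy by (simp add: linear_cmul[OF Dlin] linear_add[OF Dlin] algebra_simps)
        moreover have "c' s = X y + s *\<^sub>R D (X x)"
          unfolding c'_def DA[symmetric] by simp
        ultimately show ?thesis
          by (simp add: R_def linear_diff[OF Dlin] algebra_simps)
      qed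
      have "norm (D (X x - X y)) \<le> e1"
      proof -
        have "norm (D (X x - X y)) \<le> B * norm (X y - X x)"
          using B(2)[of "X x - X y"] by (simp add: norm_minus_commute)
        also have "\<dots> \<le> B * (L * \<rho>)"
          using Xyx B by (intro mult_left_mono) auto
        finally show ?thesis using \<rho>(4) by linarith
      qed
      then have T1: "norm (s *\<^sub>R D (X x - X y)) \<le> s * e1"
        using s0 by simp
      have "s * norm (D A) \<le> e1"
        using mult_left_mono[OF B(2)[of A], of s] \<tau>(5)[OF s0] s0 by linarith
      then have T2: "norm ((s * s) *\<^sub>R D A) \<le> s * e1"
        using s0 by (simp add: mult.assoc)
      have "norm (c' s - X (c s)) \<le> s * e1 + s * e1 + s * e1"
        unfolding Delta by (intro norm_triangle_le_diff order_trans[OF norm_triangle_ineq4] add_mono T1 T2 R)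
      then have Dn: "norm (c' s - X (c s)) \<le> 3 * e1 * s"
        by (simp add: algebra_simps)
      \<comment> \<open>Inserting \<open>X p\<close>, which is orthogonal to \<open>c s - p\<close>,
        costs nothing and leaves a Lipschitz difference of \<open>X\<close>.\<close>
      have "c' s \<bullet> (c s - p) = (c' s - X (c s)) \<bullet> (c s - p) + (X (c s) - X p) \<bullet> (c s - p)"
        using tang by (simp add: inner_diff_left)
      also have "(c' s - X (c s)) \<bullet> (c s - p) \<le> 3 * e1 * s * norm (c s - p)"
        by (rule order_trans[OF norm_cauchy_schwarz mult_right_mono[OF Dn norm_ge_zero]])
      also have "(X (c s) - X p) \<bullet> (c s - p) \<le> L * norm (c s - p) * norm (c s - p)"
        by (rule order_trans[OF norm_cauchy_schwarz mult_right_mono[OF lip[OF csd] norm_ge_zero]])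
      finally show ?thesis by (simp add: power2_eq_square algebra_simps)
    qed
    have "infdist (c t) Z \<le> exp ((L + 1) * t) * ((3 * e1) * t\<^sup>2)"
    proof (rule infdist_curve_bound[OF assms(1), where c' = c'])
      show "(c has_vector_derivative c' s) (at s)" for s
        unfolding c_def c'_def by (auto intro!: derivative_eq_intros simp: power2_eq_square scaleR_2 algebra_simps)
    qed (use y L pos t key in \<open>auto simp: c_def\<close>)
    also have "exp ((L + 1) * t) * ((3 * e1) * t\<^sup>2) \<le> 2 * ((3 * e1) * t\<^sup>2)"
    proof (rule mult_right_mono)
      have "exp ((L + 1) * t) \<le> exp (ln 2)"
        using \<tau>(2)[OF t] by (subst exp_le_cancel_iff) simp
      then show "exp ((L + 1) * t) \<le> 2" by simp
    qed (use pos in auto)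
    also have "\<dots> = e * t\<^sup>2" by (simp add: e1_def)
    finally show ?thesis by (simp add: c_def)
  qed
  then show ?thesis
    using that \<rho>(1) \<tau>0 by blast
qed

text \<open>The required points of \<open>Z\<close> are nearest points to the Taylor curve; the
  bound \<open>e * t\<^sup>2\<close> for every \<open>e\<close> says that they miss it by
  \<open>o(t\<^sup>2)\<close>.\<close>

lemma tangential_imp_second_order:
  fixes X :: "'a::euclidean_space \<Rightarrow> 'a"
  assumes "closed Z" "open W" "x \<in> Z \<inter> W" "Ck_on 1 X W" "tangential Z W X"
  shows "second_order Z x X ((1/2) *\<^sub>R frechet_derivative X (at x) (X x))"
  unfolding second_order_def
proof (intro allI impI, elim conjE)
  let ?A = "(1/2) *\<^sub>R frechet_derivative X (at x) (X x)"
  fix xs ts assume *: "\<forall>n. xs n \<in> Z" "xs \<longlonglongrightarrow> x" "\<forall>n. ts n > (0::real)" "ts \<longlonglongrightarrow> 0"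
  let ?c = "\<lambda>n. xs n + ts n *\<^sub>R X (xs n) + (ts n)\<^sup>2 *\<^sub>R ?A"
  have "\<exists>z\<in>Z. infdist (?c n) Z = dist (?c n) z" for n
    using infdist_attains_inf[OF assms(1), of "?c n"] assms(3) by (metis IntD1 empty_iff)
  then obtain zs where zs: "\<And>n. zs n \<in> Z" "\<And>n. infdist (?c n) Z = dist (?c n) (zs n)"
    by metis
  have "(\<lambda>n. (zs n - xs n - ts n *\<^sub>R X (xs n)) /\<^sub>R (ts n)\<^sup>2) \<longlonglongrightarrow> ?A"
  proof (rule tendstoI)
    fix e :: real assume e: "e > 0"
    then have "e / 2 > 0" by simp
    from tangential_imp_infdist[OF assms this] obtain \<rho> \<tau> where rt: "\<rho> > 0" "\<tau> > 0"
      "\<And>y t. y \<in> Z \<Longrightarrow> y \<in> ball x \<rho> \<Longrightarrow> 0 < t \<Longrightarrow> t < \<tau> \<Longrightarrow>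
         infdist (y + t *\<^sub>R X y + t\<^sup>2 *\<^sub>R ?A) Z \<le> (e / 2) * t\<^sup>2"
      by blast
    have "eventually (\<lambda>n. dist (xs n) x < \<rho>) sequentially" "eventually (\<lambda>n. ts n < \<tau>) sequentially"
      using tendstoD[OF *(2) rt(1)] order_tendstoD(2)[OF *(4) rt(2)] by auto
    then show "eventually (\<lambda>n. dist ((zs n - xs n - ts n *\<^sub>R X (xs n)) /\<^sub>R (ts n)\<^sup>2) ?A < e) sequentially"
    proof eventually_elim
      case (elim n)
      have tp: "(ts n)\<^sup>2 > 0" using *(3) by (simp add: less_imp_neq[symmetric])
      have "dist (?c n) (zs n) \<le> (e / 2) * (ts n)\<^sup>2"
        using rt(3)[of "xs n" "ts n"] elim * zs(2)[of n] by (simp add: dist_commute)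
      moreover have "(zs n - xs n - ts n *\<^sub>R X (xs n)) /\<^sub>R (ts n)\<^sup>2 - ?A = (zs n - ?c n) /\<^sub>R (ts n)\<^sup>2"
        using tp by (simp add: algebra_simps)
      ultimately have "dist ((zs n - xs n - ts n *\<^sub>R X (xs n)) /\<^sub>R (ts n)\<^sup>2) ?A \<le> ((e / 2) * (ts n)\<^sup>2) / (ts n)\<^sup>2"
        by (simp only: dist_norm norm_scaleR norm_minus_commute[of "?c n"])
           (use tp in \<open>simp add: divide_simps norm_minus_commute mult.commute\<close>)
      then show ?case using tp e by simp
    qed
  qed
  then show "\<exists>zs. (\<forall>n. zs n \<in> Z) \<and> (\<lambda>n. (zs n - xs n - ts n *\<^sub>R X (xs n)) /\<^sub>R (ts n)\<^sup>2) \<longlonglongrightarrow> ?A"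
    using zs by blast
qed

text \<open>The end points of the first move form an admissible starting sequence for the second.
  The mixed term comes from evaluating \<open>p2\<close> at the displaced points:
  \<open>p2 (ys n) - p2 (xs n)\<close> is \<open>ts n\<close> times the derivative of
  \<open>p2\<close> in direction \<open>p1 x\<close>, up to \<open>o(ts n)\<close>.\<close>

lemma second_order_compose:
  fixes p1 p2 :: "'a::euclidean_space \<Rightarrow> 'a"
  assumes so: "second_order Z x p1 q1" "second_order Z x p2 q2"
    and W: "open W" "x \<in> W" "continuous_on W p1" "Ck_on 1 p2 W"
  shows "second_order Z x (\<lambda>y. p1 y + p2 y) (q1 + q2 + frechet_derivative p2 (at x) (p1 x))"
  unfolding second_order_def
proof (intro allI impI, elim conjE)
  let ?D = "frechet_derivative p2 (at x)"
  fix xs ts assume *: "\<forall>n. xs n \<in> Z" "xs \<longlonglongrightarrow> x" "\<forall>n. ts n > (0::real)" "ts \<longlonglongrightarrow> 0"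
  have bl: "bounded_linear ?D"
    using W by (metis One_nat_def Ck_on_Suc_has_derivative has_derivative_bounded_linear)
  note lin = bounded_linear.linear[OF bl]
  obtain ys where ys: "\<forall>n. ys n \<in> Z" "(\<lambda>n. (ys n - xs n - ts n *\<^sub>R p1 (xs n)) /\<^sub>R (ts n)\<^sup>2) \<longlonglongrightarrow> q1"
    using so(1) * unfolding second_order_def by blast
  have p1c: "(\<lambda>n. p1 (xs n)) \<longlonglongrightarrow> p1 x"
    using W(1-3) *(2) continuous_on_eq_continuous_at isCont_tendsto_compose by blast
  let ?d = "\<lambda>n. (ys n - xs n) /\<^sub>R ts n"
  have d_eq: "?d n = ts n *\<^sub>R ((ys n - xs n - ts n *\<^sub>R p1 (xs n)) /\<^sub>R (ts n)\<^sup>2) + p1 (xs n)" for n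
  proof -
    have "ts n *\<^sub>R ((ys n - xs n - ts n *\<^sub>R p1 (xs n)) /\<^sub>R (ts n)\<^sup>2) = (ys n - xs n - ts n *\<^sub>R p1 (xs n)) /\<^sub>R ts n"
      using *(3)[rule_format, of n] by (simp add: power2_eq_square)
    also have "\<dots> = ?d n - p1 (xs n)"
      using *(3)[rule_format, of n] by (simp add: scaleR_diff_right)
    finally show ?thesis by simp
  qed
  have dlim: "?d \<longlonglongrightarrow> p1 x"
    unfolding d_eq using tendsto_add[OF tendsto_scaleR[OF *(4) ys(2)] p1c] by simp
  have "(\<lambda>n. xs n + ts n *\<^sub>R ?d n) \<longlonglongrightarrow> x + 0 *\<^sub>R p1 x"
    by (intro tendsto_intros * dlim)
  moreover have "xs n + ts n *\<^sub>R ?d n = ys n" for n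
    using *(3)[rule_format, of n] by simp
  ultimately have ysx: "ys \<longlonglongrightarrow> x" by simp
  obtain zs where zs: "\<forall>n. zs n \<in> Z" "(\<lambda>n. (zs n - ys n - ts n *\<^sub>R p2 (ys n)) /\<^sub>R (ts n)\<^sup>2) \<longlonglongrightarrow> q2"
    using so(2) ys(1) ysx *(3,4) unfolding second_order_def by blast
  have third: "(\<lambda>n. (p2 (ys n) - p2 (xs n)) /\<^sub>R ts n) \<longlonglongrightarrow> ?D (p1 x)"
  proof -
    \<comment> \<open>Strict differentiability is essential, since in general neither
      \<open>xs n\<close> nor \<open>ys n\<close> equals \<open>x\<close>.\<close>
    have "(\<lambda>n. (p2 (ys n) - p2 (xs n) - ?D (ys n - xs n)) /\<^sub>R ts n) \<longlonglongrightarrow> 0"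
    proof (rule tendstoI)
      fix e :: real assume e: "e > 0"
      define K where "K = norm (p1 x) + 1"
      have K: "K > 0" by (simp add: K_def add_nonneg_pos)
      then have eK: "e / K > 0" using e by simp
      obtain d where d: "d > 0" "ball x d \<subseteq> W"
        "\<And>y z. y \<in> ball x d \<Longrightarrow> z \<in> ball x d \<Longrightarrow> norm (p2 y - p2 z - ?D (y - z)) \<le> (e / K) * norm (y - z)"
        using C1_strict_derivative[OF W(1,4,2) eK] by blast
      have "eventually (\<lambda>n. norm (?d n) < K) sequentially"
        using order_tendstoD(2)[OF tendsto_norm[OF dlim], of K] by (simp add: K_def)
      moreover have "eventually (\<lambda>n. dist (ys n) x < d) sequentially" "eventually (\<lambda>n. dist (xs n) x < d) sequentially"
        using tendstoD[OF ysx d(1)] tendstoD[OF *(2) d(1)] by auto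
      ultimately show "eventually (\<lambda>n. dist ((p2 (ys n) - p2 (xs n) - ?D (ys n - xs n)) /\<^sub>R ts n) 0 < e) sequentially"
      proof eventually_elim
        case (elim n)
        have t: "ts n > 0" using *(3) by simp
        have "norm (p2 (ys n) - p2 (xs n) - ?D (ys n - xs n)) \<le> (e / K) * norm (ys n - xs n)"
          using elim by (intro d(3)) (auto simp: dist_commute)
        then have "norm ((p2 (ys n) - p2 (xs n) - ?D (ys n - xs n)) /\<^sub>R ts n) \<le> (e / K) * norm (?d n)"
          using mult_left_mono[of _ _ "inverse (ts n)"] t by (fastforce simp: mult.left_commute)
        also have "\<dots> < (e / K) * K"
          using elim e K by (intro mult_strict_left_mono) auto
        finally show ?case using K by simp
      qed
    qed
    moreover have "(\<lambda>n. ?D (?d n)) \<longlonglongrightarrow> ?D (p1 x)"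
      by (rule bounded_linear.tendsto[OF bl dlim])
    ultimately have "(\<lambda>n. (p2 (ys n) - p2 (xs n) - ?D (ys n - xs n)) /\<^sub>R ts n + ?D (?d n)) \<longlonglongrightarrow> 0 + ?D (p1 x)"
      by (rule tendsto_add)
    moreover have "(p2 (ys n) - p2 (xs n) - ?D (ys n - xs n)) /\<^sub>R ts n + ?D (?d n) = (p2 (ys n) - p2 (xs n)) /\<^sub>R ts n" for n
      by (simp only: linear_cmul[OF lin] scaleR_add_right[symmetric] diff_add_cancel)
    ultimately show ?thesis by simp
  qed
  have "(\<lambda>n. (ys n - xs n - ts n *\<^sub>R p1 (xs n)) /\<^sub>R (ts n)\<^sup>2 + (zs n - ys n - ts n *\<^sub>R p2 (ys n)) /\<^sub>R (ts n)\<^sup>2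
      + (p2 (ys n) - p2 (xs n)) /\<^sub>R ts n) \<longlonglongrightarrow> q1 + q2 + ?D (p1 x)"
    by (intro tendsto_add ys zs third)
  moreover have "(ys n - xs n - ts n *\<^sub>R p1 (xs n)) /\<^sub>R (ts n)\<^sup>2 + (zs n - ys n - ts n *\<^sub>R p2 (ys n)) /\<^sub>R (ts n)\<^sup>2
      + (p2 (ys n) - p2 (xs n)) /\<^sub>R ts n = (zs n - xs n - ts n *\<^sub>R (p1 (xs n) + p2 (xs n))) /\<^sub>R (ts n)\<^sup>2" for n
  proof -
    have "(p2 (ys n) - p2 (xs n)) /\<^sub>R ts n = (ts n *\<^sub>R (p2 (ys n) - p2 (xs n))) /\<^sub>R (ts n)\<^sup>2"
      using *(3)[rule_format, of n] by (simp add: power2_eq_square)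
    then show ?thesis
      by (simp only: scaleR_add_right[symmetric]) (simp add: algebra_simps)
  qed
  ultimately show "\<exists>zs. (\<forall>n. zs n \<in> Z) \<and>
      (\<lambda>n. (zs n - xs n - ts n *\<^sub>R (p1 (xs n) + p2 (xs n))) /\<^sub>R (ts n)\<^sup>2) \<longlonglongrightarrow> q1 + q2 + ?D (p1 x)"
    using zs by auto
qed

lemma tangential_uminus: "tangential Z W X \<Longrightarrow> tangential Z W (\<lambda>y. - X y)"
  by (simp add: tangential_def)

text \<open>Going along \<open>X\<close>, \<open>Y\<close>, \<open>- X\<close>, \<open>- Y\<close> for time \<open>t\<close> each moves a point by
  \<open>t\<^sup>2 [X, Y] + o(t\<^sup>2)\<close>.\<close>
lemma second_order_bracket:
  fixes X Y :: "'a::euclidean_space \<Rightarrow> 'a"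
  assumes Z: "closed Z" and W: "open W" "x \<in> Z \<inter> W"
    and X: "Ck_on 1 X W" "tangential Z W X" and Y: "Ck_on 1 Y W" "tangential Z W Y"
  shows "second_order Z x (\<lambda>y. 0) (frechet_derivative Y (at x) (X x) - frechet_derivative X (at x) (Y x))"
proof -
  let ?DX = "frechet_derivative X (at x)" and ?DY = "frechet_derivative Y (at x)"
  have x: "x \<in> W" using W by simp
  have dX: "(X has_derivative ?DX) (at x)" and dY: "(Y has_derivative ?DY) (at x)"
    using Ck_on_Suc_has_derivative[of 0 _ W] X(1) Y(1) x by auto
  have lX: "linear ?DX" and lY: "linear ?DY"
    using dX dY has_derivative_linear by auto
  have mX: "frechet_derivative (\<lambda>y. - X y) (at x) = (\<lambda>h. - ?DX h)"
    using has_derivative_minus[OF dX] by (metis frechet_derivative_at)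
  have mY: "frechet_derivative (\<lambda>y. - Y y) (at x) = (\<lambda>h. - ?DY h)"
    using has_derivative_minus[OF dY] by (metis frechet_derivative_at)
  note CX = Ck_on_minus[OF W(1) X(1)] and CY = Ck_on_minus[OF W(1) Y(1)]
  note tX = tangential_imp_second_order[OF Z W X]
  note tY = tangential_imp_second_order[OF Z W Y]
  note tmX = tangential_imp_second_order[OF Z W CX tangential_uminus[OF X(2)]]
  note tmY = tangential_imp_second_order[OF Z W CY tangential_uminus[OF Y(2)]]
  note c = Ck_on_continuous
  note s1 = second_order_compose[OF tX tY W(1) x c[OF X(1)] Y(1)]
  note s2 = second_order_compose[OF s1 tmX W(1) x continuous_on_add[OF c[OF X(1)] c[OF Y(1)]] CX]
  have cY: "continuous_on W (\<lambda>y. X y + Y y + - X y)"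
    using c[OF Y(1)] by simp
  note s3 = second_order_compose[OF s2 tmY W(1) x cY CY]
  \<comment> \<open>Read \<open>a = X'X\<close>, \<open>b = Y'Y\<close>, \<open>c = Y'X\<close>,
    \<open>d = X'Y\<close>. The halves come from the four single moves, \<open>c\<close> from
    \<open>Y\<close> after \<open>X\<close>, \<open>- a - d\<close> from \<open>- X\<close> after
    \<open>X + Y\<close>, and \<open>- b\<close> from \<open>- Y\<close> after the net displacement
    \<open>Y\<close>.\<close>
  have eq: "(1/2) *\<^sub>R a + (1/2) *\<^sub>R b + c + (1/2) *\<^sub>R a + (- a - d) + (1/2) *\<^sub>R b - b = c - d" for a b c d :: 'a
  proof -
    have "(1/2) *\<^sub>R a + (1/2) *\<^sub>R a = a" "(1/2) *\<^sub>R b + (1/2) *\<^sub>R b = b"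
      by (simp_all flip: scaleR_add_left)
    then show ?thesis by (simp add: algebra_simps)
  qed
  show ?thesis
    using s3 by (simp add: mX mY linear_neg[OF lX] linear_neg[OF lY] linear_add[OF lX] eq)
qed

text \<open>A displacement of order \<open>t\<^sup>2\<close> along the bracket stays in
  \<open>Z\<close>, hence outside the open ball about \<open>c\<close> through \<open>y\<close>, so
  the bracket cannot point into that ball. Exchanging \<open>X\<close> and \<open>Y\<close> changes
  its sign and gives the opposite inequality.\<close>

lemma tangential_bracket:
  fixes X Y :: "real ^ 'm \<Rightarrow> real ^ 'm"
  assumes Z: "closed Z" and W: "open W"
    and X: "Ck_on 1 X W" "tangential Z W X" and Y: "Ck_on 1 Y W" "tangential Z W Y"
  shows "tangential Z W (lie_bracket X Y)"
  unfolding tangential_def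
proof (intro ballI allI impI)
  fix y c assume y: "y \<in> Z \<inter> W" and near: "\<forall>z\<in>Z. dist c y \<le> dist c z"
  have le: "q \<bullet> (c - y) \<le> 0" if so: "second_order Z y (\<lambda>y. 0) q" for q
  proof -
    let ?ts = "\<lambda>n. inverse (real (Suc n))"
    obtain zs where zs: "\<And>n. zs n \<in> Z" "(\<lambda>n. (zs n - y - ?ts n *\<^sub>R 0) /\<^sub>R (?ts n)\<^sup>2) \<longlonglongrightarrow> q"
      using spec[OF spec[OF so[unfolded second_order_def], of "\<lambda>n. y"], of ?ts] y LIMSEQ_inverse_real_of_nat
      by auto
    define w where "w n = (zs n - y) /\<^sub>R (?ts n)\<^sup>2" for n
    have w: "w \<longlonglongrightarrow> q" unfolding w_def using zs(2) by simp
    have "w n \<bullet> (c - y) \<le> (?ts n)\<^sup>2 / 2 * (w n \<bullet> w n)" for n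
    proof -
      define s where "s = (?ts n)\<^sup>2"
      have s: "s > 0" by (simp add: s_def)
      have "(norm (c - y))\<^sup>2 \<le> (norm (c - zs n))\<^sup>2"
        using near zs(1) by (intro power_mono) (auto simp: dist_norm)
      then have *: "2 * ((zs n - y) \<bullet> (c - y)) \<le> (zs n - y) \<bullet> (zs n - y)"
        by (simp add: power2_norm_eq_inner algebra_simps inner_commute)
      have zw: "zs n - y = s *\<^sub>R w n"
        using s by (simp add: w_def s_def)
      have "s * (2 * (w n \<bullet> (c - y))) \<le> s * (s * (w n \<bullet> w n))"
        using * unfolding zw by (simp add: mult.left_commute)
      then have "2 * (w n \<bullet> (c - y)) \<le> s * (w n \<bullet> w n)"
        using s by simp
      then show ?thesis by (simp add: s_def)
    qed
    moreover have "(\<lambda>n. w n \<bullet> (c - y)) \<longlonglongrightarrow> q \<bullet> (c - y)"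
      by (intro tendsto_intros w)
    moreover have "(\<lambda>n. (?ts n)\<^sup>2 / 2 * (w n \<bullet> w n)) \<longlonglongrightarrow> 0\<^sup>2 / 2 * (q \<bullet> q)"
      by (intro tendsto_intros w LIMSEQ_inverse_real_of_nat) auto
    ultimately have "q \<bullet> (c - y) \<le> 0\<^sup>2 / 2 * (q \<bullet> q)"
      by (intro LIMSEQ_le[of "\<lambda>n. w n \<bullet> (c - y)"]) blast+
    then show ?thesis by simp
  qed
  show "lie_bracket X Y y \<bullet> (c - y) = 0"
    using le[OF second_order_bracket[OF Z W y X Y]] le[OF second_order_bracket[OF Z W y Y X]]
    by (simp add: lie_bracket_def inner_diff_left)
qed

text \<open>Smoothness is carried through the induction together with tangency, because every
  bracket consumes a derivative of its arguments.\<close>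

lemma tangential_lie_module:
  fixes \<X> :: "(real ^ 'm \<Rightarrow> real ^ 'm) set"
  assumes Z: "closed Z" and W: "open W"
    and gen: "\<And>X. X \<in> \<X> \<Longrightarrow> smooth_on X W \<and> tangential Z W X"
    and "X \<in> lie_module W \<X>"
  shows "smooth_on X W \<and> tangential Z W X"
  using assms(4)
proof induction
  case (gen X)
  then show ?case using assms(3) by blast
next
  case zero
  then show ?case by (simp add: smooth_on_def Ck_on_const tangential_def)
next
  case (add X Y)
  then show ?case by (simp add: smooth_on_def Ck_on_add W tangential_def inner_add_left)
next
  case (smult f X)
  then show ?case by (simp add: smooth_on_def Ck_on_scaleR W tangential_def)
next
  case (bracket X Y)
  then show ?case
    using smooth_on_lie_bracket[OF W] tangential_bracket[OF Z W]
    unfolding smooth_on_def by blast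
qed

text \<open>For \<open>c\<close> close to \<open>q\<close> let \<open>y\<close> be a nearest point
  in \<open>Z\<close>. Then \<open>c - y\<close> is orthogonal to all values at \<open>y\<close> of
  fields in the Lie module, hence to the whole space, so \<open>c = y\<close>.\<close>

lemma full_lie_rank_imp_subset_interior:
  fixes \<X> :: "(real ^ 'm \<Rightarrow> real ^ 'm) set"
  assumes Z: "closed Z" and W: "open W"
    and gen: "\<And>X. X \<in> \<X> \<Longrightarrow> smooth_on X W \<and> tangential Z W X"
    and rank: "\<And>x. x \<in> W \<Longrightarrow> lie_rank W \<X> x = CARD('m)"
  shows "Z \<inter> W \<subseteq> interior Z"
proof
  fix q assume q: "q \<in> Z \<inter> W"
  then obtain d where d: "d > 0" "ball q d \<subseteq> W"
    using W openE by blast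
  \<comment> \<open>Half the radius keeps the nearest point \<open>y\<close> inside
    \<open>W\<close>.\<close>
  have "ball q (d / 2) \<subseteq> Z"
  proof
    fix c assume c: "c \<in> ball q (d / 2)"
    obtain y where y: "y \<in> Z" "infdist c Z = dist c y"
      using infdist_attains_inf[OF Z] q by blast
    have near: "\<forall>z\<in>Z. dist c y \<le> dist c z"
      using infdist_le y by metis
    then have "dist c y < d / 2"
      using q c by (metis IntD1 dist_commute le_less_trans mem_ball)
    then have "y \<in> W"
      using c d(2) dist_triangle[of q y c] by auto
    have "orthogonal (c - y) s" if "s \<in> {X y |X. X \<in> lie_module W \<X>}" for s
      using that tangential_lie_module[OF Z W gen] near y(1) \<open>y \<in> W\<close>
      unfolding tangential_def orthogonal_def by (auto simp: inner_commute)
    then have "orthogonal (c - y) (c - y)" if "c - y \<in> span {X y |X. X \<in> lie_module W \<X>}"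
      using orthogonal_to_span[OF that] by blast
    moreover have "span {X y |X. X \<in> lie_module W \<X>} = UNIV"
      using rank[OF \<open>y \<in> W\<close>] unfolding lie_rank_def
      by (simp add: dim_eq_full[symmetric])
    ultimately show "c \<in> Z"
      using y(1) by (simp add: orthogonal_def)
  qed
  then show "q \<in> interior Z"
    using d(1) by (meson centre_in_ball half_gt_zero mem_interior)
qed

section \<open>The curvature operator and the Hopf lemma\<close>

lemma Ck_on_vec:
  fixes f :: "'a::euclidean_space \<Rightarrow> real ^ 'm"
  assumes "open U" "\<And>i. Ck_on k (\<lambda>x. f x $ i) U"
  shows "Ck_on k f U"
proof -
  have "f x = (\<Sum>i\<in>UNIV. f x $ i *\<^sub>R axis i 1)" for x
    by (simp add: vec_eq_iff axis_def if_distrib cong: if_cong)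
  moreover have "Ck_on k (\<lambda>x. \<Sum>i\<in>UNIV. f x $ i *\<^sub>R (axis i 1 :: real ^ 'm)) U"
    by (intro Ck_on_sum Ck_on_scaleR Ck_on_const assms)
  ultimately show ?thesis by simp
qed

lemma has_derivative_grad:
  assumes "f differentiable (at x)"
  shows "(f has_derivative (\<lambda>h. grad f x \<bullet> h)) (at x)"
proof -
  let ?D = "frechet_derivative f (at x)"
  have D: "(f has_derivative ?D) (at x)"
    using assms frechet_derivative_works by blast
  have "linear ?D" using D has_derivative_linear by blast
  then have "?D h = grad f x \<bullet> h" for h
    by (subst linear_Basis_expansion[of ?D h])
       (simp_all add: grad_def inner_vec_def[of "vec_lambda _"] Basis_vec_def sum.UNION_disjoint axis_eq_axis inner_axis
        sum.reindex[of "\<lambda>i. axis i 1"] UNION_singleton_eq_range inj_on_def mult.commute)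
  then show ?thesis
    using D by (simp add: ext[of ?D "\<lambda>h. grad f x \<bullet> h"])
qed

lemma grad_eqI:
  assumes "(f has_derivative (\<lambda>h. g \<bullet> h)) (at x)"
  shows "grad f x = g"
proof -
  have "frechet_derivative f (at x) = (\<lambda>h. g \<bullet> h)"
    using assms by (metis frechet_derivative_at)
  then show ?thesis
    by (simp add: grad_def vec_eq_iff inner_axis)
qed

lemma Ck_on_grad:
  assumes "open U" "Ck_on (Suc k) f U"
  shows "Ck_on k (grad f) U"
proof (rule Ck_on_vec[OF assms(1)])
  show "Ck_on k (\<lambda>x. grad f x $ i) U" for i
    using assms(2) by (simp add: grad_def axis_in_Basis_iff)
qed

lemma divergence_eq:
  "(G has_derivative D) (at x) \<Longrightarrow> divergence G x = (\<Sum>i\<in>UNIV. D (axis i 1) $ i)"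
  unfolding divergence_def by (metis (no_types, lifting) frechet_derivative_at sum.cong)

text \<open>The divergence of a normalized field as a function of its value \<open>p\<close> and its
  derivative \<open>L\<close>. It is linear in \<open>L\<close>; up to the factor
  \<open>1 / norm p\<close> it is the trace of \<open>L\<close> over the orthogonal complement of
  \<open>p\<close>, hence degenerate along \<open>p\<close>.\<close>

definition curv_op :: "real ^ 'm \<Rightarrow> (real ^ 'm \<Rightarrow> real ^ 'm) \<Rightarrow> real" where
  "curv_op p L = ((\<Sum>i\<in>UNIV. L (axis i 1) $ i) - (p \<bullet> L p) / (p \<bullet> p)) / norm p"

lemma has_derivative_normalize:
  fixes \<alpha> :: "'a::real_normed_vector \<Rightarrow> 'b::real_inner"
  assumes "(\<alpha> has_derivative L) (at x)" "\<alpha> x \<noteq> 0"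
  shows "((\<lambda>y. \<alpha> y /\<^sub>R norm (\<alpha> y)) has_derivative
     (\<lambda>h. L h /\<^sub>R norm (\<alpha> x) - ((\<alpha> x \<bullet> L h) / (norm (\<alpha> x))^3) *\<^sub>R \<alpha> x)) (at x)"
proof -
  have n: "((\<lambda>y. norm (\<alpha> y)) has_derivative (\<lambda>h. (L h \<bullet> \<alpha> x) / norm (\<alpha> x))) (at x)"
    using has_derivative_compose[OF assms(1) has_derivative_norm[OF assms(2)]]
    by (simp add: sgn_div_norm inner_commute divide_inverse_commute)
  have i: "((\<lambda>y. inverse (norm (\<alpha> y))) has_derivative
      (\<lambda>h. - (inverse (norm (\<alpha> x)) * ((L h \<bullet> \<alpha> x) / norm (\<alpha> x)) * inverse (norm (\<alpha> x))))) (at x)"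
    by (rule Deriv.has_derivative_inverse[OF _ n]) (use assms(2) in simp)
  show ?thesis
    using has_derivative_scaleR[OF i assms(1)]
    by (simp add: inner_commute power3_eq_cube divide_inverse mult_ac)
qed

lemma trace_rank_one:
  fixes L :: "real ^ 'm \<Rightarrow> real ^ 'm"
  assumes "linear L"
  shows "(\<Sum>i\<in>UNIV. (p \<bullet> L (axis i 1)) * q $ i) = p \<bullet> L q"
proof -
  have "q = (\<Sum>i\<in>UNIV. q $ i *\<^sub>R axis i 1)"
    by (simp add: vec_eq_iff axis_def if_distrib cong: if_cong)
  then have "L q = (\<Sum>i\<in>UNIV. q $ i *\<^sub>R L (axis i 1))"
    by (metis (no_types, lifting) linear_sum[OF assms] linear_cmul[OF assms] sum.cong)
  then show ?thesis
    by (simp add: inner_sum_right mult.commute)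
qed

lemma mean_curvature_eq_curv_op:
  assumes "((\<lambda>x. grad u x + F x) has_derivative L) (at x)" "grad u x + F x \<noteq> 0"
  shows "mean_curvature F u x = curv_op (grad u x + F x) L"
proof -
  let ?p = "grad u x + F x"
  have lin: "linear L" using assms(1) has_derivative_linear by blast
  have n0: "norm ?p \<noteq> 0" using assms(2) by simp
  have "mean_curvature F u x = (\<Sum>i\<in>UNIV. (L (axis i 1) /\<^sub>R norm ?p - ((?p \<bullet> L (axis i 1)) / (norm ?p)^3) *\<^sub>R ?p) $ i)"
    unfolding mean_curvature_def normal_field_def
    by (rule divergence_eq[OF has_derivative_normalize[OF assms]])
  also have "\<dots> = (\<Sum>i\<in>UNIV. L (axis i 1) $ i / norm ?p - ((?p \<bullet> L (axis i 1)) * ?p $ i) / (norm ?p)^3)"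
    by (intro sum.cong refl) (simp only: vector_minus_component vector_scaleR_component, simp add: divide_inverse mult_ac)
  also have "\<dots> = (\<Sum>i\<in>UNIV. L (axis i 1) $ i) / norm ?p - (\<Sum>i\<in>UNIV. (?p \<bullet> L (axis i 1)) * ?p $ i) / (norm ?p)^3"
    by (simp only: sum_subtractf sum_divide_distrib)
  also have "\<dots> = curv_op ?p L"
    unfolding trace_rank_one[OF lin] curv_op_def dot_square_norm
    using n0 by (simp add: diff_divide_distrib power3_eq_cube power2_eq_square)
  finally show ?thesis .
qed

lemma curv_op_add: "curv_op p (\<lambda>h. L h + M h) = curv_op p L + curv_op p M"
  by (simp add: curv_op_def sum.distrib inner_add_right add_divide_distrib diff_divide_distrib)

lemma curv_op_scale: "curv_op p (\<lambda>h. c *\<^sub>R L h) = c * curv_op p L"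
  by (simp add: curv_op_def sum_distrib_left[symmetric] algebra_simps diff_divide_distrib)

text \<open>With \<open>P\<close> the orthogonal projection along the unit vector \<open>n\<close>, the trace of \<open>P M P\<close> is
  \<open>tr M - n \<bullet> M n\<close>.\<close>
lemma curv_op_nonneg:
  fixes L :: "real ^ 'm \<Rightarrow> real ^ 'm"
  assumes lin: "linear L" and psd: "\<And>h. 0 \<le> h \<bullet> L h" and "p \<noteq> 0"
  shows "0 \<le> curv_op p L"
proof -
  define n where "n = p /\<^sub>R norm p"
  have nn: "n \<bullet> n = 1"
    using assms(3) by (simp add: n_def dot_square_norm power2_eq_square)
  have "0 \<le> (\<Sum>i\<in>UNIV. (axis i 1 - n $ i *\<^sub>R n) \<bullet> L (axis i 1 - n $ i *\<^sub>R n))"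
    by (intro sum_nonneg psd)
  also have "\<dots> = (\<Sum>i\<in>UNIV. L (axis i 1) $ i) - (\<Sum>i\<in>UNIV. (n \<bullet> L (axis i 1)) * n $ i)
      - (\<Sum>i\<in>UNIV. L n $ i * n $ i) + (\<Sum>i\<in>UNIV. n $ i * n $ i) * (n \<bullet> L n)"
    by (simp add: linear_diff[OF lin] linear_cmul[OF lin] inner_diff_left inner_diff_right
        sum.distrib sum_subtractf inner_axis inner_axis' sum_distrib_right sum_distrib_left algebra_simps)
  also have "\<dots> = (\<Sum>i\<in>UNIV. L (axis i 1) $ i) - n \<bullet> L n"
  proof -
    have "(\<Sum>i\<in>UNIV. L n $ i * n $ i) = n \<bullet> L n" "(\<Sum>i\<in>UNIV. n $ i * n $ i) = n \<bullet> n"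
      by (simp_all add: inner_vec_def mult.commute)
    then show ?thesis
      unfolding trace_rank_one[OF lin] nn by simp
  qed
  also have "n \<bullet> L n = (p \<bullet> L p) / (p \<bullet> p)"
    by (simp add: n_def linear_cmul[OF lin] dot_square_norm power2_eq_square divide_inverse mult_ac)
  finally show ?thesis
    using assms(3) by (simp add: curv_op_def)
qed

lemma norm_normalize_diff_le:
  fixes p q :: "'a::real_inner"
  assumes "r > 0" "norm p \<ge> r" "norm q \<ge> r"
  shows "norm (p /\<^sub>R norm p - q /\<^sub>R norm q) \<le> 2 * norm (p - q) / r"
proof -
  have pos: "norm p > 0" "norm q > 0" using assms by linarith+
  have "p /\<^sub>R norm p - q /\<^sub>R norm q = (p - q) /\<^sub>R norm p + ((norm q - norm p) / (norm p * norm q)) *\<^sub>R q"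
    using pos by (simp add: algebra_simps divide_simps) (simp add: field_simps flip: scaleR_add_left scaleR_diff_left)
  then have "norm (p /\<^sub>R norm p - q /\<^sub>R norm q)
      \<le> norm ((p - q) /\<^sub>R norm p) + norm (((norm q - norm p) / (norm p * norm q)) *\<^sub>R q)"
    by (simp only: norm_triangle_ineq)
  also have "norm ((p - q) /\<^sub>R norm p) = norm (p - q) / norm p"
    by (simp add: divide_inverse_commute)
  also have "norm (((norm q - norm p) / (norm p * norm q)) *\<^sub>R q) = \<bar>norm q - norm p\<bar> / norm p"
    using pos by (simp add: abs_mult)
  also have "norm (p - q) / norm p + \<bar>norm q - norm p\<bar> / norm p \<le> norm (p - q) / r + norm (p - q) / r"
    using assms norm_triangle_ineq3[of q p] by (intro add_mono frac_le) (auto simp: norm_minus_commute)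
  finally show ?thesis by simp
qed

text \<open>Serves to exchange the first argument while \<open>L\<close> stays fixed. The numerator
  is at most \<open>K * (CARD('m) + 1)\<close> and multiplies the variation of
  \<open>1 / norm p\<close>; the remaining 4 comes from the unit vectors in the quadratic term,
  which differ by at most \<open>2 * norm (p - q) / r\<close>.\<close>

lemma curv_op_lipschitz:
  fixes L :: "real ^ 'm \<Rightarrow> real ^ 'm"
  assumes lin: "linear L" and K: "\<And>h. norm (L h) \<le> K * norm h"
    and r: "r > 0" "norm p \<ge> r" "norm q \<ge> r"
  shows "\<bar>curv_op p L - curv_op q L\<bar> \<le> K * (real CARD('m) + 5) / r\<^sup>2 * norm (p - q)"
proof -
  define P where "P = p /\<^sub>R norm p"
  define Q where "Q = q /\<^sub>R norm q"
  define T where "T = (\<Sum>i\<in>UNIV. L (axis i 1) $ i)"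
  let ?d = "norm (p - q)"
  have pos: "norm p > 0" "norm q > 0" using r by linarith+
  have PQ: "norm P = 1" "norm Q = 1" using pos by (auto simp: P_def Q_def)
  have K0: "K \<ge> 0"
    using order_trans[OF norm_ge_zero K[of P]] PQ by simp
  have eq: "curv_op p L = (T - P \<bullet> L P) / norm p" "curv_op q L = (T - Q \<bullet> L Q) / norm q"
    by (simp_all add: curv_op_def T_def P_def Q_def linear_cmul[OF lin] dot_square_norm power2_eq_square divide_inverse mult_ac)
  have T: "\<bar>T\<bar> \<le> K * CARD('m)"
  proof -
    have "\<bar>T\<bar> \<le> (\<Sum>i\<in>(UNIV::'m set). K)"
      unfolding T_def
    proof (rule order_trans[OF sum_abs sum_mono])
      fix i :: 'm
      show "\<bar>L (axis i 1) $ i\<bar> \<le> K"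
        using component_le_norm_cart[of "L (axis i 1)" i] K[of "axis i 1"] by simp
    qed
    then show ?thesis by (simp add: mult.commute)
  qed
  have LP: "norm (L P) \<le> K" "norm (L Q) \<le> K" using K[of P] K[of Q] PQ by auto
  have QLQ: "\<bar>Q \<bullet> L Q\<bar> \<le> K"
    using Cauchy_Schwarz_ineq2[of Q "L Q"] PQ LP by simp
  have d1: "norm (P - Q) \<le> 2 * ?d / r"
    unfolding P_def Q_def by (rule norm_normalize_diff_le[OF r])
  have A: "\<bar>P \<bullet> L P - Q \<bullet> L Q\<bar> \<le> 4 * K * ?d / r"
  proof -
    have "P \<bullet> L P - Q \<bullet> L Q = (P - Q) \<bullet> L P + Q \<bullet> L (P - Q)"
      by (simp add: linear_diff[OF lin] algebra_simps)
    moreover have "\<bar>(P - Q) \<bullet> L P\<bar> \<le> norm (P - Q) * K"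
      by (rule order_trans[OF Cauchy_Schwarz_ineq2 mult_left_mono[OF LP(1)]]) simp
    moreover have "\<bar>Q \<bullet> L (P - Q)\<bar> \<le> norm (P - Q) * K"
      using order_trans[OF Cauchy_Schwarz_ineq2[of Q "L (P - Q)"]] K[of "P - Q"] PQ by (simp add: mult.commute)
    ultimately have "\<bar>P \<bullet> L P - Q \<bullet> L Q\<bar> \<le> 2 * (norm (P - Q) * K)"
      by linarith
    also have "\<dots> \<le> 2 * ((2 * ?d / r) * K)"
      using d1 K0 by (intro mult_left_mono mult_right_mono) auto
    finally show ?thesis by (simp add: algebra_simps)
  qed
  have B: "\<bar>1 / norm p - 1 / norm q\<bar> \<le> ?d / r\<^sup>2"
  proof -
    have "\<bar>1 / norm p - 1 / norm q\<bar> = \<bar>norm q - norm p\<bar> / (norm p * norm q)"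
      using pos by (subst diff_frac_eq) (simp_all add: abs_divide abs_mult)
    also have "\<dots> \<le> ?d / (r * r)"
      using r norm_triangle_ineq3[of q p]
      by (intro frac_le mult_mono) (auto simp: norm_minus_commute)
    finally show ?thesis by (simp add: power2_eq_square)
  qed
  have "curv_op p L - curv_op q L = (T - Q \<bullet> L Q) * (1 / norm p - 1 / norm q) - (P \<bullet> L P - Q \<bullet> L Q) / norm p"
    unfolding eq by (simp only: diff_divide_distrib) (simp add: algebra_simps)
  then have "\<bar>curv_op p L - curv_op q L\<bar> \<le> \<bar>T - Q \<bullet> L Q\<bar> * \<bar>1 / norm p - 1 / norm q\<bar> + \<bar>P \<bullet> L P - Q \<bullet> L Q\<bar> / norm p"
    using abs_triangle_ineq4[of "(T - Q \<bullet> L Q) * (1 / norm p - 1 / norm q)" "(P \<bullet> L P - Q \<bullet> L Q) / norm p"] pos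
    by (simp add: abs_mult)
  also have "\<dots> \<le> (K * CARD('m) + K) * (?d / r\<^sup>2) + (4 * K * ?d / r) / r"
    using T QLQ A B r K0 pos by (intro add_mono mult_mono frac_le) auto
  also have "\<dots> = K * (real CARD('m) + 5) / r\<^sup>2 * ?d"
    using r by (simp add: field_simps power2_eq_square)
  finally show ?thesis .
qed

text \<open>If \<open>h \<bullet> G h\<close> were negative, the derivative of \<phi> along
  \<open>h\<close> would vanish at \<open>x\<close> and be negative just after it, so by the mean
  value theorem \<phi> would drop below its minimum.\<close>

lemma second_derivative_nonneg_at_min:
  fixes \<phi> :: "'a::euclidean_space \<Rightarrow> real"
  assumes B: "open B" "x \<in> B"
    and der: "\<And>y. y \<in> B \<Longrightarrow> (\<phi> has_derivative (\<lambda>h. \<Gamma> y \<bullet> h)) (at y)"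
    and der2: "(\<Gamma> has_derivative G) (at x)"
    and min: "\<And>y. y \<in> B \<Longrightarrow> \<phi> x \<le> \<phi> y"
  shows "\<Gamma> x = 0" and "0 \<le> h \<bullet> G h"
proof -
  have "(\<lambda>h. \<Gamma> x \<bullet> h) = (\<lambda>h. 0)"
    by (rule has_derivative_local_min[OF der[OF B(2)]])
       (use B min eventually_nhds_in_open[OF B] in \<open>auto elim: eventually_mono simp: eventually_at_filter\<close>)
  then have "\<Gamma> x \<bullet> \<Gamma> x = 0" by meson
  then show \<Gamma>0: "\<Gamma> x = 0" by simp
  show "0 \<le> h \<bullet> G h"
  proof (rule ccontr)
    assume neg: "\<not> 0 \<le> h \<bullet> G h"
    define k where "k t = \<Gamma> (x + t *\<^sub>R h) \<bullet> h" for t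
    have line: "((\<lambda>t. x + t *\<^sub>R h) has_derivative (\<lambda>t. t *\<^sub>R h)) (at t)" for t
      by (auto intro!: derivative_eq_intros)
    have "(k has_derivative (\<lambda>t. G (t *\<^sub>R h) \<bullet> h)) (at 0)"
      unfolding k_def
      by (rule has_derivative_inner_left, rule has_derivative_compose[OF line]) (use der2 in simp)
    moreover have "G (t *\<^sub>R h) = t *\<^sub>R G h" for t
      using der2 has_derivative_linear linear_cmul by blast
    ultimately have "(k has_real_derivative h \<bullet> G h) (at 0)"
      by (simp add: has_field_derivative_def inner_commute mult.commute[of _ "h \<bullet> G h"])
    then obtain d where d: "d > 0" "\<And>t. t > 0 \<Longrightarrow> t < d \<Longrightarrow> k (0 + t) < k 0"
      using neg DERIV_neg_dec_right[of k _ 0] by (metis not_le)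
    have "((\<lambda>t. x + t *\<^sub>R h) \<longlongrightarrow> x + 0 *\<^sub>R h) (at 0)"
      by (intro tendsto_intros)
    then have "eventually (\<lambda>t. x + t *\<^sub>R h \<in> B) (at 0)"
      using B topological_tendstoD by fastforce
    then obtain d' where d': "d' > 0" "\<And>t. t \<noteq> 0 \<Longrightarrow> \<bar>t\<bar> < d' \<Longrightarrow> x + t *\<^sub>R h \<in> B"
      unfolding eventually_at by (auto simp: dist_real_def)
    define t where "t = min d d' / 2"
    have t: "0 < t" "t < d" "t < d'" using d(1) d'(1) by (auto simp: t_def)
    have inB: "x + s *\<^sub>R h \<in> B" if "0 \<le> s" "s \<le> t" for s
      using d'(2)[of s] that t B by (cases "s = 0") auto
    have "((\<lambda>s. \<phi> (x + s *\<^sub>R h)) has_real_derivative k s) (at s)" if "0 \<le> s" "s \<le> t" for s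
      using has_derivative_compose[OF line der[OF inB[OF that]]]
      by (simp add: has_field_derivative_def k_def mult.commute[of _ "\<Gamma> (x + s *\<^sub>R h) \<bullet> h"])
    from MVT2[OF t(1) this] obtain s where s: "0 < s" "s < t" "\<phi> (x + t *\<^sub>R h) - \<phi> (x + 0 *\<^sub>R h) = (t - 0) * k s"
      by blast
    have "k s < 0"
      using d(2)[of s] s t by (simp add: k_def \<Gamma>0)
    then have "t * k s < 0" using t by (simp add: mult_pos_neg)
    then show False
      using s(3) min[OF inB[of t]] t by simp
  qed
qed

section \<open>Touching functions and the Gaussian barrier\<close>

lemma Ck_on_grad_add:
  assumes "open V" "Ck_on 2 u V" "Ck_on 1 F V"
  shows "Ck_on 1 (\<lambda>x. grad u x + F x) V"
proof -
  have "Ck_on 1 (grad u) V"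
    using Ck_on_grad[of V 1 u] assms(1,2) by (simp add: numeral_2_eq_2 del: Ck_on.simps)
  then show ?thesis
    by (rule Ck_on_add[OF assms(1) _ assms(3)])
qed

lemma C1_has_derivative: "Ck_on 1 f U \<Longrightarrow> x \<in> U \<Longrightarrow> (f has_derivative frechet_derivative f (at x)) (at x)"
  using Ck_on_Suc_has_derivative[of 0] by simp

lemma C2_has_derivative_grad: "Ck_on 2 f U \<Longrightarrow> x \<in> U \<Longrightarrow> (f has_derivative (\<lambda>h. grad f x \<bullet> h)) (at x)"
  by (rule has_derivative_grad) (simp add: numeral_2_eq_2)

lemma C1_derivative_locally_bounded:
  fixes f :: "'a::euclidean_space \<Rightarrow> 'b::real_normed_vector"
  assumes "open V" "y \<in> V" "Ck_on 1 f V"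
  shows "\<exists>K. \<forall>\<^sub>F x in nhds y. \<forall>h. norm (frechet_derivative f (at x) h) \<le> K * norm h"
proof -
  let ?D = "\<lambda>x. frechet_derivative f (at x)"
  have "\<forall>\<^sub>F x in nhds y. norm (?D x b) < norm (?D y b) + 1" if "b \<in> Basis" for b
  proof -
    have "isCont (\<lambda>x. ?D x b) y"
      using assms that by (simp add: continuous_on_eq_continuous_at)
    then have "((\<lambda>x. ?D x b) \<longlongrightarrow> ?D y b) (nhds y)"
      unfolding continuous_at by (rule iffD1[OF tendsto_at_iff_tendsto_nhds[of "\<lambda>x. ?D x b" y]])
    then have "((\<lambda>x. norm (?D x b)) \<longlongrightarrow> norm (?D y b)) (nhds y)"
      by (rule tendsto_norm)
    then show ?thesis by (rule order_tendstoD) simp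
  qed
  then have "\<forall>\<^sub>F x in nhds y. \<forall>b\<in>Basis. norm (?D x b) < norm (?D y b) + 1"
    by (intro eventually_ball_finite) auto
  moreover have "\<forall>\<^sub>F x in nhds y. x \<in> V"
    by (rule eventually_nhds_in_open[OF assms(1,2)])
  ultimately have "\<forall>\<^sub>F x in nhds y. \<forall>h. norm (?D x h) \<le> (\<Sum>b\<in>Basis. norm (?D y b) + 1) * norm h"
  proof eventually_elim
    case (elim x)
    show ?case
    proof
      fix h
      have "linear (?D x)"
        using C1_has_derivative[OF assms(3) elim(2)] has_derivative_linear by blast
      then have "norm (?D x h) = norm (\<Sum>b\<in>Basis. (h \<bullet> b) *\<^sub>R ?D x b)"
        by (subst linear_Basis_expansion[of "?D x" h]) auto
      also have "\<dots> \<le> (\<Sum>b\<in>Basis. norm h * (norm (?D y b) + 1))"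
      proof (rule sum_norm_le)
        fix b :: 'a assume b: "b \<in> Basis"
        show "norm ((h \<bullet> b) *\<^sub>R ?D x b) \<le> norm h * (norm (?D y b) + 1)"
          using elim(1)[rule_format, OF b] Basis_le_norm[OF b, of h] by (auto intro!: mult_mono)
      qed
      finally show "norm (?D x h) \<le> (\<Sum>b\<in>Basis. norm (?D y b) + 1) * norm h"
        by (simp add: sum_distrib_left mult.commute)
    qed
  qed
  then show ?thesis by blast
qed

lemma grad_eq_at_touching:
  assumes V: "open V" "y \<in> V" and C2: "Ck_on 2 u V" "Ck_on 2 v V"
    and le: "\<And>x. x \<in> V \<Longrightarrow> u x \<le> v x" and eq: "v y = u y"
  shows "grad v y = grad u y"
proof -
  have d: "((\<lambda>x. v x - u x) has_derivative (\<lambda>h. grad v y \<bullet> h - grad u y \<bullet> h)) (at y)"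
    using C2 V by (intro has_derivative_diff C2_has_derivative_grad)
  have "(\<lambda>h. grad v y \<bullet> h - grad u y \<bullet> h) = (\<lambda>h. 0)"
  proof (rule has_derivative_local_min[OF d])
    have "\<forall>\<^sub>F x in at y. x \<in> V"
      using eventually_nhds_in_open[OF V] by (simp add: eventually_at_filter eventually_mono)
    then show "\<forall>\<^sub>F x in at y. v y - u y \<le> v x - u x"
      by eventually_elim (use le eq in simp)
  qed
  then have "(grad v y - grad u y) \<bullet> h = 0" for h
    by (metis inner_diff_left)
  then show ?thesis
    by (metis inner_eq_zero_iff right_minus_eq)
qed

text \<open>The closed ball with diameter from \<open>c\<close> to \<open>y\<close> lies in the open
  ball about \<open>c\<close> through \<open>y\<close> except for the point \<open>y\<close>.
  Passing to the smaller ball isolates the contact point, as a Hopf barrier needs.\<close>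

lemma dist_midpoint_ball:
  fixes c y :: "'a::real_inner"
  assumes "dist (midpoint c y) x \<le> dist (midpoint c y) y" "x \<noteq> y"
  shows "dist c x < dist c y"
proof -
  define m where "m = midpoint c y"
  define z where "z = y - m"
  have c: "c = m - z" and y: "y = m + z"
    by (auto simp: m_def z_def midpoint_def algebra_simps simp flip: scaleR_add_left)
  define w where "w = x - m"
  have x: "x = m + w" by (simp add: w_def)
  have "norm w \<le> norm z"
    using assms(1) unfolding m_def[symmetric] by (simp add: x y dist_norm)
  then have ww: "w \<bullet> w \<le> z \<bullet> z"
    by (simp add: norm_le)
  have "0 < (w - z) \<bullet> (w - z)"
    using assms(2) x y by simp
  then have "2 * (w \<bullet> z) < w \<bullet> w + z \<bullet> z"
    by (simp add: algebra_simps inner_commute)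
  then have "(w + z) \<bullet> (w + z) < (z + z) \<bullet> (z + z)"
    using ww by (simp add: algebra_simps inner_commute)
  then have "norm (w + z) < norm (z + z)"
    by (simp add: norm_lt)
  moreover have "dist c x = norm (w + z)" "dist c y = norm (z + z)"
    by (simp_all add: c x y dist_norm norm_minus_commute algebra_simps)
  ultimately show ?thesis by simp
qed

text \<open>With \<open>k\<close> the exponential factor, the map is the second derivative of
  \<open>exp (- \<kappa> |z|\<^sup>2)\<close>. The leading power \<open>\<kappa>\<^sup>2\<close>
  multiplies the squared part of \<open>z\<close> orthogonal to \<open>p\<close>, so the barrier is
  effective unless \<open>z\<close> is parallel to \<open>p\<close>.\<close>

lemma curv_op_barrier:
  fixes p z :: "real ^ 'm"
  assumes "p \<noteq> 0"
  shows "curv_op p (\<lambda>h. k *\<^sub>R ((4 * \<kappa>\<^sup>2 * (z \<bullet> h)) *\<^sub>R z - (2 * \<kappa>) *\<^sub>R h)) =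
    k * (4 * \<kappa>\<^sup>2 * (z \<bullet> z - (p \<bullet> z)\<^sup>2 / (p \<bullet> p)) - 2 * \<kappa> * (real CARD('m) - 1)) / norm p"
proof -
  have "(\<Sum>i\<in>UNIV. ((4 * \<kappa>\<^sup>2 * (z \<bullet> axis i 1)) *\<^sub>R z - (2 * \<kappa>) *\<^sub>R axis i 1) $ i)
      = 4 * \<kappa>\<^sup>2 * (z \<bullet> z) - 2 * \<kappa> * real CARD('m)"
    by (simp add: inner_axis sum_subtractf inner_vec_def[of z z] sum_distrib_left mult.assoc)
  moreover have "(p \<bullet> ((4 * \<kappa>\<^sup>2 * (z \<bullet> p)) *\<^sub>R z - (2 * \<kappa>) *\<^sub>R p)) / (p \<bullet> p)
      = 4 * \<kappa>\<^sup>2 * ((p \<bullet> z)\<^sup>2 / (p \<bullet> p)) - 2 * \<kappa>"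
    using assms by (simp add: inner_diff_right inner_commute power2_eq_square divide_simps)
  ultimately show ?thesis
    unfolding curv_op_scale by (simp only: curv_op_def) (simp add: algebra_simps)
qed

lemma has_derivative_gauss:
  fixes c :: "'a::real_inner"
  shows "((\<lambda>x. exp (- \<kappa> * ((x - c) \<bullet> (x - c)))) has_derivative
      (\<lambda>h. (- 2 * \<kappa> * exp (- \<kappa> * ((x - c) \<bullet> (x - c)))) *\<^sub>R (x - c) \<bullet> h)) (at x)"
  by (auto intro!: derivative_eq_intros simp: inner_commute algebra_simps)

lemma has_derivative_gauss_grad:
  fixes c :: "'a::real_inner"
  shows "((\<lambda>x. (- 2 * \<kappa> * exp (- \<kappa> * ((x - c) \<bullet> (x - c)))) *\<^sub>R (x - c)) has_derivative
      (\<lambda>h. exp (- \<kappa> * ((x - c) \<bullet> (x - c))) *\<^sub>R ((4 * \<kappa>\<^sup>2 * ((x - c) \<bullet> h)) *\<^sub>R (x - c) - (2 * \<kappa>) *\<^sub>R h))) (at x)"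
  by (auto intro!: derivative_eq_intros has_derivative_gauss simp: inner_commute algebra_simps power2_eq_square)

text \<open>At a proximal normal \<open>c - y\<close> of the coincidence set that is not parallel to the
  normal field, the barrier \<open>exp (- \<kappa> |x - m|\<^sup>2)\<close>, \<open>m\<close> the midpoint of \<open>c\<close> and \<open>y\<close>,
  is a strict subsolution; its second derivatives beat all lower-order terms for large \<open>\<kappa>\<close>.\<close>
lemma hopf_normal:
  fixes u v :: "real ^ 'm \<Rightarrow> real" and F :: "real ^ 'm \<Rightarrow> real ^ 'm"
  assumes V: "open V" "y \<in> V"
    and C2: "Ck_on 2 u V" "Ck_on 2 v V" and C1: "Ck_on 1 F V"
    and le: "\<And>x. x \<in> V \<Longrightarrow> u x \<le> v x" and eq: "v y = u y"
    and reg: "grad u y + F y \<noteq> 0"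
    and curv: "\<And>x. x \<in> V \<Longrightarrow> grad u x + F x \<noteq> 0 \<Longrightarrow> grad v x + F x \<noteq> 0 \<Longrightarrow>
      mean_curvature F v x \<le> mean_curvature F u x"
    and gap: "\<And>x. x \<in> V \<Longrightarrow> dist c x < dist c y \<Longrightarrow> u x < v x"
    and perp: "h \<bullet> (grad u y + F y) = 0"
  shows "h \<bullet> (c - y) = 0"
proof (rule ccontr)
  assume neq: "h \<bullet> (c - y) \<noteq> 0"
  define \<alpha> where "\<alpha> x = grad u x + F x" for x
  define \<beta> where "\<beta> x = grad v x + F x" for x
  define p where "p = grad u y + F y"
  define m where "m = midpoint c y"
  define s where "s = norm (y - m)"
  \<comment> \<open>Squared length of the component of \<open>x - m\<close> orthogonal to
    \<open>\<beta> x\<close>, the coefficient that drives the barrier.\<close>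
  define g where "g x = (x - m) \<bullet> (x - m) - (\<beta> x \<bullet> (x - m))\<^sup>2 / (\<beta> x \<bullet> \<beta> x)" for x
  have C1': "Ck_on 1 \<alpha> V" "Ck_on 1 \<beta> V"
    unfolding \<alpha>_def \<beta>_def using Ck_on_grad_add V C2 C1 by blast+
  have cont: "isCont \<alpha> y" "isCont \<beta> y"
    using C1' Ck_on_continuous V continuous_on_eq_continuous_at by blast+
  have p: "\<alpha> y = p" "\<beta> y = p" "p \<noteq> 0"
    using grad_eq_at_touching[OF V C2 le eq] reg by (auto simp: \<alpha>_def \<beta>_def p_def)
  have g_pos: "g y > 0"
  proof -
    let ?z = "y - m"
    \<comment> \<open>The component of \<open>?z\<close> orthogonal to \<open>p\<close>, scaled by
      \<open>p \<bullet> p\<close> to avoid division; \<open>h\<close> detects it, being orthogonal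
      to \<open>p\<close> but not to \<open>c - y\<close>.\<close>
    define w where "w = (p \<bullet> p) *\<^sub>R ?z - (p \<bullet> ?z) *\<^sub>R p"
    have "?z = (- 1/2) *\<^sub>R (c - y)"
      by (simp add: m_def midpoint_def algebra_simps flip: scaleR_add_left)
    then have zh: "?z \<bullet> h = (- 1/2) * (h \<bullet> (c - y))"
      by (simp add: inner_commute)
    have ph: "p \<bullet> h = 0"
      using perp by (simp add: p_def inner_commute)
    have "w \<bullet> h = (p \<bullet> p) * ((- 1/2) * (h \<bullet> (c - y)))"
      unfolding w_def inner_diff_left[of "(p \<bullet> p) *\<^sub>R ?z"] inner_scaleR_left zh ph by simp
    then have "w \<bullet> h \<noteq> 0"
      using neq p by simp
    then have "w \<bullet> w > 0" by auto
    moreover have "w \<bullet> w = (p \<bullet> p) * ((p \<bullet> p) * (?z \<bullet> ?z) - (p \<bullet> ?z)\<^sup>2)"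
      by (simp add: w_def inner_diff_left inner_diff_right power2_eq_square algebra_simps inner_commute)
    ultimately have "(p \<bullet> p) * ((p \<bullet> p) * (?z \<bullet> ?z) - (p \<bullet> ?z)\<^sup>2) > 0"
      by (simp only:)
    then have "(p \<bullet> p) * (?z \<bullet> ?z) - (p \<bullet> ?z)\<^sup>2 > 0"
      by (rule zero_less_mult_pos) (use p(3) in simp)
    moreover have "g y = ((p \<bullet> p) * (?z \<bullet> ?z) - (p \<bullet> ?z)\<^sup>2) / (p \<bullet> p)"
      using p(3) by (simp add: g_def p(2) diff_divide_distrib)
    ultimately show ?thesis using p(3) by simp
  qed
  obtain K where K: "\<forall>\<^sub>F x in nhds y. \<forall>h. norm (frechet_derivative \<alpha> (at x) h) \<le> K * norm h"
    using C1_derivative_locally_bounded[OF V C1'(1)] by blast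
  have g_cont: "isCont g y"
    unfolding g_def by (intro continuous_intros cont) (use p in simp)
  have tend: "(f \<longlongrightarrow> f y) (nhds y)" if "isCont f y" for f :: "real ^ 'm \<Rightarrow> real"
    using that by (simp add: continuous_at tendsto_at_iff_tendsto_nhds)
  define \<mu> where "\<mu> = norm p / 2"
  have \<mu>: "0 < \<mu>" "\<mu> < norm p" using p by (auto simp: \<mu>_def)
  have "\<forall>\<^sub>F x in nhds y. \<mu> < norm (\<alpha> x)" "\<forall>\<^sub>F x in nhds y. \<mu> < norm (\<beta> x)"
    "\<forall>\<^sub>F x in nhds y. norm (\<beta> x) < norm p + 1"
    using order_tendstoD[OF tend[OF continuous_norm[OF cont(1)]]] order_tendstoD[OF tend[OF continuous_norm[OF cont(2)]]]
      \<mu> p by auto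
  moreover have "\<forall>\<^sub>F x in nhds y. g y / 2 < g x"
    by (rule order_tendstoD(1)[OF tend[OF g_cont]]) (use g_pos in simp)
  moreover note K eventually_nhds_in_open[OF V]
  ultimately
  have "\<forall>\<^sub>F x in nhds y. (\<forall>h. norm (frechet_derivative \<alpha> (at x) h) \<le> K * norm h) \<and> x \<in> V \<and>
      \<mu> < norm (\<alpha> x) \<and> \<mu> < norm (\<beta> x) \<and> norm (\<beta> x) < norm p + 1 \<and> g y / 2 < g x"
    by eventually_elim auto
  then obtain r where r: "r > 0" "\<And>x. dist x y < r \<Longrightarrow>
      (\<forall>h. norm (frechet_derivative \<alpha> (at x) h) \<le> K * norm h) \<and> x \<in> V \<and>
      \<mu> < norm (\<alpha> x) \<and> \<mu> < norm (\<beta> x) \<and> norm (\<beta> x) < norm p + 1 \<and> g y / 2 < g x"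
    unfolding eventually_nhds_metric by blast
  define \<rho> where "\<rho> = r / 2"
  have \<rho>: "\<rho> > 0" and near: "x \<in> cball y \<rho> \<Longrightarrow> dist x y < r" for x
    using r(1) by (auto simp: \<rho>_def dist_commute)
  have cballV: "cball y \<rho> \<subseteq> V" using near r(2) by blast
  have K0: "K \<ge> 0"
  proof -
    have "norm (frechet_derivative \<alpha> (at y) (axis undefined 1)) \<le> K * norm (axis undefined 1 :: real ^ 'm)"
      by (rule r(2)[of y, THEN conjunct1, rule_format]) (use r(1) in simp)
    from order_trans[OF norm_ge_zero this] show ?thesis by simp
  qed
  define C where "C = K * (real CARD('m) + 5) / \<mu>\<^sup>2"
  have C: "C \<ge> 0" using K0 by (simp add: C_def)
  define M where "M = norm p + 1"
  have M: "M > 0" by (simp add: M_def add_nonneg_pos)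
  have s0: "s \<ge> 0" by (simp add: s_def)
  \<comment> \<open>Near \<open>y\<close> the value of \<open>g\<close> exceeds
    \<open>g y / 2\<close>, so after division by \<kappa> the second-order gain is at least
    \<open>2 * \<kappa> * g y\<close>. The numerator collects what it has to beat: the first-order
    error on the ball of radius \<rho> and the trace term.\<close>
  define \<kappa> where "\<kappa> = (C * (2 * (s + \<rho>)) * M + 2 * real CARD('m)) / (2 * g y) + 1"
  have \<kappa>: "\<kappa> > 0"
    using C s0 \<rho> M g_pos by (simp add: \<kappa>_def add_nonneg_pos)
  have \<kappa>_large: "2 * \<kappa> * g y > C * (2 * (s + \<rho>)) * M + 2 * real CARD('m)"
  proof -
    have *: "2 * (A / (2 * t) + 1) * t = A + 2 * t" if "t > 0" for A t :: real
      using that by (simp add: field_simps)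
    show ?thesis
      unfolding \<kappa>_def *[OF g_pos] using g_pos by linarith
  qed
  define E where "E x = exp (- \<kappa> * ((x - m) \<bullet> (x - m)))" for x
  define \<psi> where "\<psi> x = E x - exp (- \<kappa> * (s * s))" for x
  have E: "0 < E x" "E x \<le> 1" for x
    using \<kappa> by (auto simp: E_def)
  have \<psi>_y: "\<psi> y = 0"
    by (simp add: \<psi>_def E_def s_def dot_square_norm power2_eq_square)
  have \<psi>_out: "\<psi> x < 0" if "dist m x > s" for x
  proof -
    have "s * s < (x - m) \<bullet> (x - m)"
      using that s0 power_strict_mono[of s "dist m x" 2]
      by (simp add: dot_square_norm dist_norm norm_minus_commute power2_eq_square)
    then show ?thesis using \<kappa> by (simp add: \<psi>_def E_def)
  qed
  have \<psi>_le: "\<psi> x \<le> 1" for x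
    using E(2)[of x] exp_gt_zero[of "- \<kappa> * (s * s)"] unfolding \<psi>_def by linarith
  have contuv: "continuous_on (cball y \<rho>) (\<lambda>x. v x - u x)"
    using Ck_on_continuous C2 cballV by (intro continuous_on_diff) (blast intro: continuous_on_subset)+
  \<comment> \<open>The sphere splits in two: on \<open>?S\<close> compactness bounds
    \<open>v - u\<close> below by a positive number, elsewhere \<psi> is negative. For small
    \<epsilon> the function \<phi> is thus positive on the whole sphere.\<close>
  let ?S = "sphere y \<rho> \<inter> cball m s"
  have S_gap: "v x - u x > 0" if "x \<in> ?S" for x
  proof -
    have "x \<noteq> y" "dist m x \<le> dist m y" "x \<in> V"
      using that \<rho> cballV by (auto simp: s_def dist_norm norm_minus_commute)
    then show ?thesis
      using gap[of x] dist_midpoint_ball[of c y x] by (simp add: m_def)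
  qed
  have "\<exists>f0>0. \<forall>x\<in>?S. f0 \<le> v x - u x"
  proof (cases "?S = {}")
    case False
    have "compact ?S" by (simp add: compact_Int_closed)
    moreover have "continuous_on ?S (\<lambda>x. v x - u x)"
      by (rule continuous_on_subset[OF contuv]) auto
    ultimately obtain x0 where "x0 \<in> ?S" "\<forall>x\<in>?S. v x0 - u x0 \<le> v x - u x"
      using continuous_attains_inf[of ?S] False by blast
    then show ?thesis using S_gap by blast
  qed (auto intro: exI[of _ 1])
  then obtain f0 where f0: "f0 > 0" "\<And>x. x \<in> ?S \<Longrightarrow> f0 \<le> v x - u x" by blast
  define \<epsilon> where "\<epsilon> = f0 / 2"
  have \<epsilon>: "\<epsilon> > 0" "\<epsilon> < f0" using f0 by (auto simp: \<epsilon>_def)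
  define \<phi> where "\<phi> x = v x - u x - \<epsilon> * \<psi> x" for x
  have sphere_pos: "\<phi> x > 0" if "x \<in> sphere y \<rho>" for x
  proof (cases "dist m x \<le> s")
    case True
    then have "f0 \<le> v x - u x" using that f0(2) by auto
    moreover have "\<epsilon> * \<psi> x \<le> \<epsilon> * 1" using \<psi>_le \<epsilon> by (intro mult_left_mono) auto
    ultimately show ?thesis unfolding \<phi>_def using \<epsilon> by linarith
  next
    case False
    then have "\<epsilon> * \<psi> x < 0" using \<psi>_out[of x] \<epsilon> by (simp add: mult_pos_neg)
    moreover have "u x \<le> v x" using le that cballV by auto
    ultimately show ?thesis by (simp add: \<phi>_def)
  qed
  have "continuous_on (cball y \<rho>) \<phi>"
    unfolding \<phi>_def \<psi>_def E_def by (intro continuous_intros contuv)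
  then obtain q where q: "q \<in> cball y \<rho>" "\<And>x. x \<in> cball y \<rho> \<Longrightarrow> \<phi> q \<le> \<phi> x"
    using continuous_attains_inf[of "cball y \<rho>" \<phi>] \<rho> by auto
  \<comment> \<open>Since \<phi> vanishes at \<open>y\<close>, its minimum cannot lie on the
    sphere.\<close>
  have "\<phi> q \<le> 0" using q(2)[of y] \<rho> eq \<psi>_y by (simp add: \<phi>_def)
  then have "q \<notin> sphere y \<rho>" using sphere_pos by force
  then have qb: "q \<in> ball y \<rho>" using q(1) by auto
  have qV: "q \<in> V" using q(1) cballV by auto
  \<comment> \<open>\<Gamma> is the gradient of \<phi>, and \<open>G\<close> below is its derivative
    at the minimum point \<open>q\<close>.\<close>
  define \<Gamma> where "\<Gamma> x = \<beta> x - \<alpha> x - \<epsilon> *\<^sub>R ((- 2 * \<kappa> * E x) *\<^sub>R (x - m))" for x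
  define La where "La = frechet_derivative \<alpha> (at q)"
  define Lb where "Lb = frechet_derivative \<beta> (at q)"
  define Lp where "Lp h = E q *\<^sub>R ((4 * \<kappa>\<^sup>2 * ((q - m) \<bullet> h)) *\<^sub>R (q - m) - (2 * \<kappa>) *\<^sub>R h)" for h
  define G where "G h = Lb h - La h - \<epsilon> *\<^sub>R Lp h" for h
  have La: "(\<alpha> has_derivative La) (at q)" and Lb: "(\<beta> has_derivative Lb) (at q)"
    unfolding La_def Lb_def using C1_has_derivative C1' qV by blast+
  have \<phi>_der: "(\<phi> has_derivative (\<lambda>h. \<Gamma> x \<bullet> h)) (at x)" if "x \<in> ball y \<rho>" for x
  proof -
    have "x \<in> V" using that cballV by auto
    then have "(\<phi> has_derivative (\<lambda>h. grad v x \<bullet> h - grad u x \<bullet> h - \<epsilon> * (((- 2 * \<kappa> * E x) *\<^sub>R (x - m)) \<bullet> h - 0))) (at x)"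
      unfolding \<phi>_def \<psi>_def E_def
      by (intro has_derivative_diff has_derivative_mult_right has_derivative_gauss has_derivative_const
          C2_has_derivative_grad[OF C2(1)] C2_has_derivative_grad[OF C2(2)])
    then show ?thesis
      by (rule has_derivative_eq_rhs) (simp add: \<Gamma>_def \<alpha>_def \<beta>_def inner_diff_left inner_add_left fun_eq_iff)
  qed
  have \<Gamma>_der: "(\<Gamma> has_derivative G) (at q)"
    unfolding \<Gamma>_def G_def Lp_def E_def
    by (intro has_derivative_diff La Lb has_derivative_scaleR_right has_derivative_gauss_grad)
  have \<phi>_min: "\<phi> q \<le> \<phi> x" if "x \<in> ball y \<rho>" for x
    using q(2) that by auto
  note min = second_derivative_nonneg_at_min[OF open_ball qb \<phi>_der \<Gamma>_der \<phi>_min]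
  have qn: "norm (frechet_derivative \<alpha> (at q) h) \<le> K * norm h" "\<mu> < norm (\<alpha> q)" "\<mu> < norm (\<beta> q)"
    "norm (\<beta> q) < M" "g y / 2 < g q" for h
    using r(2)[OF near[OF q(1)]] by (auto simp: M_def)
  have nz: "\<alpha> q \<noteq> 0" "\<beta> q \<noteq> 0" using qn \<mu> by auto
  have H: "curv_op (\<beta> q) Lb \<le> curv_op (\<alpha> q) La"
    using curv[OF qV] nz mean_curvature_eq_curv_op[of u F La q] mean_curvature_eq_curv_op[of v F Lb q] La Lb
    unfolding \<alpha>_def \<beta>_def by simp
  \<comment> \<open>At the minimum \<open>G\<close> is positive semidefinite, so the curvature of
    the barrier is bounded by the cost of replacing \<open>\<beta> q\<close> by
    \<open>\<alpha> q\<close> in front of \<open>La\<close>.\<close>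
  have "Lb = (\<lambda>h. G h + (La h + \<epsilon> *\<^sub>R Lp h))"
    by (simp add: G_def)
  then have "curv_op (\<beta> q) Lb = curv_op (\<beta> q) G + (curv_op (\<beta> q) La + \<epsilon> * curv_op (\<beta> q) Lp)"
    by (simp only: curv_op_add curv_op_scale)
  moreover have "0 \<le> curv_op (\<beta> q) G"
    using \<Gamma>_der has_derivative_linear min(2) nz by (intro curv_op_nonneg) auto
  ultimately have up: "\<epsilon> * curv_op (\<beta> q) Lp \<le> curv_op (\<alpha> q) La - curv_op (\<beta> q) La"
    using H by linarith
  have "\<bar>curv_op (\<alpha> q) La - curv_op (\<beta> q) La\<bar> \<le> C * norm (\<alpha> q - \<beta> q)"
    unfolding C_def using La has_derivative_linear qn \<mu>
    by (intro curv_op_lipschitz) (auto simp: La_def less_imp_le)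
  \<comment> \<open>The vanishing gradient of \<phi> makes the two fields differ by a multiple of
    \<epsilon> and of \<open>E q\<close>. Both factors cancel, which leaves a term linear in
    \<kappa> against one quadratic in \<kappa>.\<close>
  also have "\<alpha> q - \<beta> q = (\<epsilon> * (2 * \<kappa> * E q)) *\<^sub>R (q - m)"
    using min(1) by (simp add: \<Gamma>_def algebra_simps)
  also have "C * norm \<dots> \<le> C * (\<epsilon> * (2 * \<kappa> * E q) * (s + \<rho>))"
  proof -
    have "norm (q - m) \<le> s + \<rho>"
      using norm_triangle_ineq[of "q - y" "y - m"] q(1) by (simp add: s_def dist_norm norm_minus_commute)
    then show ?thesis
      using C \<epsilon> \<kappa> E[of q] by (auto intro!: mult_left_mono simp: abs_mult)
  qed
  finally have "\<epsilon> * curv_op (\<beta> q) Lp \<le> C * (\<epsilon> * (2 * \<kappa> * E q) * (s + \<rho>))"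
    using up by linarith
  then have "\<epsilon> * curv_op (\<beta> q) Lp \<le> \<epsilon> * (E q * (\<kappa> * (C * (2 * (s + \<rho>)))))"
    by (simp add: mult_ac)
  then have upper: "curv_op (\<beta> q) Lp \<le> E q * (\<kappa> * (C * (2 * (s + \<rho>))))"
    using \<epsilon> by simp
  have lower: "curv_op (\<beta> q) Lp = E q * (4 * \<kappa>\<^sup>2 * g q - 2 * \<kappa> * (real CARD('m) - 1)) / norm (\<beta> q)"
    unfolding Lp_def g_def by (rule curv_op_barrier[OF nz(2)])
  have big: "\<kappa> * (C * (2 * (s + \<rho>)) * M) < 4 * \<kappa>\<^sup>2 * g q - 2 * \<kappa> * (real CARD('m) - 1)"
  proof -
    have "C * (2 * (s + \<rho>)) * M < 4 * \<kappa> * g q - 2 * (real CARD('m) - 1)"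
    proof -
      have "2 * \<kappa> * g y \<le> 4 * \<kappa> * g q" using qn(5) \<kappa> by simp
      moreover have "A < y - 2 * (c - 1)" if "A + 2 * c < x" "x \<le> y" for A c x y :: real
        using that unfolding right_diff_distrib by linarith
      ultimately show ?thesis using \<kappa>_large by blast
    qed
    then have "\<kappa> * (C * (2 * (s + \<rho>)) * M) < \<kappa> * (4 * \<kappa> * g q - 2 * (real CARD('m) - 1))"
      using \<kappa> by (intro mult_strict_left_mono)
    then show ?thesis by (simp add: algebra_simps power2_eq_square)
  qed
  have "E q * (\<kappa> * (C * (2 * (s + \<rho>)))) * norm (\<beta> q) \<le> E q * (\<kappa> * (C * (2 * (s + \<rho>)))) * M"
    using E[of q] \<kappa> C s0 \<rho> qn(4) by (intro mult_left_mono) auto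
  also have "\<dots> = E q * (\<kappa> * (C * (2 * (s + \<rho>)) * M))" by (simp add: mult_ac)
  also have "\<dots> < E q * (4 * \<kappa>\<^sup>2 * g q - 2 * \<kappa> * (real CARD('m) - 1))"
    using big E(1) by (intro mult_strict_left_mono)
  also have "\<dots> = curv_op (\<beta> q) Lp * norm (\<beta> q)"
    using nz by (simp add: lower)
  also have "\<dots> \<le> E q * (\<kappa> * (C * (2 * (s + \<rho>)))) * norm (\<beta> q)"
    using upper by (intro mult_right_mono) auto
  finally show False by simp
qed

section \<open>The strong maximum principle off the singular set\<close>

text \<open>Restriction to a smaller set enlarges the class of smooth coefficients; full rank
  therefore survives the shrinking of a neighborhood.\<close>

lemma lie_module_mono:
  assumes "W' \<subseteq> W"
  shows "lie_module W \<X> \<subseteq> lie_module W' \<X>"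
proof
  fix X assume "X \<in> lie_module W \<X>"
  then show "X \<in> lie_module W' \<X>"
  proof induction
    case (smult f X)
    then show ?case
      using assms by (intro lie_module.smult) (auto simp: smooth_on_def intro: Ck_on_subset)
  qed (auto intro: lie_module.intros)
qed

lemma full_lie_rank_mono:
  fixes \<X> :: "(real ^ 'm \<Rightarrow> real ^ 'm) set"
  assumes "W' \<subseteq> W" "lie_rank W \<X> x = CARD('m)"
  shows "lie_rank W' \<X> x = CARD('m)"
proof -
  have "CARD('m) \<le> lie_rank W' \<X> x"
    using lie_module_mono[OF assms(1)] unfolding assms(2)[symmetric] lie_rank_def
    by (intro dim_subset span_mono) blast
  moreover have "lie_rank W' \<X> x \<le> CARD('m)"
    unfolding lie_rank_def by (rule order_trans[OF dim_subset_UNIV]) simp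
  ultimately show ?thesis by simp
qed

lemma strong_maximum_principle_local:
  fixes u v w :: "real ^ 'm \<Rightarrow> real" and F :: "real ^ 'm \<Rightarrow> real ^ 'm"
  assumes W: "open W" "q \<in> W"
    and C2: "Ck_on 2 u W" "Ck_on 2 v W" and C1: "Ck_on 1 F W"
    and le: "\<And>x. x \<in> W \<Longrightarrow> u x \<le> v x" and eq: "v q = u q"
    and w: "w = u \<or> w = v" and reg: "\<And>x. x \<in> W \<Longrightarrow> grad w x + F x \<noteq> 0"
    and curv: "\<And>x. x \<in> W \<Longrightarrow> grad u x + F x \<noteq> 0 \<Longrightarrow> grad v x + F x \<noteq> 0 \<Longrightarrow>
      mean_curvature F v x \<le> mean_curvature F u x"
    and frame: "smooth_orthonormal_perp_frame W (normal_field F w) N"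
    and rank: "\<And>x. x \<in> W \<Longrightarrow> lie_rank W {N i |i. i \<in> {1..CARD('m) - 1}} x = CARD('m)"
  shows "\<exists>d>0. \<forall>x\<in>ball q d. v x = u x"
proof -
  let ?\<X> = "{N i |i. i \<in> {1..CARD('m) - 1}}"
  obtain d where d: "d > 0" "cball q d \<subseteq> W"
    using W open_contains_cball by blast
  define V where "V = ball q d"
  \<comment> \<open>Taken in the closed ball so that it is closed in the whole space and nearest
    points exist; tangency is claimed in the open ball \<open>V\<close>.\<close>
  define Z where "Z = {x \<in> cball q d. v x = u x}"
  have V: "open V" "V \<subseteq> W" "V \<subseteq> cball q d" "q \<in> V"
    using d by (auto simp: V_def)
  have Z: "closed Z"
  proof -
    have "continuous_on (cball q d) (\<lambda>x. v x - u x)"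
      using Ck_on_continuous C2 d(2) by (intro continuous_on_diff) (blast intro: continuous_on_subset)+
    then have "closed {x \<in> cball q d. v x - u x = 0}"
      by (intro continuous_closed_preimage_constant) auto
    then show ?thesis by (simp add: Z_def)
  qed
  have touch_grad: "grad v y = grad u y" if "y \<in> Z \<inter> V" for y
    using that V le by (intro grad_eq_at_touching[of V y u v] Ck_on_subset[OF C2(1)] Ck_on_subset[OF C2(2)]) (auto simp: Z_def)
  have "smooth_on (N i) V \<and> tangential Z V (N i)" if i: "i \<in> {1..CARD('m) - 1}" for i
  proof
    show "smooth_on (N i) V"
      using frame i V(2) unfolding smooth_orthonormal_perp_frame_def smooth_on_def
      by (blast intro: Ck_on_subset)
    show "tangential Z V (N i)"
      unfolding tangential_def
    proof (intro ballI allI impI)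
      fix y c assume y: "y \<in> Z \<inter> V" and c: "\<forall>z\<in>Z. dist c y \<le> dist c z"
      have yW: "y \<in> W" using y V by auto
      \<comment> \<open>Whichever of \<open>u\<close> and \<open>v\<close> is \<open>w\<close>, its
        gradient at a contact point is the common one, so the frame for \<open>w\<close> is
        orthogonal to the normal of \<open>u\<close>.\<close>
      have gw: "grad w y = grad u y" using w touch_grad[OF y] by auto
      have "N i y \<in> orthogonal_comp {normal_field F w y}"
        using frame i yW unfolding smooth_orthonormal_perp_frame_def by (metis (mono_tags, lifting) mem_Collect_eq span_base)
      then have perp: "N i y \<bullet> (grad u y + F y) = 0"
        using reg[OF yW] gw by (simp add: orthogonal_comp_def orthogonal_def normal_field_def inner_commute)
      show "N i y \<bullet> (c - y) = 0"
      proof (rule hopf_normal[where V = V and u = u and v = v and F = F, OF V(1)])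
        show "u x < v x" if "x \<in> V" "dist c x < dist c y" for x
        proof -
          \<comment> \<open>Minimality of \<open>dist c y\<close> over \<open>Z\<close> empties the
            ball about \<open>c\<close> of contact points, which is the gap that the Hopf lemma asks
            for.\<close>
          have "x \<notin> Z" using c that(2) by force
          then have "v x \<noteq> u x" using that(1) V(3) by (auto simp: Z_def)
          then show ?thesis using le[of x] that(1) V(2) by force
        qed
        show "mean_curvature F v x \<le> mean_curvature F u x" if "x \<in> V" "grad u x + F x \<noteq> 0" "grad v x + F x \<noteq> 0" for x
          using curv that V(2) by blast
        show "u x \<le> v x" if "x \<in> V" for x using le that V(2) by blast
        show "grad u y + F y \<noteq> 0" using reg[OF yW] gw by simp
      qed (use y V C1 C2 perp in \<open>auto simp: Z_def intro: Ck_on_subset simp del: Ck_on.simps\<close>)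
    qed
  qed
  then have "Z \<inter> V \<subseteq> interior Z"
    using rank V(2) full_lie_rank_mono[OF V(2)]
    by (intro full_lie_rank_imp_subset_interior[OF Z V(1), of ?\<X>]) blast+
  moreover have "q \<in> Z \<inter> V" using d V eq by (auto simp: Z_def)
  ultimately obtain e where "e > 0" "ball q e \<subseteq> Z"
    using mem_interior by blast
  then show ?thesis by (force simp: Z_def)
qed

section \<open>Divergence theorem and cutoff functions\<close>

text \<open>By translation invariance every difference quotient of \<open>g\<close> along
  \<open>b\<close> has integral zero. The quotients are bounded by the maximum of the derivative
  and, for steps of length at most 1, vanish outside radius \<open>R + 1\<close>, so dominated
  convergence applies.\<close>

lemma integral_partial_derivative_eq_0:
  fixes g :: "'a::euclidean_space \<Rightarrow> real"
  assumes C1: "Ck_on 1 g UNIV" and supp: "\<And>x. norm x > R \<Longrightarrow> g x = 0" and b: "b \<in> Basis"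
  shows "integrable lborel (\<lambda>x. frechet_derivative g (at x) b)"
    and "integral\<^sup>L lborel (\<lambda>x. frechet_derivative g (at x) b) = 0"
proof -
  define k where "k x = frechet_derivative g (at x) b" for x
  have der: "(g has_derivative frechet_derivative g (at x)) (at x)" for x
    using Ck_on_Suc_has_derivative[of 0 g UNIV] C1 by simp
  have kc: "continuous_on UNIV k"
    unfolding k_def using C1 b by simp
  have gc: "continuous_on UNIV g" using C1 by (rule Ck_on_continuous)
  have k0: "k x = 0" if "norm x > R" for x
  proof -
    have "open {x :: 'a. R < norm x}"
      by (intro open_Collect_less continuous_intros)
    then have "(g has_derivative (\<lambda>h. 0)) (at x)"
      using that supp by (intro has_derivative_transform_within_open[OF has_derivative_const]) auto
    then show ?thesis
      unfolding k_def by (metis frechet_derivative_at)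
  qed
  have "compact (k ` cball 0 R)"
    by (intro compact_continuous_image continuous_on_subset[OF kc]) auto
  then obtain B where B: "B > 0" "\<And>x. x \<in> cball 0 R \<Longrightarrow> norm (k x) \<le> B"
    using compact_imp_bounded bounded_pos by (metis image_eqI)
  have kB: "\<bar>k x\<bar> \<le> B" for x
    using B(2)[of x] k0[of x] B(1) by (cases "norm x \<le> R") auto
  have int_compact: "integrable lborel f" if "continuous_on UNIV f" "\<And>x. norm x > r \<Longrightarrow> f x = 0"
    for f :: "'a \<Rightarrow> real" and r
  proof -
    have "integrable lborel (\<lambda>x. indicator (cball 0 r) x *\<^sub>R f x)"
      by (intro borel_integrable_compact continuous_on_subset[OF that(1)]) auto
    moreover have "(\<lambda>x. indicator (cball 0 r) x *\<^sub>R f x) = f"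
      using that(2) by (auto simp: indicator_def not_le fun_eq_iff)
    ultimately show ?thesis by (simp only:)
  qed
  have lin: "linear (frechet_derivative g (at x))" for x
    using der has_derivative_linear by blast
  define t where "t n = inverse (real (Suc n))" for n
  have t: "0 < t n" "t n \<le> 1" for n by (auto simp: t_def divide_simps)
  define s where "s n x = (g (x + t n *\<^sub>R b) - g x) / t n" for n x
  have line: "((\<lambda>r. g (x + r *\<^sub>R b)) has_real_derivative k (x + r *\<^sub>R b)) (at r)" for x r
  proof -
    have "((\<lambda>r. x + r *\<^sub>R b) has_derivative (\<lambda>r. r *\<^sub>R b)) (at r)"
      by (auto intro!: derivative_eq_intros)
    from has_derivative_compose[OF this der] show ?thesis
      by (simp add: has_field_derivative_def k_def linear_cmul[OF lin] mult.commute[of _ "frechet_derivative g _ _"])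
  qed
  have s_lim: "(\<lambda>n. s n x) \<longlonglongrightarrow> k x" for x
  proof -
    have "((\<lambda>h. (g (x + h *\<^sub>R b) - g x) / h) \<longlongrightarrow> k x) (at 0)"
      using line[of x 0] by (simp add: DERIV_def)
    moreover have "filterlim t (at 0) sequentially"
      using t(1) LIMSEQ_inverse_real_of_nat unfolding filterlim_at t_def
      by (auto simp: eventually_sequentially)
    ultimately show ?thesis
      unfolding s_def by (rule filterlim_compose)
  qed
  have s_bound: "norm (s n x) \<le> B * indicator (cball 0 (R + 1)) x" for n x
  proof (cases "norm x \<le> R + 1")
    case True
    obtain z where z: "0 < z" "z < t n" "g (x + t n *\<^sub>R b) - g (x + 0 *\<^sub>R b) = (t n - 0) * k (x + z *\<^sub>R b)"
      using MVT2[OF t(1)[of n] line] by blast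
    then have "s n x = k (x + z *\<^sub>R b)"
      using t(1)[of n] by (simp add: s_def)
    then show ?thesis using kB True by simp
  next
    case False
    have "norm (t n *\<^sub>R b) \<le> 1" using t[of n] b by simp
    then have "norm (x + t n *\<^sub>R b) > R"
      using False norm_triangle_ineq4[of "x + t n *\<^sub>R b" "t n *\<^sub>R b"] by simp
    then show ?thesis using False supp by (simp add: s_def)
  qed
  have gi: "integrable lborel g" by (rule int_compact[OF gc supp])
  have s_int: "integral\<^sup>L lborel (s n) = 0" for n
  proof -
    have gm: "g \<in> borel_measurable borel"
      by (rule borel_measurable_continuous_onI[OF gc])
    have 1: "integral\<^sup>L lborel (\<lambda>x. g (t n *\<^sub>R b + x)) = integral\<^sup>L lborel g"
      using integral_distr[of "(+) (t n *\<^sub>R b)" lborel borel g] gm by (simp add: lborel_distr_plus)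
    have 2: "integrable lborel (\<lambda>x. g (t n *\<^sub>R b + x))"
      using integrable_distr_eq[of "(+) (t n *\<^sub>R b)" lborel borel g] gm gi by (simp add: lborel_distr_plus)
    show ?thesis
      unfolding s_def using 1 2 gi by (simp add: add.commute)
  qed
  have "continuous_on UNIV (s n)" for n
    unfolding s_def[abs_def] using t(1)[of n]
    by (intro continuous_intros continuous_on_compose2[OF gc]) auto
  then have meas: "k \<in> borel_measurable lborel" "\<And>n. s n \<in> borel_measurable lborel"
    using borel_measurable_continuous_onI[OF kc] borel_measurable_continuous_onI by auto
  have dom: "integrable lborel (\<lambda>x. B * indicator (cball 0 (R + 1)) x :: real)"
    by (intro integrable_mult_right integrable_real_indicator) (auto simp: emeasure_bounded_finite[unfolded infinity_ennreal_def])
  have "(\<lambda>n. integral\<^sup>L lborel (s n)) \<longlonglongrightarrow> integral\<^sup>L lborel k"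
    by (rule integral_dominated_convergence[OF meas dom]) (use s_lim s_bound in auto)
  then have "integral\<^sup>L lborel k = 0"
    using s_int by (simp add: LIMSEQ_const_iff)
  then show "integral\<^sup>L lborel (\<lambda>x. frechet_derivative g (at x) b) = 0"
    by (simp add: k_def[abs_def])
  show "integrable lborel (\<lambda>x. frechet_derivative g (at x) b)"
    using int_compact[OF kc k0] by (simp add: k_def[abs_def])
qed

lemma integral_divergence_eq_0:
  fixes G :: "real ^ 'm \<Rightarrow> real ^ 'm"
  assumes C1: "Ck_on 1 G UNIV" and supp: "bounded S" "\<And>x. x \<notin> S \<Longrightarrow> G x = 0"
  shows "integrable lborel (divergence G)" and "integral\<^sup>L lborel (divergence G) = 0"
proof -
  obtain R where R: "\<And>x. x \<in> S \<Longrightarrow> norm x \<le> R"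
    using supp(1) bounded_iff by blast
  define k where "k i x = frechet_derivative (\<lambda>x. G x $ i) (at x) (axis i 1)" for i x
  have comp: "((\<lambda>x. G x $ i) has_derivative (\<lambda>h. frechet_derivative G (at x) h $ i)) (at x)" for i x
    using Ck_on_Suc_has_derivative[of 0 G UNIV x] C1 by (auto intro: bounded_linear.has_derivative[OF bounded_linear_vec_nth])
  have k_eq: "k i x = frechet_derivative G (at x) (axis i 1) $ i" for i x
    unfolding k_def using comp[of i x] by (metis frechet_derivative_at)
  then have div: "divergence G = (\<lambda>x. \<Sum>i\<in>UNIV. k i x)"
    by (simp add: divergence_def fun_eq_iff)
  have C1i: "Ck_on 1 (\<lambda>x. G x $ i) UNIV" for i
    using Ck_on_inner[OF open_UNIV C1 Ck_on_const, of "axis i 1"] by (simp add: inner_axis del: Ck_on.simps)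
  have s: "G x $ i = 0" if "norm x > R" for i x
  proof -
    have "x \<notin> S" using R[of x] that by auto
    then show ?thesis using supp(2) by simp
  qed
  have b: "axis i 1 \<in> (Basis :: (real ^ 'm) set)" for i by (simp add: axis_in_Basis_iff)
  note p = integral_partial_derivative_eq_0[OF C1i s b]
  show "integrable lborel (divergence G)"
    unfolding div by (intro Bochner_Integration.integrable_sum) (use p(1) in \<open>simp add: k_def[abs_def]\<close>)
  have "integral\<^sup>L lborel (divergence G) = (\<Sum>i\<in>UNIV. integral\<^sup>L lborel (k i))"
    unfolding div by (intro Bochner_Integration.integral_sum) (use p(1) in \<open>simp add: k_def[abs_def]\<close>)
  then show "integral\<^sup>L lborel (divergence G) = 0"
    using p(2) by (simp add: k_def[abs_def])
qed

text \<open>The contradiction scheme shared by both integral arguments: a divergence of total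
  integral zero that is strictly negative on one ball has to be compensated on the error
  balls.\<close>

lemma divergence_estimate:
  fixes G :: "real ^ 'm \<Rightarrow> real ^ 'm" and x :: "nat \<Rightarrow> real ^ 'm"
  assumes C1: "Ck_on 1 G UNIV" and supp: "bounded S" "\<And>x. x \<notin> S \<Longrightarrow> G x = 0"
    and le: "\<And>y. divergence G y \<le> - \<kappa> * indicator (ball x0 \<rho>) y + (\<Sum>n\<in>I. c n * indicator (ball (x n) (r n)) y)"
    and \<rho>: "\<rho> \<ge> 0" and r: "\<And>n. n \<in> I \<Longrightarrow> r n \<ge> 0"
  shows "\<kappa> * (unit_ball_vol (real CARD('m)) * \<rho> ^ CARD('m))
      \<le> (\<Sum>n\<in>I. c n * (unit_ball_vol (real CARD('m)) * r n ^ CARD('m)))"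
proof -
  let ?M = "lborel :: (real ^ 'm) measure"
  have i: "integrable ?M (\<lambda>y. k * indicator (ball z s) y :: real)" for k z s
    by (intro integrable_mult_right integrable_real_indicator) (auto simp: emeasure_bounded_finite[unfolded infinity_ennreal_def])
  have e: "integral\<^sup>L ?M (\<lambda>y. k * indicator (ball z s) y) = k * (unit_ball_vol (real CARD('m)) * s ^ CARD('m))" if "s \<ge> 0" for k z s
    using content_ball[OF that, of z] by simp
  have "0 = integral\<^sup>L ?M (divergence G)"
    using integral_divergence_eq_0[OF C1 supp] by simp
  also have "\<dots> \<le> integral\<^sup>L ?M (\<lambda>y. - \<kappa> * indicator (ball x0 \<rho>) y + (\<Sum>n\<in>I. c n * indicator (ball (x n) (r n)) y))"
    by (intro integral_mono integral_divergence_eq_0[OF C1 supp] le Bochner_Integration.integrable_add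
        Bochner_Integration.integrable_sum i)
  also have "\<dots> = - \<kappa> * (unit_ball_vol (real CARD('m)) * \<rho> ^ CARD('m))
      + (\<Sum>n\<in>I. c n * (unit_ball_vol (real CARD('m)) * r n ^ CARD('m)))"
  proof -
    have "integral\<^sup>L ?M (\<lambda>y. \<Sum>n\<in>I. c n * indicator (ball (x n) (r n)) y)
        = (\<Sum>n\<in>I. integral\<^sup>L ?M (\<lambda>y. c n * indicator (ball (x n) (r n)) y))"
      by (intro Bochner_Integration.integral_sum i)
    also have "\<dots> = (\<Sum>n\<in>I. c n * (unit_ball_vol (real CARD('m)) * r n ^ CARD('m)))"
      by (intro sum.cong refl e r)
    finally show ?thesis
      by (subst Bochner_Integration.integral_add[OF i Bochner_Integration.integrable_sum[OF i]]) (simp only: e[OF \<rho>])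
  qed
  finally show ?thesis by simp
qed

text \<open>A ball about any point of a set contains that set once its radius exceeds the diameter.
  Enlarging the radii even of sets of diameter 0 costs an excess that is spread geometrically over
  the cover; compactness then leaves finitely many balls.\<close>

lemma null_hausdorff_cover:
  fixes K :: "'a::metric_space set"
  assumes null: "hausdorff_measure d A = 0" and K: "compact K" "K \<subseteq> A" and "\<delta> > 0" "\<eta> > 0"
  shows "\<exists>I x r. finite (I :: nat set) \<and> (\<forall>n\<in>I. x n \<in> K \<and> 0 < r n \<and> r n < \<delta>) \<and>
    K \<subseteq> (\<Union>n\<in>I. ball (x n) (r n)) \<and> (\<Sum>n\<in>I. r n ^ d) < \<eta>"
proof -
  \<comment> \<open>Normalization of the Hausdorff measure: a nonempty set of diameter
    \<open>D\<close> contributes \<open>\<omega> * D ^ d\<close>.\<close>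
  define \<omega> where "\<omega> = unit_ball_vol (real d) / 2 ^ d"
  have \<omega>: "\<omega> > 0" by (simp add: \<omega>_def)
  \<comment> \<open>The cover then costs \<open>\<eta> / 4\<close> and the enlargement of the radii
    at most \<open>\<eta> / 4 * 2\<close>, in total less than \<eta>.\<close>
  define \<eta>' where "\<eta>' = \<omega> * \<eta> / 4"
  have \<eta>': "\<eta>' > 0" using \<omega> assms(5) by (simp add: \<eta>'_def)
  have "hausdorff_premeasure d (\<delta> / 2) A \<le> hausdorff_measure d A"
    unfolding hausdorff_measure_def by (rule SUP_upper) (use assms(4) in simp)
  then have "hausdorff_premeasure d (\<delta> / 2) A < ennreal \<eta>'"
    using null \<eta>' by simp
  then obtain C :: "nat \<Rightarrow> 'a set" where C: "A \<subseteq> (\<Union>n. C n)" "\<And>n. bounded (C n)" "\<And>n. diameter (C n) \<le> \<delta> / 2"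
    "(\<Sum>n. ennreal (if C n = {} then 0 else unit_ball_vol (real d) * (diameter (C n) / 2) ^ d)) < ennreal \<eta>'"
    unfolding hausdorff_premeasure_def INF_less_iff by auto
  define a where "a n = (if C n = {} then 0 else unit_ball_vol (real d) * (diameter (C n) / 2) ^ d)" for n
  have dn: "diameter (C n) \<ge> 0" for n by (rule diameter_ge_0[OF C(2)])
  have a0: "a n \<ge> 0" for n using dn[of n] by (simp add: a_def)
  have a_sum: "(\<Sum>n\<in>I. a n) < \<eta>'" if "finite I" for I
  proof -
    have "ennreal (\<Sum>n\<in>I. a n) = (\<Sum>n\<in>I. ennreal (a n))"
      using a0 by (simp add: sum_ennreal)
    also have "\<dots> \<le> (\<Sum>n. ennreal (a n))"
      by (rule sum_le_suminf) (use that in auto)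
    also have "\<dots> < ennreal \<eta>'" using C(4) by (simp add: a_def[abs_def])
    finally show ?thesis
      using a0 by (simp add: ennreal_less_iff sum_nonneg)
  qed
  have "\<exists>r. diameter (C n) < r \<and> r < \<delta> \<and> r ^ d < diameter (C n) ^ d + \<eta> / 4 * (1/2) ^ n" for n
  proof -
    let ?D = "diameter (C n)"
    have "((\<lambda>r. r ^ d) \<longlongrightarrow> ?D ^ d) (at_right ?D)" by (intro tendsto_intros)
    moreover have "?D ^ d < ?D ^ d + \<eta> / 4 * (1/2) ^ n" using assms(5) by simp
    ultimately have "\<forall>\<^sub>F r in at_right ?D. r ^ d < ?D ^ d + \<eta> / 4 * (1/2) ^ n"
      by (rule order_tendstoD)
    moreover have "\<forall>\<^sub>F r in at_right ?D. r < \<delta>" "\<forall>\<^sub>F r in at_right ?D. r > ?D"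
      using C(3)[of n] assms(4) by (auto intro!: eventually_at_right_less order_tendstoD(2)[OF tendsto_ident_at])
    ultimately have "\<forall>\<^sub>F r in at_right ?D. ?D < r \<and> r < \<delta> \<and> r ^ d < ?D ^ d + \<eta> / 4 * (1/2) ^ n"
      by eventually_elim auto
    then show ?thesis
      using eventually_happens trivial_limit_at_right_real by blast
  qed
  then obtain r where r: "\<And>n. diameter (C n) < r n" "\<And>n. r n < \<delta>" "\<And>n. r n ^ d < diameter (C n) ^ d + \<eta> / 4 * (1/2) ^ n"
    by metis
  \<comment> \<open>Sets that miss \<open>K\<close> are discarded, as they offer no centre in
    \<open>K\<close>.\<close>
  define J where "J = {n. C n \<inter> K \<noteq> {}}"
  have "\<forall>n\<in>J. \<exists>z. z \<in> C n \<inter> K"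
    by (auto simp: J_def)
  from bchoice[OF this] obtain x where x: "\<And>n. n \<in> J \<Longrightarrow> x n \<in> C n \<inter> K"
    by blast
  have "K \<subseteq> (\<Union>n\<in>J. ball (x n) (r n))"
  proof
    fix y assume y: "y \<in> K"
    then obtain n where n: "y \<in> C n" using C(1) K by blast
    then have "n \<in> J" using y by (auto simp: J_def)
    moreover have "dist (x n) y < r n"
      using diameter_bounded_bound[OF C(2), of "x n" n y] x[OF \<open>n \<in> J\<close>] n r(1)[of n] by auto
    ultimately show "y \<in> (\<Union>n\<in>J. ball (x n) (r n))" by auto
  qed
  then obtain I where I: "I \<subseteq> J" "finite I" "K \<subseteq> (\<Union>n\<in>I. ball (x n) (r n))"
    using compactE_image[OF K(1), of J "\<lambda>n. ball (x n) (r n)"] by auto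
  have "(\<Sum>n\<in>I. r n ^ d) \<le> (\<Sum>n\<in>I. a n / \<omega> + \<eta> / 4 * (1/2) ^ n)"
  proof (rule sum_mono)
    fix n assume "n \<in> I"
    then have "C n \<noteq> {}" using I x by blast
    then have "diameter (C n) ^ d = a n / \<omega>"
      using less_imp_neq[OF unit_ball_vol_pos[of "real d"]] by (simp add: a_def \<omega>_def power_divide)
    then show "r n ^ d \<le> a n / \<omega> + \<eta> / 4 * (1/2) ^ n" using r(3)[of n] by simp
  qed
  also have "\<dots> = (\<Sum>n\<in>I. a n) / \<omega> + \<eta> / 4 * (\<Sum>n\<in>I. (1/2) ^ n)"
    by (simp only: sum.distrib sum_divide_distrib sum_distrib_left)
  also have "\<dots> \<le> \<eta>' / \<omega> + \<eta> / 4 * 2"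
  proof -
    have "(\<Sum>n\<in>I. (1/2::real) ^ n) \<le> (\<Sum>n. (1/2) ^ n)"
      by (rule sum_le_suminf) (use I(2) in \<open>auto intro: summable_geometric\<close>)
    also have "\<dots> = 2" by (simp add: suminf_geometric)
    finally have "(\<Sum>n\<in>I. (1/2::real) ^ n) \<le> 2" .
    then show ?thesis
      using a_sum[OF I(2)] \<omega> assms(5) by (intro add_mono divide_right_mono mult_left_mono) auto
  qed
  also have "\<dots> < \<eta>" using \<omega> assms(5) by (simp add: \<eta>'_def)
  finally have "(\<Sum>n\<in>I. r n ^ d) < \<eta>" .
  moreover have "\<forall>n\<in>I. x n \<in> K \<and> 0 < r n \<and> r n < \<delta>"
    using I x r dn by (meson IntD2 le_less_trans subsetD)
  ultimately show ?thesis using I by blast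
qed

text \<open>Squaring removes the kink of the positive part and yields a \<open>C^1\<close>
  truncation, which is enough regularity for the divergence theorem above.\<close>

definition sqpos :: "real \<Rightarrow> real" where
  "sqpos t = (max 0 t)\<^sup>2"

lemma sqpos_has_derivative: "(sqpos has_real_derivative 2 * max 0 t) (at t)"
proof -
  consider "t > 0" | "t < 0" | "t = 0" by linarith
  then show ?thesis
  proof cases
    case 1
    have "((\<lambda>t. t\<^sup>2) has_real_derivative 2 * t) (at t)"
      by (auto intro!: derivative_eq_intros)
    then have "(sqpos has_real_derivative 2 * t) (at t)"
      by (rule has_field_derivative_transform_within_open[of _ _ _ "{0<..}"]) (use 1 in \<open>auto simp: sqpos_def\<close>)
    then show ?thesis using 1 by simp
  next
    case 2
    have "((\<lambda>t. 0) has_real_derivative 0) (at t)" by simp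
    then have "(sqpos has_real_derivative 0) (at t)"
      by (rule has_field_derivative_transform_within_open[of _ _ _ "{..<0}"]) (use 2 in \<open>auto simp: sqpos_def\<close>)
    then show ?thesis using 2 by simp
  next
    case 3
    have "((\<lambda>h. (sqpos (0 + h) - sqpos 0) / h) \<longlongrightarrow> 0) (at 0)"
    proof (rule Lim_null_comparison)
      show "\<forall>\<^sub>F h in at 0. norm ((sqpos (0 + h) - sqpos 0) / h) \<le> \<bar>h\<bar>"
        by (rule always_eventually) (auto simp: sqpos_def max_def power2_eq_square)
      show "((\<lambda>h::real. \<bar>h\<bar>) \<longlongrightarrow> 0) (at 0)" by (rule tendsto_rabs_zero) (rule tendsto_ident_at)
    qed
    then show ?thesis using 3 by (simp add: DERIV_def)
  qed
qed

lemma sqpos_compose_has_derivative: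
  "(f has_derivative f') (at x) \<Longrightarrow> ((\<lambda>x. sqpos (f x)) has_derivative (\<lambda>h. 2 * max 0 (f x) * f' h)) (at x)"
  using has_derivative_compose[OF _ sqpos_has_derivative[unfolded has_field_derivative_def], of f f' x UNIV] by simp

lemma Ck_on_sqpos:
  assumes "open U" "Ck_on 1 f U"
  shows "Ck_on 1 (\<lambda>x. sqpos (f x)) U"
proof -
  have "Ck_on (Suc 0) (\<lambda>x. sqpos (f x)) U"
  proof (rule Ck_on_Suc_intro[OF assms(1)])
    show "((\<lambda>x. sqpos (f x)) has_derivative (\<lambda>h. 2 * max 0 (f x) * frechet_derivative f (at x) h)) (at x)" if "x \<in> U" for x
      using Ck_on_Suc_has_derivative[of 0 f U x] assms(2) that by (intro sqpos_compose_has_derivative) simp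
    show "Ck_on 0 (\<lambda>x. 2 * max 0 (f x) * frechet_derivative f (at x) b) U" if "b \<in> Basis" for b
      using assms(2) that Ck_on_continuous[OF assms(2)] by (auto intro!: continuous_intros)
  qed
  then show ?thesis by simp
qed

text \<open>The cutoff depends on \<open>s = |y - x0|^2 / r^2\<close> and passes from 0 at
  \<open>s \<le> 1\<close> to 1 at \<open>s \<ge> 2\<close>. The 12 is the product of 4 from the two
  truncations, 2 from the derivative of \<open>s\<close>, and \<open>3 / 2\<close>, which bounds
  \<open>|y - x0| / r\<close> where \<open>s < 2\<close>.\<close>

lemma ball_cutoff:
  fixes x0 :: "real ^ 'm"
  assumes r: "r > 0"
  obtains \<zeta> :: "real ^ 'm \<Rightarrow> real" where "Ck_on 1 \<zeta> UNIV" "\<And>y. 0 \<le> \<zeta> y" "\<And>y. \<zeta> y \<le> 1"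
    "\<And>y. y \<in> ball x0 r \<Longrightarrow> \<zeta> y = 0" "\<And>y. 2 * r \<le> dist y x0 \<Longrightarrow> \<zeta> y = 1"
    "\<And>y. norm (grad \<zeta> y) \<le> 12 / r * indicator (ball x0 (2 * r)) y"
proof -
  define s where "s y = ((y - x0) \<bullet> (y - x0)) / r\<^sup>2" for y
  define \<zeta> where "\<zeta> y = 1 - sqpos (1 - sqpos (s y - 1))" for y
  have s_eq: "s y = (dist y x0 / r)\<^sup>2" for y
    by (simp add: s_def dot_square_norm dist_norm power_divide)
  have s_der: "(s has_derivative (\<lambda>h. (2 / r\<^sup>2) * ((y - x0) \<bullet> h))) (at y)" for y
  proof -
    have "((\<lambda>y. (y - x0) \<bullet> (y - x0)) has_derivative (\<lambda>h. 2 * ((y - x0) \<bullet> h))) (at y)"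
      by (auto intro!: derivative_eq_intros simp: inner_commute)
    from bounded_linear.has_derivative[OF bounded_linear_divide this, of "r\<^sup>2"] show ?thesis
      by (simp add: s_def[abs_def])
  qed
  have "Ck_on (Suc 0) s UNIV"
    by (rule Ck_on_Suc_intro[OF open_UNIV s_der]) (use r in \<open>auto intro!: continuous_intros\<close>)
  then have s_C1: "Ck_on 1 s UNIV" by simp
  have C1: "Ck_on 1 \<zeta> UNIV"
    unfolding \<zeta>_def by (intro Ck_on_diff Ck_on_sqpos Ck_on_const s_C1 open_UNIV)
  have sq: "0 \<le> sqpos t" for t by (simp add: sqpos_def)
  have sq1: "sqpos (1 - t) \<le> 1" if "t \<ge> 0" for t
    using that power_mono[of "max 0 (1 - t)" 1 2] by (simp add: sqpos_def)
  define c where "c y = (2 * max 0 (1 - sqpos (s y - 1))) * (2 * max 0 (s y - 1))" for y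
  have "(\<zeta> has_derivative (\<lambda>h. 0 - 2 * max 0 (1 - sqpos (s y - 1)) *
      (0 - 2 * max 0 (s y - 1) * ((2 / r\<^sup>2) * ((y - x0) \<bullet> h) - 0)))) (at y)" for y
    unfolding \<zeta>_def by (intro has_derivative_diff has_derivative_const sqpos_compose_has_derivative s_der)
  then have "(\<zeta> has_derivative (\<lambda>h. ((c y * (2 / r\<^sup>2)) *\<^sub>R (y - x0)) \<bullet> h)) (at y)" for y
    by (rule has_derivative_eq_rhs) (simp add: c_def fun_eq_iff mult_ac)
  then have grad: "grad \<zeta> y = (c y * (2 / r\<^sup>2)) *\<^sub>R (y - x0)" for y
    by (rule grad_eqI)
  have "norm (grad \<zeta> y) \<le> 12 / r * indicator (ball x0 (2 * r)) y" for y
  proof (cases "s y < 2")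
    case True
    have "(dist y x0 / r)\<^sup>2 \<le> (3 / 2)\<^sup>2"
    proof -
      have "(3 / 2 :: real)\<^sup>2 = 9 / 4" by (simp add: power2_eq_square)
      then show ?thesis using True[unfolded s_eq] by linarith
    qed
    then have d: "dist y x0 / r \<le> 3 / 2"
      by (rule power2_le_imp_le) simp
    have "0 \<le> c y" by (simp add: c_def)
    have "c y \<le> (2 * 1) * (2 * 1)"
      unfolding c_def using True sq[of "s y - 1"] by (intro mult_mono) auto
    then have "norm (grad \<zeta> y) \<le> 4 * (2 / r\<^sup>2) * dist y x0"
      unfolding grad using \<open>0 \<le> c y\<close> by (simp add: dist_norm abs_mult) (intro mult_right_mono divide_right_mono; simp)
    also have "\<dots> = (8 / r) * (dist y x0 / r)"
      by (simp add: power2_eq_square)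
    also have "\<dots> \<le> (8 / r) * (3 / 2)"
      using d r by (intro mult_left_mono) auto
    finally have "norm (grad \<zeta> y) \<le> 12 / r" by simp
    moreover have "y \<in> ball x0 (2 * r)"
      using d r by (simp add: dist_commute pos_divide_le_eq)
    ultimately show ?thesis by simp
  next
    case False
    then have "1\<^sup>2 \<le> (s y - 1)\<^sup>2" by (intro power_mono) auto
    then have "c y = 0" using False by (simp add: c_def sqpos_def)
    then show ?thesis using r by (simp add: grad indicator_def)
  qed
  moreover have "\<zeta> y = 0" if "y \<in> ball x0 r" for y
  proof -
    have "dist y x0 / r \<le> 1" using that r by (simp add: dist_commute)
    then have "s y \<le> 1" unfolding s_eq using r by (simp add: power_le_one)
    then show ?thesis by (simp add: \<zeta>_def sqpos_def)
  qed
  moreover have "\<zeta> y = 1" if "2 * r \<le> dist y x0" for y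
  proof -
    have "2 \<le> dist y x0 / r" using that r by (simp add: pos_le_divide_eq)
    then have "2\<^sup>2 \<le> s y" unfolding s_eq by (intro power_mono) auto
    then have "1\<^sup>2 \<le> (s y - 1)\<^sup>2" "s y \<ge> 1" by (auto intro!: power_mono)
    then show ?thesis by (simp add: \<zeta>_def sqpos_def)
  qed
  moreover have "0 \<le> \<zeta> y" "\<zeta> y \<le> 1" for y
    unfolding \<zeta>_def using sq sq1[OF sq[of "s y - 1"]] by (auto simp: algebra_simps)
  ultimately show ?thesis using that C1 by blast
qed

text \<open>A product of single-ball cutoffs: all factors lie between 0 and 1, so by the product
  rule the gradient is at most the sum of the single gradients.\<close>

lemma balls_cutoff:
  fixes x :: "nat \<Rightarrow> real ^ 'm"
  assumes "finite I" "\<And>n. n \<in> I \<Longrightarrow> r n > 0"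
  shows "\<exists>\<zeta> :: real ^ 'm \<Rightarrow> real. Ck_on 1 \<zeta> UNIV \<and> (\<forall>y. 0 \<le> \<zeta> y \<and> \<zeta> y \<le> 1) \<and>
    (\<forall>n\<in>I. \<forall>y\<in>ball (x n) (r n). \<zeta> y = 0) \<and> (\<forall>y. (\<forall>n\<in>I. 2 * r n \<le> dist y (x n)) \<longrightarrow> \<zeta> y = 1) \<and>
    (\<forall>y. norm (grad \<zeta> y) \<le> (\<Sum>n\<in>I. 12 / r n * indicator (ball (x n) (2 * r n)) y))"
  using assms
proof (induction I)
  case empty
  have "grad (\<lambda>y. 1) y = 0" for y :: "real ^ 'm"
    by (rule grad_eqI) simp
  then show ?case by (intro exI[of _ "\<lambda>y. 1"]) (simp add: Ck_on_const del: Ck_on.simps)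
next
  case (insert k I)
  obtain \<zeta> :: "real ^ 'm \<Rightarrow> real" where \<zeta>: "Ck_on 1 \<zeta> UNIV" "\<And>y. 0 \<le> \<zeta> y" "\<And>y. \<zeta> y \<le> 1"
    "\<And>n y. n \<in> I \<Longrightarrow> y \<in> ball (x n) (r n) \<Longrightarrow> \<zeta> y = 0" "\<And>y. (\<forall>n\<in>I. 2 * r n \<le> dist y (x n)) \<Longrightarrow> \<zeta> y = 1"
    "\<And>y. norm (grad \<zeta> y) \<le> (\<Sum>n\<in>I. 12 / r n * indicator (ball (x n) (2 * r n)) y)"
    using insert.IH insert.prems by blast
  obtain \<theta> :: "real ^ 'm \<Rightarrow> real" where \<theta>: "Ck_on 1 \<theta> UNIV" "\<And>y. 0 \<le> \<theta> y" "\<And>y. \<theta> y \<le> 1"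
    "\<And>y. y \<in> ball (x k) (r k) \<Longrightarrow> \<theta> y = 0" "\<And>y. 2 * r k \<le> dist y (x k) \<Longrightarrow> \<theta> y = 1"
    "\<And>y. norm (grad \<theta> y) \<le> 12 / r k * indicator (ball (x k) (2 * r k)) y"
    using ball_cutoff[of "r k" "x k"] insert.prems by blast
  have diff: "\<zeta> differentiable (at y)" "\<theta> differentiable (at y)" for y
    using \<zeta>(1) \<theta>(1) by auto
  have "((\<lambda>y. \<theta> y * \<zeta> y) has_derivative (\<lambda>h. (\<theta> y *\<^sub>R grad \<zeta> y + \<zeta> y *\<^sub>R grad \<theta> y) \<bullet> h)) (at y)" for y
    using has_derivative_mult[OF has_derivative_grad[OF diff(2)] has_derivative_grad[OF diff(1)], of y]
    by (simp add: inner_add_left mult.commute)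
  then have g: "grad (\<lambda>y. \<theta> y * \<zeta> y) y = \<theta> y *\<^sub>R grad \<zeta> y + \<zeta> y *\<^sub>R grad \<theta> y" for y
    by (rule grad_eqI)
  have "norm (grad (\<lambda>y. \<theta> y * \<zeta> y) y) \<le> (\<Sum>n\<in>insert k I. 12 / r n * indicator (ball (x n) (2 * r n)) y)" for y
  proof -
    have "norm (grad (\<lambda>y. \<theta> y * \<zeta> y) y) \<le> \<theta> y * norm (grad \<zeta> y) + \<zeta> y * norm (grad \<theta> y)"
      unfolding g using norm_triangle_ineq[of "\<theta> y *\<^sub>R grad \<zeta> y"] \<zeta>(2) \<theta>(2) by (metis abs_of_nonneg norm_scaleR)
    also have "\<dots> \<le> norm (grad \<zeta> y) + norm (grad \<theta> y)"
      using \<zeta>(2,3) \<theta>(2,3) by (intro add_mono mult_left_le_one_le) auto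
    finally show ?thesis using \<zeta>(6)[of y] \<theta>(6)[of y] insert.hyps by simp
  qed
  moreover have "Ck_on 1 (\<lambda>y. \<theta> y * \<zeta> y) UNIV"
    by (intro Ck_on_mult open_UNIV \<zeta> \<theta>)
  ultimately show ?case
    using \<zeta>(2-5) \<theta>(2-5) by (intro exI[of _ "\<lambda>y. \<theta> y * \<zeta> y"]) (auto intro: mult_le_one simp del: Ck_on.simps)
qed

section \<open>The isolated singular point\<close>

text \<open>The mean value theorem in direction \<open>a\<close> is applied to the increment of
  \<open>f\<close> in direction \<open>b\<close>; strict differentiability of the gradient then
  evaluates the difference of gradients that appears.\<close>

lemma second_difference_estimate:
  fixes f :: "real ^ 'm \<Rightarrow> real"
  assumes V: "open V" "x \<in> V" and C2: "Ck_on 2 f V" and "e > 0"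
  defines "H \<equiv> frechet_derivative (grad f) (at x)"
  shows "\<exists>\<tau>>0. \<forall>t. 0 < t \<and> t < \<tau> \<longrightarrow>
    \<bar>f (x + t *\<^sub>R a + t *\<^sub>R b) - f (x + t *\<^sub>R a) - f (x + t *\<^sub>R b) + f x - t\<^sup>2 * (a \<bullet> H b)\<bar> \<le> e * t\<^sup>2"
proof -
  define M where "M = norm a * norm b + 1"
  have M: "M > 0" by (simp add: M_def add_nonneg_pos)
  have C1: "Ck_on 1 (grad f) V"
    using Ck_on_grad[of V 1 f] V(1) C2 by (simp add: numeral_2_eq_2 del: Ck_on.simps)
  have linH: "linear H"
    unfolding H_def using C1_has_derivative[OF C1 V(2)] has_derivative_linear by blast
  obtain d where d: "d > 0" "ball x d \<subseteq> V"
    "\<And>y z. y \<in> ball x d \<Longrightarrow> z \<in> ball x d \<Longrightarrow> norm (grad f y - grad f z - H (y - z)) \<le> (e / M) * norm (y - z)"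
    using C1_strict_derivative[OF V(1) C1 V(2), of "e / M"] M assms(4) unfolding H_def by auto
  define N where "N = norm a + norm b + 1"
  have N: "N > 0" by (simp add: N_def add_nonneg_pos)
  have "\<bar>f (x + t *\<^sub>R a + t *\<^sub>R b) - f (x + t *\<^sub>R a) - f (x + t *\<^sub>R b) + f x - t\<^sup>2 * (a \<bullet> H b)\<bar> \<le> e * t\<^sup>2"
    if t: "0 < t" "t < d / N" for t
  proof -
    have tN: "t * N < d" using t N by (simp add: pos_less_divide_eq)
    have inb: "x + s *\<^sub>R a + r *\<^sub>R b \<in> ball x d" if "0 \<le> s" "s \<le> t" "0 \<le> r" "r \<le> t" for s r
    proof -
      have "norm (s *\<^sub>R a + r *\<^sub>R b) \<le> s * norm a + r * norm b"
        using norm_triangle_ineq[of "s *\<^sub>R a" "r *\<^sub>R b"] that by simp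
      also have "\<dots> \<le> t * norm a + t * norm b"
        using that by (intro add_mono mult_right_mono) auto
      also have "\<dots> \<le> t * N" using t by (simp add: N_def algebra_simps)
      finally have "norm (s *\<^sub>R a + r *\<^sub>R b) < d" using tN by linarith
      moreover have "x - (x + s *\<^sub>R a + r *\<^sub>R b) = - (s *\<^sub>R a + r *\<^sub>R b)" by simp
      ultimately show ?thesis by (simp only: mem_ball dist_norm norm_minus_cancel)
    qed
    have der: "((\<lambda>s. f (x + s *\<^sub>R a + r *\<^sub>R b)) has_real_derivative grad f (x + s *\<^sub>R a + r *\<^sub>R b) \<bullet> a) (at s)"
      if "0 \<le> s" "s \<le> t" "0 \<le> r" "r \<le> t" for s r
    proof -
      have "((\<lambda>s. x + s *\<^sub>R a + r *\<^sub>R b) has_derivative (\<lambda>s. s *\<^sub>R a)) (at s)"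
        by (auto intro!: derivative_eq_intros)
      moreover have "x + s *\<^sub>R a + r *\<^sub>R b \<in> V" using inb[OF that] d(2) by blast
      ultimately have "((\<lambda>s. f (x + s *\<^sub>R a + r *\<^sub>R b)) has_derivative
          (\<lambda>h. grad f (x + s *\<^sub>R a + r *\<^sub>R b) \<bullet> (h *\<^sub>R a))) (at s)"
        by (intro has_derivative_compose[OF _ C2_has_derivative_grad[OF C2]])
      then show ?thesis
        by (simp add: has_field_derivative_def mult.commute[of _ "grad f _ \<bullet> a"])
    qed
    define k where "k s = f (x + s *\<^sub>R a + t *\<^sub>R b) - f (x + s *\<^sub>R a + 0 *\<^sub>R b)" for s
    have k_der: "(k has_real_derivative (grad f (x + s *\<^sub>R a + t *\<^sub>R b) \<bullet> a - grad f (x + s *\<^sub>R a + 0 *\<^sub>R b) \<bullet> a)) (at s)"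
      if "0 \<le> s" "s \<le> t" for s
      unfolding k_def by (intro DERIV_diff der) (use that t in auto)
    obtain s where s: "0 < s" "s < t"
      "k t - k 0 = (t - 0) * (grad f (x + s *\<^sub>R a + t *\<^sub>R b) \<bullet> a - grad f (x + s *\<^sub>R a + 0 *\<^sub>R b) \<bullet> a)"
      using MVT2[OF t(1) k_der] by blast
    define R where "R = grad f (x + s *\<^sub>R a + t *\<^sub>R b) - grad f (x + s *\<^sub>R a + 0 *\<^sub>R b) - H (t *\<^sub>R b)"
    have "norm R \<le> (e / M) * norm (t *\<^sub>R b)"
      using d(3)[OF inb[of s t] inb[of s 0]] s t by (simp add: R_def)
    then have "norm R * norm a \<le> (e / M) * norm (t *\<^sub>R b) * norm a"
      by (intro mult_right_mono) auto
    also have "\<dots> = (e * t / M) * (norm a * norm b)" using t by simp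
    also have "\<dots> \<le> (e * t / M) * M"
      using assms(4) t M by (intro mult_left_mono) (auto simp: M_def)
    finally have R: "norm R * norm a \<le> e * t" using M by simp
    have "grad f (x + s *\<^sub>R a + t *\<^sub>R b) - grad f (x + s *\<^sub>R a + 0 *\<^sub>R b) = R + t *\<^sub>R H b"
      by (simp add: R_def linear_cmul[OF linH])
    then have "k t - k 0 = t * ((R + t *\<^sub>R H b) \<bullet> a)"
      using s(3) by (simp add: inner_diff_left[symmetric])
    then have "k t - k 0 - t\<^sup>2 * (a \<bullet> H b) = t * (R \<bullet> a)"
      by (simp add: inner_add_left inner_commute algebra_simps power2_eq_square)
    then have "\<bar>k t - k 0 - t\<^sup>2 * (a \<bullet> H b)\<bar> \<le> t * (e * t)"
      using Cauchy_Schwarz_ineq2[of R a] R t by (simp add: abs_mult)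
    then show ?thesis
      by (simp add: k_def power2_eq_square mult_ac)
  qed
  then show ?thesis
    using d(1) N by (intro exI[of _ "d / N"]) auto
qed

text \<open>The second difference is symmetric in \<open>a\<close> and \<open>b\<close>, and both
  sides are its limit after division by \<open>t\<^sup>2\<close>.\<close>

lemma hessian_symmetric:
  fixes f :: "real ^ 'm \<Rightarrow> real"
  assumes V: "open V" "x \<in> V" and C2: "Ck_on 2 f V"
  shows "a \<bullet> frechet_derivative (grad f) (at x) b = b \<bullet> frechet_derivative (grad f) (at x) a"
proof -
  let ?H = "frechet_derivative (grad f) (at x)"
  have "\<bar>a \<bullet> ?H b - b \<bullet> ?H a\<bar> \<le> 0 + e" if e: "e > 0" for e
  proof -
    have e2: "e / 2 > 0" using e by simp
    obtain \<tau> where \<tau>: "\<tau> > 0" "\<And>t. 0 < t \<Longrightarrow> t < \<tau> \<Longrightarrow>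
      \<bar>f (x + t *\<^sub>R a + t *\<^sub>R b) - f (x + t *\<^sub>R a) - f (x + t *\<^sub>R b) + f x - t\<^sup>2 * (a \<bullet> ?H b)\<bar> \<le> e / 2 * t\<^sup>2"
      using second_difference_estimate[OF V C2 e2, of a b] by blast
    obtain \<sigma> where \<sigma>: "\<sigma> > 0" "\<And>t. 0 < t \<Longrightarrow> t < \<sigma> \<Longrightarrow>
      \<bar>f (x + t *\<^sub>R b + t *\<^sub>R a) - f (x + t *\<^sub>R b) - f (x + t *\<^sub>R a) + f x - t\<^sup>2 * (b \<bullet> ?H a)\<bar> \<le> e / 2 * t\<^sup>2"
      using second_difference_estimate[OF V C2 e2, of b a] by blast
    define t where "t = min \<tau> \<sigma> / 2"
    have t: "0 < t" "t < \<tau>" "t < \<sigma>" using \<tau>(1) \<sigma>(1) by (auto simp: t_def)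
    have "x + t *\<^sub>R b + t *\<^sub>R a = x + t *\<^sub>R a + t *\<^sub>R b" by simp
    then have "\<bar>t\<^sup>2 * (a \<bullet> ?H b) - t\<^sup>2 * (b \<bullet> ?H a)\<bar> \<le> e / 2 * t\<^sup>2 + e / 2 * t\<^sup>2"
      using \<tau>(2)[OF t(1,2)] \<sigma>(2)[OF t(1,3)] by (simp only: abs_le_iff) linarith
    then have "t\<^sup>2 * \<bar>a \<bullet> ?H b - b \<bullet> ?H a\<bar> \<le> t\<^sup>2 * e"
      by (simp add: abs_mult right_diff_distrib[symmetric] mult.commute)
    then show ?thesis using t by simp
  qed
  then have "\<bar>a \<bullet> ?H b - b \<bullet> ?H a\<bar> \<le> 0" by (rule field_le_epsilon)
  then show ?thesis by simp
qed

section \<open>The skew rotation \<open>flat_field\<close>, its divergence, and bump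
  functions\<close>

lemma flat_field_linear: "linear (\<lambda>p :: real ^ 'm. flat_field a (\<lambda>x. p) (0 :: real ^ 'm))"
  by (rule linearI) (simp_all add: flat_field_def vec_eq_iff algebra_simps sum.distrib sum_distrib_left)

lemma flat_field_inner_self:
  fixes a :: "real ^ 'm ^ 'm"
  assumes "\<And>j k. a $ j $ k + a $ k $ j = 0"
  shows "X x \<bullet> flat_field a X x = 0"
proof -
  have "X x \<bullet> flat_field a X x = (\<Sum>j\<in>UNIV. \<Sum>k\<in>UNIV. a $ j $ k * (X x $ j * X x $ k))"
    by (simp add: flat_field_def inner_vec_def sum_distrib_left mult_ac)
  moreover have "\<dots> = (\<Sum>j\<in>UNIV. \<Sum>k\<in>UNIV. a $ k $ j * (X x $ j * X x $ k))"
    by (subst sum.swap) (simp add: mult_ac)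
  moreover have "\<dots> = - (\<Sum>j\<in>UNIV. \<Sum>k\<in>UNIV. a $ j $ k * (X x $ j * X x $ k))"
    unfolding sum_negf[symmetric]
  proof (intro sum.cong refl)
    fix j k
    have "a $ k $ j = - a $ j $ k" using assms[of j k] by linarith
    then show "a $ k $ j * (X x $ j * X x $ k) = - (a $ j $ k * (X x $ j * X x $ k))"
      by (simp only: mult_minus_left)
  qed
  ultimately show ?thesis by linarith
qed

lemma flat_field_inner_parallel:
  fixes a :: "real ^ 'm ^ 'm"
  assumes a: "\<And>j k. a $ j $ k + a $ k $ j = 0" and "q = c *\<^sub>R X x"
  shows "q \<bullet> flat_field a X x = 0"
  using flat_field_inner_self[of a X x, OF a] assms(2) by simp

lemma flat_field_has_derivative:
  assumes "(X has_derivative L) (at x)"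
  shows "(flat_field a X has_derivative (\<lambda>h. flat_field a L h)) (at x)"
proof -
  \<comment> \<open>A constant field evaluated at the dummy point 0 presents the matrix
    \<open>a\<close> as a linear map on vectors.\<close>
  have bl: "bounded_linear (\<lambda>p. flat_field a (\<lambda>x. p) 0)"
    using flat_field_linear linear_conv_bounded_linear by blast
  show ?thesis
    using bounded_linear.has_derivative[OF bl assms] by (simp add: flat_field_def[abs_def])
qed

text \<open>The second derivatives of \<open>u\<close> enter as the trace of a skew matrix times the
  symmetric Hessian, which is zero.\<close>

lemma divergence_flat_field_grad_add:
  fixes a :: "real ^ 'm ^ 'm"
  assumes V: "open V" "x \<in> V" and C2: "Ck_on 2 u V" and C1: "Ck_on 1 F V"
    and a: "\<And>j k. a $ j $ k + a $ k $ j = 0"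
  shows "divergence (flat_field a (\<lambda>x. grad u x + F x)) x = divergence (flat_field a F) x"
proof -
  let ?H = "frechet_derivative (grad u) (at x)" and ?L = "frechet_derivative F (at x)"
  have C1u: "Ck_on 1 (grad u) V"
    using Ck_on_grad[of V 1 u] V(1) C2 by (simp add: numeral_2_eq_2 del: Ck_on.simps)
  note dH = C1_has_derivative[OF C1u V(2)] and dL = C1_has_derivative[OF C1 V(2)]
  have "divergence (flat_field a (\<lambda>x. grad u x + F x)) x
      = (\<Sum>i\<in>UNIV. flat_field a (\<lambda>h. ?H h + ?L h) (axis i 1) $ i)"
    by (rule divergence_eq[OF flat_field_has_derivative[OF has_derivative_add[OF dH dL]]])
  also have "\<dots> = (\<Sum>i\<in>UNIV. flat_field a ?H (axis i 1) $ i) + (\<Sum>i\<in>UNIV. flat_field a ?L (axis i 1) $ i)"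
    by (simp add: flat_field_def sum.distrib algebra_simps)
  also have "(\<Sum>i\<in>UNIV. flat_field a ?L (axis i 1) $ i) = divergence (flat_field a F) x"
    by (rule divergence_eq[OF flat_field_has_derivative[OF dL], symmetric])
  also have "(\<Sum>i\<in>UNIV. flat_field a ?H (axis i 1) $ i) = 0"
  proof -
    define S where "S j k = ?H (axis j 1) $ k" for j k
    have sym: "S k j = S j k" for j k
      using hessian_symmetric[OF V C2, of "axis j 1" "axis k 1"] by (simp add: S_def inner_axis')
    have "(\<Sum>i\<in>UNIV. flat_field a ?H (axis i 1) $ i) = (\<Sum>j\<in>UNIV. \<Sum>k\<in>UNIV. a $ j $ k * S j k)"
      by (simp add: flat_field_def S_def)
    moreover have "\<dots> = (\<Sum>j\<in>UNIV. \<Sum>k\<in>UNIV. a $ k $ j * S k j)"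
      by (rule sum.swap)
    moreover have "\<dots> = - (\<Sum>j\<in>UNIV. \<Sum>k\<in>UNIV. a $ j $ k * S j k)"
      unfolding sum_negf[symmetric]
    proof (intro sum.cong refl)
      fix j k
      have "a $ k $ j = - a $ j $ k" using a[of j k] by linarith
      then show "a $ k $ j * S k j = - (a $ j $ k * S j k)" by (simp only: sym[of j k] mult_minus_left)
    qed
    ultimately show ?thesis by linarith
  qed
  finally show ?thesis by simp
qed

lemma divergence_scaleR:
  assumes "(f has_derivative (\<lambda>h. g \<bullet> h)) (at x)" "(X has_derivative L) (at x)"
  shows "divergence (\<lambda>x. f x *\<^sub>R X x) x = f x * divergence X x + g \<bullet> X x"
proof -
  have "divergence (\<lambda>x. f x *\<^sub>R X x) x = (\<Sum>i\<in>UNIV. (f x *\<^sub>R L (axis i 1) + (g \<bullet> axis i 1) *\<^sub>R X x) $ i)"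
    by (rule divergence_eq[OF has_derivative_scaleR[OF assms]])
  then show ?thesis
    using divergence_eq[OF assms(2)]
    by (simp add: sum.distrib sum_distrib_left inner_axis inner_vec_def[of g "X x"])
qed

text \<open>Monotonicity of the gradient of the norm. With \<open>P\<close> and \<open>Q\<close> the
  unit vectors, the inner product is \<open>(|p| + |q|) (1 - P \<bullet> Q)\<close>, and
  \<open>|W|^2 = 2 (1 - P \<bullet> Q)\<close>.\<close>

lemma normalize_monotone:
  fixes p q :: "'a::real_inner"
  assumes "p \<noteq> 0" "q \<noteq> 0"
  defines "W \<equiv> q /\<^sub>R norm q - p /\<^sub>R norm p"
  shows "0 \<le> (q - p) \<bullet> W" and "(q - p) \<bullet> W = 0 \<Longrightarrow> W = 0"
proof -
  define P Q where "P = p /\<^sub>R norm p" and "Q = q /\<^sub>R norm q"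
  have PQ: "P \<bullet> P = 1" "Q \<bullet> Q = 1" "p = norm p *\<^sub>R P" "q = norm q *\<^sub>R Q"
    using assms(1,2) by (simp_all add: P_def Q_def dot_square_norm power2_eq_square)
  have "(q - p) \<bullet> W = (norm q *\<^sub>R Q - norm p *\<^sub>R P) \<bullet> (Q - P)"
    using PQ(3,4) by (simp add: W_def P_def Q_def)
  also have "\<dots> = (norm p + norm q) * (1 - P \<bullet> Q)"
    using PQ(1,2) by (simp add: inner_diff_left inner_diff_right inner_commute algebra_simps)
  finally have eq: "(q - p) \<bullet> W = (norm p + norm q) * (1 - P \<bullet> Q)" .
  have WW: "W \<bullet> W = 2 * (1 - P \<bullet> Q)"
    using PQ(1,2) by (simp add: W_def flip: P_def Q_def) (simp add: inner_diff_left inner_diff_right inner_commute)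
  then have nn: "1 - P \<bullet> Q \<ge> 0"
    using inner_ge_zero[of W] by simp
  then show "0 \<le> (q - p) \<bullet> W" unfolding eq by (intro mult_nonneg_nonneg) auto
  assume "(q - p) \<bullet> W = 0"
  moreover have "norm p + norm q \<noteq> 0" using assms(1,2) by (simp add: add_nonneg_eq_0_iff)
  ultimately have "1 - P \<bullet> Q = 0" unfolding eq by simp
  then show "W = 0" using WW by simp
qed

text \<open>Closedness of the sublevel set in the whole space keeps it from accumulating at the
  boundary of \<open>V\<close>, so \<open>V\<close> and the complement of the sublevel set are open
  and cover everything.\<close>

lemma Ck_on_bump:
  fixes f :: "real ^ 'm \<Rightarrow> real"
  assumes V: "open V" and C1: "Ck_on 1 f V" and S: "closed {x \<in> V. f x \<le> \<epsilon>}"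
  shows "Ck_on 1 (\<lambda>x. if x \<in> V then sqpos (\<epsilon> - f x) else 0) UNIV"
proof -
  let ?\<phi> = "\<lambda>x. if x \<in> V then sqpos (\<epsilon> - f x) else 0" and ?S = "{x \<in> V. f x \<le> \<epsilon>}"
  have "Ck_on 1 (\<lambda>x. sqpos (\<epsilon> - f x)) V"
    by (intro Ck_on_sqpos Ck_on_diff Ck_on_const V C1)
  then have "Ck_on 1 ?\<phi> V"
    by (subst Ck_on_cong[OF V, of _ "\<lambda>x. sqpos (\<epsilon> - f x)"]) auto
  moreover have "Ck_on 1 ?\<phi> (- ?S)"
    by (subst Ck_on_cong[of _ _ "\<lambda>x. 0"]) (use S in \<open>auto simp: sqpos_def Ck_on_const simp del: Ck_on.simps\<close>)
  moreover have "V \<union> - ?S = UNIV" by auto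
  ultimately show ?thesis
    using Ck_on_Un[OF V, of "- ?S" 1 ?\<phi>] S by (simp only: open_Compl)
qed

lemma bump_has_derivative:
  assumes "open V" "x \<in> V" "(f has_derivative (\<lambda>h. g \<bullet> h)) (at x)"
  shows "((\<lambda>x. if x \<in> V then sqpos (\<epsilon> - f x) else 0) has_derivative
      (\<lambda>h. (- (2 * max 0 (\<epsilon> - f x)) *\<^sub>R g) \<bullet> h)) (at x)"
proof -
  have "((\<lambda>x. sqpos (\<epsilon> - f x)) has_derivative (\<lambda>h. 2 * max 0 (\<epsilon> - f x) * (0 - g \<bullet> h))) (at x)"
    by (intro sqpos_compose_has_derivative has_derivative_diff has_derivative_const assms(3))
  then have "((\<lambda>x. if x \<in> V then sqpos (\<epsilon> - f x) else 0) has_derivative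
      (\<lambda>h. 2 * max 0 (\<epsilon> - f x) * (0 - g \<bullet> h))) (at x)"
    by (rule has_derivative_transform_within_open[OF _ assms(1,2)]) simp
  then show ?thesis
    by (rule has_derivative_eq_rhs) (simp add: fun_eq_iff)
qed

lemma divergence_eq_0_locally:
  assumes "open U" "x \<in> U" "\<And>y. y \<in> U \<Longrightarrow> G y = 0"
  shows "divergence G x = 0"
proof -
  have "(G has_derivative (\<lambda>h. 0)) (at x)"
    by (rule has_derivative_transform_within_open[OF has_derivative_const assms(1,2)]) (simp add: assms(3))
  then show ?thesis by (simp add: divergence_eq)
qed

text \<open>Testing \<open>div W \<le> 0\<close>, \<open>W = N(v) - N(u)\<close>, with a bump function of \<open>v - u\<close> forces
  the nonnegative quantity \<open>\<nabla>(v - u) \<bullet> W\<close> to vanish. The singular points are cut out by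
  functions whose gradients have small integral, which is where the Hausdorff null condition enters.\<close>
lemma normal_fields_agree:
  fixes u v :: "real ^ 'm \<Rightarrow> real" and F :: "real ^ 'm \<Rightarrow> real ^ 'm"
  assumes V: "open V" and C2: "Ck_on 2 u V" "Ck_on 2 v V" and C1: "Ck_on 1 F V"
    and S: "compact {x \<in> V. v x - u x \<le> \<epsilon>}"
    and K: "compact K" "K \<subseteq> A" "hausdorff_measure (CARD('m) - 1) A = 0"
    and reg: "\<And>x. x \<in> V - K \<Longrightarrow> grad u x + F x \<noteq> 0 \<and> grad v x + F x \<noteq> 0"
    and curv: "\<And>x. x \<in> V - K \<Longrightarrow> mean_curvature F v x \<le> mean_curvature F u x"
    and x0: "x0 \<in> V - K" "v x0 - u x0 < \<epsilon>"
  shows "normal_field F v x0 = normal_field F u x0"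
proof (rule ccontr)
  assume neq: "normal_field F v x0 \<noteq> normal_field F u x0"
  define S where "S = {x \<in> V. v x - u x \<le> \<epsilon>}"
  define W where "W x = normal_field F v x - normal_field F u x" for x
  define \<alpha> where "\<alpha> x = grad u x + F x" for x
  define \<beta> where "\<beta> x = grad v x + F x" for x
  define f where "f x = v x - u x" for x
  define \<phi> where "\<phi> x = (if x \<in> V then sqpos (\<epsilon> - f x) else 0)" for x
  \<comment> \<open>On \<open>V\<close> this is \<open>- \<nabla>\<phi> \<bullet> W\<close>, the
    main term in the divergence of \<open>\<phi> W\<close>. It is nonnegative off \<open>K\<close>
    by monotonicity, and positive at \<open>x0\<close> under the contrary assumption.\<close>
  define k where "k x = 2 * max 0 (\<epsilon> - f x) * ((\<beta> x - \<alpha> x) \<bullet> W x)" for x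
  let ?m = "CARD('m)"
  have S': "compact S" "S \<subseteq> V" using S by (auto simp: S_def)
  have VK: "open (V - K)" using V K(1) by (simp add: compact_imp_closed open_Diff)
  have "Ck_on 1 u V" "Ck_on 1 v V"
    using C2 Ck_on_Suc_imp[of 1] by (auto simp: numeral_2_eq_2 simp del: Ck_on.simps)
  then have C1f: "Ck_on 1 f V" unfolding f_def by (intro Ck_on_diff V)
  have C1ab: "Ck_on 1 \<alpha> V" "Ck_on 1 \<beta> V"
    unfolding \<alpha>_def \<beta>_def using Ck_on_grad_add V C2 C1 by blast+
  have C1N: "Ck_on 1 (\<lambda>x. \<gamma> x /\<^sub>R norm (\<gamma> x)) (V - K)"
    if \<gamma>: "Ck_on 1 \<gamma> V" "\<And>x. x \<in> V - K \<Longrightarrow> \<gamma> x \<noteq> 0" for \<gamma> :: "real ^ 'm \<Rightarrow> real ^ 'm"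
  proof -
    have "Ck_on (Suc 0) (\<lambda>x. \<gamma> x /\<^sub>R norm (\<gamma> x)) (V - K)"
    proof (rule Ck_on_Suc_intro[OF VK])
      show "((\<lambda>x. \<gamma> x /\<^sub>R norm (\<gamma> x)) has_derivative (\<lambda>h. frechet_derivative \<gamma> (at x) h /\<^sub>R norm (\<gamma> x)
          - ((\<gamma> x \<bullet> frechet_derivative \<gamma> (at x) h) / (norm (\<gamma> x))^3) *\<^sub>R \<gamma> x)) (at x)" if "x \<in> V - K" for x
        using that by (intro has_derivative_normalize C1_has_derivative[OF \<gamma>(1)] \<gamma>(2)) auto
      fix b :: "real ^ 'm" assume b: "b \<in> Basis"
      have "continuous_on (V - K) \<gamma>" "continuous_on (V - K) (\<lambda>x. frechet_derivative \<gamma> (at x) b)"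
        using Ck_on_continuous[OF \<gamma>(1)] \<gamma>(1) b by (auto intro: continuous_on_subset)
      then show "Ck_on 0 (\<lambda>x. frechet_derivative \<gamma> (at x) b /\<^sub>R norm (\<gamma> x)
          - ((\<gamma> x \<bullet> frechet_derivative \<gamma> (at x) b) / (norm (\<gamma> x))^3) *\<^sub>R \<gamma> x) (V - K)"
        unfolding Ck_on.simps(1) using \<gamma>(2) by (intro continuous_intros) auto
    qed
    then show ?thesis by simp
  qed
  have NN: "Ck_on 1 (normal_field F u) (V - K)" "Ck_on 1 (normal_field F v) (V - K)"
    unfolding normal_field_def[abs_def]
    using C1N[OF C1ab(1)] C1N[OF C1ab(2)] reg unfolding \<alpha>_def \<beta>_def by blast+
  have C1W: "Ck_on 1 W (V - K)"
    unfolding W_def by (intro Ck_on_diff VK NN)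
  have W_eq: "W x = \<beta> x /\<^sub>R norm (\<beta> x) - \<alpha> x /\<^sub>R norm (\<alpha> x)" for x
    by (simp add: W_def normal_field_def \<alpha>_def \<beta>_def)
  have nz: "\<alpha> x \<noteq> 0" "\<beta> x \<noteq> 0" if "x \<in> V - K" for x
    using reg[OF that] by (auto simp: \<alpha>_def \<beta>_def)
  have W2: "norm (W x) \<le> 2" if "x \<in> V - K" for x
    unfolding W_eq using nz[OF that] norm_triangle_ineq4[of "\<beta> x /\<^sub>R norm (\<beta> x)" "\<alpha> x /\<^sub>R norm (\<alpha> x)"] by simp
  have k_nonneg: "0 \<le> k x" if "x \<in> V - K" for x
    unfolding k_def W_eq using normalize_monotone(1)[OF nz[OF that]] by (intro mult_nonneg_nonneg) auto
  have k_pos: "0 < k x0"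
  proof -
    have "(\<beta> x0 - \<alpha> x0) \<bullet> W x0 \<noteq> 0"
      using normalize_monotone(2)[OF nz[OF x0(1)]] neq W_eq[of x0] by (auto simp: W_def)
    moreover have "0 \<le> (\<beta> x0 - \<alpha> x0) \<bullet> W x0"
      unfolding W_eq by (rule normalize_monotone(1)[OF nz[OF x0(1)]])
    ultimately show ?thesis using x0(2) by (simp add: k_def f_def)
  qed
  have "continuous_on (V - K) k"
    unfolding k_def using Ck_on_continuous[OF C1f] Ck_on_continuous[OF C1ab(1)] Ck_on_continuous[OF C1ab(2)] Ck_on_continuous[OF C1W]
    by (intro continuous_intros) (auto intro: continuous_on_subset)
  then have "(k \<longlongrightarrow> k x0) (nhds x0)"
    using VK x0(1) by (simp add: continuous_on_eq_continuous_at continuous_at tendsto_at_iff_tendsto_nhds)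
  then have "\<forall>\<^sub>F x in nhds x0. k x0 / 2 < k x"
    by (rule order_tendstoD) (use k_pos in simp)
  with eventually_nhds_in_open[OF VK x0(1)] have "\<forall>\<^sub>F x in nhds x0. x \<in> V - K \<and> k x0 / 2 < k x"
    by eventually_elim auto
  then obtain R where R: "R > 0" "\<And>x. dist x x0 < R \<Longrightarrow> x \<in> V - K \<and> k x0 / 2 < k x"
    unfolding eventually_nhds_metric by blast
  define \<rho> where "\<rho> = R / 2"
  define \<kappa> where "\<kappa> = k x0 / 2"
  have \<rho>: "\<rho> > 0" "\<kappa> > 0" using R k_pos by (auto simp: \<rho>_def \<kappa>_def)
  have \<phi>_C1: "Ck_on 1 \<phi> UNIV"
    unfolding \<phi>_def using Ck_on_bump[OF V C1f, of \<epsilon>] S'(1) by (simp add: S_def f_def compact_imp_closed)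
  have \<phi>0: "0 \<le> \<phi> x" for x by (simp add: \<phi>_def sqpos_def)
  have \<phi>_out: "\<phi> x = 0" if "x \<notin> S" for x
    using that by (auto simp: \<phi>_def S_def f_def sqpos_def)
  have "compact (\<phi> ` S)"
    using \<phi>_C1 Ck_on_continuous S'(1) by (intro compact_continuous_image) (blast intro: continuous_on_subset)
  then obtain M where M: "M > 0" "\<And>x. x \<in> S \<Longrightarrow> norm (\<phi> x) \<le> M"
    using compact_imp_bounded bounded_pos by (metis image_eqI)
  have \<phi>M: "\<phi> x \<le> M" for x
    using M(2)[of x] M(1) \<phi>_out[of x] by (cases "x \<in> S") auto
  have \<phi>_der: "(\<phi> has_derivative (\<lambda>h. (- (2 * max 0 (\<epsilon> - f x)) *\<^sub>R (\<beta> x - \<alpha> x)) \<bullet> h)) (at x)" if x: "x \<in> V" for x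
  proof -
    have "(f has_derivative (\<lambda>h. (\<beta> x - \<alpha> x) \<bullet> h)) (at x)"
      unfolding f_def
      by (rule has_derivative_eq_rhs[OF has_derivative_diff[OF C2_has_derivative_grad[OF C2(2) x] C2_has_derivative_grad[OF C2(1) x]]])
         (simp add: \<alpha>_def \<beta>_def inner_diff_left fun_eq_iff)
    from bump_has_derivative[OF V x this] show ?thesis
      unfolding \<phi>_def .
  qed
  define \<omega> where "\<omega> = unit_ball_vol (real ?m)"
  have \<omega>: "\<omega> > 0" by (simp add: \<omega>_def)
  \<comment> \<open>24 is the 12 of the cutoff gradient times the bound 2 for
    \<open>norm (W y)\<close>; \<open>M\<close> bounds \<phi>, and \<open>\<omega> * 2 ^ ?m\<close>
    stems from the volume of the doubled balls. Then \<eta> makes \<open>c * \<eta>\<close> equal to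
    the gain on \<open>ball x0 \<rho>\<close>.\<close>
  define c where "c = 24 * M * \<omega> * 2 ^ ?m"
  have c: "c > 0" using M \<omega> by (simp add: c_def)
  define \<eta> where "\<eta> = \<kappa> * (\<omega> * \<rho> ^ ?m) / c"
  have \<eta>: "\<eta> > 0" using \<rho> \<omega> c by (simp add: \<eta>_def)
  \<comment> \<open>The set \<open>K\<close> keeps distance at least \<open>R = 2 \<rho>\<close>
    from \<open>x0\<close>, so for radii below \<open>\<rho> / 2\<close> the doubled balls miss
    \<open>ball x0 \<rho>\<close>.\<close>
  have "\<rho> / 2 > 0" using \<rho> by simp
  from null_hausdorff_cover[OF K(3,1,2) this \<eta>] obtain I x r where I: "finite (I :: nat set)"
    and xr: "\<And>n. n \<in> I \<Longrightarrow> x n \<in> K \<and> 0 < r n \<and> r n < \<rho> / 2"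
    and cov: "K \<subseteq> (\<Union>n\<in>I. ball (x n) (r n))" and sum_small: "(\<Sum>n\<in>I. r n ^ (?m - 1)) < \<eta>"
    by blast
  obtain \<zeta> :: "real ^ 'm \<Rightarrow> real" where \<zeta>: "Ck_on 1 \<zeta> UNIV" "\<And>y. 0 \<le> \<zeta> y" "\<And>y. \<zeta> y \<le> 1"
    "\<And>n y. n \<in> I \<Longrightarrow> y \<in> ball (x n) (r n) \<Longrightarrow> \<zeta> y = 0"
    "\<And>y. (\<forall>n\<in>I. 2 * r n \<le> dist y (x n)) \<Longrightarrow> \<zeta> y = 1"
    "\<And>y. norm (grad \<zeta> y) \<le> (\<Sum>n\<in>I. 12 / r n * indicator (ball (x n) (2 * r n)) y)"
    using balls_cutoff[OF I, of r x] xr by blast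
  define G where "G y = (if y \<in> V - K then (\<phi> y * \<zeta> y) *\<^sub>R W y else 0)" for y
  let ?O = "\<Union>n\<in>I. ball (x n) (r n)"
  have G_O: "G y = 0" if "y \<in> ?O" for y using that \<zeta>(4) by (auto simp: G_def)
  have G_S: "G y = 0" if "y \<notin> S" for y using \<phi>_out[OF that] by (simp add: G_def)
  \<comment> \<open>Three open sets cover the space: the regular part of \<open>V\<close>, the balls
    around \<open>K\<close> on which the cutoff vanishes, and the complement of the compact set
    \<open>S\<close>.\<close>
  have G_C1: "Ck_on 1 G UNIV"
  proof -
    have "Ck_on 1 (\<lambda>y. (\<phi> y * \<zeta> y) *\<^sub>R W y) (V - K)"
      by (intro Ck_on_scaleR Ck_on_mult VK C1W Ck_on_subset[OF \<phi>_C1] Ck_on_subset[OF \<zeta>(1)]) auto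
    then have 1: "Ck_on 1 G (V - K)"
      by (subst Ck_on_cong[OF VK, of _ "\<lambda>y. (\<phi> y * \<zeta> y) *\<^sub>R W y"]) (auto simp: G_def)
    have oS: "open (- S)" using S'(1) by (simp add: compact_imp_closed open_Compl)
    have oO: "open ?O" by auto
    have 2: "Ck_on 1 G ?O"
      by (subst Ck_on_cong[OF oO, of _ "\<lambda>y. 0"]) (simp_all add: G_O Ck_on_const del: Ck_on.simps)
    have 3: "Ck_on 1 G (- S)"
      by (subst Ck_on_cong[OF oS, of _ "\<lambda>y. 0"]) (simp_all add: G_S Ck_on_const del: Ck_on.simps)
    have "V - K \<union> ?O \<union> - S = UNIV" using cov S'(2) by blast
    then show ?thesis
      using Ck_on_Un[OF _ oS Ck_on_Un[OF VK oO 1 2] 3] VK oO by (simp only: open_Un)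
  qed
  have far: "2 * r n \<le> dist y (x n)" if "y \<in> ball x0 \<rho>" "n \<in> I" for y n
  proof (rule ccontr)
    assume "\<not> ?thesis"
    then have "dist (x n) x0 < R"
      using that xr[OF that(2)] dist_triangle[of "x n" x0 y] by (auto simp: \<rho>_def dist_commute)
    then show False using R(2) xr[OF that(2)] by blast
  qed
  have div: "divergence G y \<le> - \<kappa> * indicator (ball x0 \<rho>) y + (\<Sum>n\<in>I. (24 * M / r n) * indicator (ball (x n) (2 * r n)) y)"
    (is "_ \<le> ?r1 + ?r2") for y
  proof -
    have r2: "?r2 \<ge> 0" using M xr by (intro sum_nonneg) (auto simp: less_imp_le)
    have ballVK: "ball x0 \<rho> \<subseteq> V - K"
      using R(2) \<rho> by (auto simp: \<rho>_def dist_commute)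
    show ?thesis
    proof (cases "y \<in> V - K")
      case False
      then have y: "y \<in> ?O \<or> y \<in> - S" using cov S'(2) by blast
      have "divergence G y = 0"
      proof (cases "y \<in> ?O")
        case True
        show ?thesis by (rule divergence_eq_0_locally[of ?O]) (use True G_O in auto)
      next
        case False
        then show ?thesis
          by (intro divergence_eq_0_locally[of "- S"]) (use y G_S S'(1) in \<open>auto simp: compact_imp_closed open_Compl\<close>)
      qed
      moreover have "y \<notin> ball x0 \<rho>" using False ballVK by blast
      ultimately show ?thesis using r2 by simp
    next
      case True
      let ?g = "- (2 * max 0 (\<epsilon> - f y)) *\<^sub>R (\<beta> y - \<alpha> y)"
      have dz: "(\<zeta> has_derivative (\<lambda>h. grad \<zeta> y \<bullet> h)) (at y)"
        by (rule has_derivative_grad) (use \<zeta>(1) in simp)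
      have df: "(\<phi> has_derivative (\<lambda>h. ?g \<bullet> h)) (at y)" using \<phi>_der True by blast
      have dp: "((\<lambda>y. \<phi> y * \<zeta> y) has_derivative (\<lambda>h. (\<phi> y *\<^sub>R grad \<zeta> y + \<zeta> y *\<^sub>R ?g) \<bullet> h)) (at y)"
        using has_derivative_mult[OF df dz] by (rule has_derivative_eq_rhs) (simp add: inner_add_left inner_diff_left fun_eq_iff)
      have dW: "(W has_derivative frechet_derivative W (at y)) (at y)"
        by (rule C1_has_derivative[OF C1W True])
      have "((\<lambda>y. (\<phi> y * \<zeta> y) *\<^sub>R W y) has_derivative
          frechet_derivative (\<lambda>y. (\<phi> y * \<zeta> y) *\<^sub>R W y) (at y)) (at y)"
        by (rule frechet_derivative_works[THEN iffD1, OF differentiableI[OF has_derivative_scaleR[OF dp dW]]])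
      then have "(G has_derivative frechet_derivative (\<lambda>y. (\<phi> y * \<zeta> y) *\<^sub>R W y) (at y)) (at y)"
        by (rule has_derivative_transform_within_open[OF _ VK True]) (simp add: G_def)
      then have "divergence G y = divergence (\<lambda>y. (\<phi> y * \<zeta> y) *\<^sub>R W y) y"
        by (subst (2) divergence_def) (rule divergence_eq)
      also have "\<dots> = (\<phi> y * \<zeta> y) * divergence W y + (\<phi> y *\<^sub>R grad \<zeta> y + \<zeta> y *\<^sub>R ?g) \<bullet> W y"
        by (rule divergence_scaleR[OF dp dW])
      also have "\<dots> = (\<phi> y * \<zeta> y) * divergence W y + \<phi> y * (grad \<zeta> y \<bullet> W y) - \<zeta> y * k y"
        by (simp add: inner_add_left inner_diff_left k_def)
      \<comment> \<open>The first term is nonpositive by the curvature inequality, the second is the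
        price of the cutoff, and the third is discarded except on \<open>ball x0 \<rho>\<close>,
        where the cutoff equals 1.\<close>
      also have "\<dots> \<le> 0 + M * ((\<Sum>n\<in>I. 12 / r n * indicator (ball (x n) (2 * r n)) y) * 2) - \<kappa> * indicator (ball x0 \<rho>) y"
      proof (intro diff_mono add_mono)
        have dNv: "(normal_field F v has_derivative frechet_derivative (normal_field F v) (at y)) (at y)"
          and dNu: "(normal_field F u has_derivative frechet_derivative (normal_field F u) (at y)) (at y)"
          using C1_has_derivative NN True by blast+
        have "divergence W y = mean_curvature F v y - mean_curvature F u y"
          using divergence_eq[OF has_derivative_diff[OF dNv dNu]]
          by (simp add: W_def[abs_def] mean_curvature_def divergence_def sum_subtractf)
        then show "(\<phi> y * \<zeta> y) * divergence W y \<le> 0"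
          using curv[OF True] \<phi>0[of y] \<zeta>(2)[of y] by (intro mult_nonneg_nonpos) auto
        have "grad \<zeta> y \<bullet> W y \<le> norm (grad \<zeta> y) * norm (W y)" by (rule norm_cauchy_schwarz)
        also have "\<dots> \<le> (\<Sum>n\<in>I. 12 / r n * indicator (ball (x n) (2 * r n)) y) * 2"
          using order_trans[OF norm_ge_zero \<zeta>(6)[of y]] by (intro mult_mono \<zeta>(6) W2[OF True]) auto
        finally have "\<phi> y * (grad \<zeta> y \<bullet> W y) \<le> \<phi> y * ((\<Sum>n\<in>I. 12 / r n * indicator (ball (x n) (2 * r n)) y) * 2)"
          using \<phi>0 by (intro mult_left_mono)
        also have "\<dots> \<le> M * ((\<Sum>n\<in>I. 12 / r n * indicator (ball (x n) (2 * r n)) y) * 2)"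
          using \<phi>M order_trans[OF norm_ge_zero \<zeta>(6)[of y]] by (intro mult_right_mono) auto
        finally show "\<phi> y * (grad \<zeta> y \<bullet> W y) \<le> M * ((\<Sum>n\<in>I. 12 / r n * indicator (ball (x n) (2 * r n)) y) * 2)" .
        show "\<kappa> * indicator (ball x0 \<rho>) y \<le> \<zeta> y * k y"
        proof (cases "y \<in> ball x0 \<rho>")
          case inb: True
          then have "\<zeta> y = 1" using \<zeta>(5) far by blast
          moreover have "\<kappa> < k y" using R(2)[of y] inb \<rho> by (auto simp: \<kappa>_def \<rho>_def dist_commute)
          ultimately show ?thesis using inb by simp
        next
          case False
          then show ?thesis using k_nonneg[OF True] \<zeta>(2) by simp
        qed
      qed
      also have "\<dots> = ?r1 + ?r2"
        by (simp add: sum_distrib_left sum_distrib_right mult_ac)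
      finally show ?thesis .
    qed
  qed
  have "\<kappa> * (\<omega> * \<rho> ^ ?m) \<le> (\<Sum>n\<in>I. (24 * M / r n) * (\<omega> * (2 * r n) ^ ?m))"
    unfolding \<omega>_def using \<rho> xr compact_imp_bounded[OF S'(1)] G_S
    by (intro divergence_estimate[OF G_C1 _ _ div]) (auto simp: less_imp_le)
  \<comment> \<open>The cutoff gradient costs one power of \<open>r n\<close> against the volume,
    which is why the Hausdorff dimension is one below that of the space.\<close>
  also have "\<dots> = (\<Sum>n\<in>I. c * r n ^ (?m - 1))"
  proof (rule sum.cong[OF refl])
    fix n assume "n \<in> I"
    then have "r n > 0" using xr by blast
    moreover have "r n ^ ?m = r n * r n ^ (?m - 1)"
      using power_minus_mult[of ?m "r n"] zero_less_card_finite by (simp add: mult.commute)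
    ultimately show "(24 * M / r n) * (\<omega> * (2 * r n) ^ ?m) = c * r n ^ (?m - 1)"
      by (simp add: c_def power_mult_distrib)
  qed
  also have "\<dots> = c * (\<Sum>n\<in>I. r n ^ (?m - 1))" by (rule sum_distrib_left[symmetric])
  also have "\<dots> < c * \<eta>" using sum_small c by (rule mult_strict_left_mono)
  also have "\<dots> = \<kappa> * (\<omega> * \<rho> ^ ?m)" using c by (simp add: \<eta>_def)
  finally show False by simp
qed

lemma Ck_on_flat_field:
  fixes X :: "real ^ 'm \<Rightarrow> real ^ 'm"
  assumes "open V" "Ck_on k X V"
  shows "Ck_on k (flat_field a X) V"
proof (rule Ck_on_vec[OF assms(1)])
  fix j
  have "Ck_on k (\<lambda>x. \<Sum>l\<in>UNIV. a $ j $ l * (X x \<bullet> axis l 1)) V"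
    by (intro Ck_on_sum Ck_on_mult Ck_on_inner Ck_on_const assms)
  then show "Ck_on k (\<lambda>x. flat_field a X x $ j) V"
    by (simp add: flat_field_def inner_axis)
qed

lemma continuous_on_divergence:
  assumes "Ck_on 1 X V"
  shows "continuous_on V (divergence X)"
  unfolding divergence_def[abs_def]
  using assms by (intro continuous_intros) (auto simp: axis_in_Basis_iff)

lemma coincidence_propagates:
  fixes \<Omega> :: "(real ^ 'm) set" and F :: "real ^ 'm \<Rightarrow> real ^ 'm" and u v w :: "real ^ 'm \<Rightarrow> real"
  assumes \<Omega>: "open \<Omega>" "connected \<Omega>" and C2: "Ck_on 2 u \<Omega>" "Ck_on 2 v \<Omega>" and C1: "Ck_on 1 F \<Omega>"
    and le: "\<And>x. x \<in> \<Omega> \<Longrightarrow> u x \<le> v x"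
    and w: "w = u \<or> w = v" and reg: "\<And>x. x \<in> \<Omega> \<Longrightarrow> grad w x + F x \<noteq> 0"
    and curv: "\<And>x. x \<in> \<Omega> \<Longrightarrow> grad u x + F x \<noteq> 0 \<Longrightarrow> grad v x + F x \<noteq> 0 \<Longrightarrow>
      mean_curvature F v x \<le> mean_curvature F u x"
    and rank: "\<And>q. q \<in> \<Omega> \<Longrightarrow>
      \<exists>U N. open U \<and> q \<in> U \<and> U \<subseteq> \<Omega> \<and>
            smooth_orthonormal_perp_frame U (normal_field F w) N \<and>
            (\<forall>x\<in>U. lie_rank U {N i |i. i \<in> {1..CARD('m) - 1}} x = CARD('m))"
    and q: "q \<in> \<Omega>" "v q = u q" and x: "x \<in> \<Omega>"
  shows "v x = u x"
proof -
  define Z where "Z = {x \<in> \<Omega>. v x - u x = 0}"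
  have "continuous_on \<Omega> (\<lambda>x. v x - u x)"
    using Ck_on_continuous C2 by (intro continuous_on_diff)
  then have "closedin (top_of_set \<Omega>) Z"
    unfolding Z_def by (rule continuous_closedin_preimage_constant)
  moreover have "open Z"
    unfolding open_contains_ball
  proof
    fix p assume p: "p \<in> Z"
    then obtain U N where U: "open U" "p \<in> U" "U \<subseteq> \<Omega>"
      "smooth_orthonormal_perp_frame U (normal_field F w) N"
      "\<And>x. x \<in> U \<Longrightarrow> lie_rank U {N i |i. i \<in> {1..CARD('m) - 1}} x = CARD('m)"
      using rank[of p] by (auto simp: Z_def)
    have "\<exists>d>0. \<forall>x\<in>ball p d. v x = u x"
    proof (rule strong_maximum_principle_local[OF U(1,2) _ _ _ _ _ w _ _ U(4,5)])
      show "Ck_on 2 u U" "Ck_on 2 v U" "Ck_on 1 F U"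
        using C2 C1 U(3) Ck_on_subset by blast+
      show "v p = u p" using p by (simp add: Z_def)
    qed (use le reg curv U(3) in blast)+
    then obtain d where d: "d > 0" "\<And>x. x \<in> ball p d \<Longrightarrow> v x = u x" by blast
    obtain e where e: "e > 0" "ball p e \<subseteq> U" using U openE by blast
    have "ball p (min d e) \<subseteq> Z" using d(2) e(2) U(3) by (auto simp: Z_def)
    then show "\<exists>e>0. ball p e \<subseteq> Z" using d(1) e(1) by (intro exI[of _ "min d e"]) auto
  qed
  then have "openin (top_of_set \<Omega>) Z" by (intro open_subset) (auto simp: Z_def)
  ultimately have "Z = {} \<or> Z = \<Omega>" using \<Omega>(2) unfolding connected_clopen by blast
  moreover have "q \<in> Z" using q by (simp add: Z_def)
  ultimately show ?thesis using x by (auto simp: Z_def)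
qed

text \<open>Where \<open>N(u) = N(v)\<close>, the field \<open>X = (\<nabla>u + F)\<^sup>b\<close> is tangent to the level sets of
  \<open>v - u\<close>, while \<open>div X = div F\<^sup>b\<close> has a sign: impossible on a compact sublevel set.\<close>
lemma not_isolated_coincidence:
  fixes F :: "real ^ 'm \<Rightarrow> real ^ 'm" and u v :: "real ^ 'm \<Rightarrow> real" and a :: "real ^ 'm ^ 'm"
  assumes V: "open V" "p0 \<in> V" and C2: "Ck_on 2 u V" "Ck_on 2 v V" and C1: "Ck_on 1 F V"
    and S: "compact {x \<in> V. v x - u x \<le> \<epsilon>}" and \<epsilon>: "\<epsilon> > 0" "v p0 = u p0"
    and K: "compact K" "K \<subseteq> A" "hausdorff_measure (CARD('m) - 1) A = 0"
    and reg: "\<And>x. x \<in> V - K \<Longrightarrow> grad u x + F x \<noteq> 0 \<and> grad v x + F x \<noteq> 0"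
    and sing: "\<And>x. x \<in> V \<inter> K \<Longrightarrow> grad u x + F x = 0 \<or> grad v x + F x = 0"
    and curv: "\<And>x. x \<in> V - K \<Longrightarrow> mean_curvature F v x \<le> mean_curvature F u x"
    and a: "\<And>j k. a $ j $ k + a $ k $ j = 0"
    and \<sigma>: "\<And>x. x \<in> V \<Longrightarrow> \<sigma> * divergence (flat_field a F) x > 0"
  shows False
proof -
  define S' where "S' = {x \<in> V. v x - u x \<le> \<epsilon>}"
  define \<alpha> where "\<alpha> x = grad u x + F x" for x
  define \<beta> where "\<beta> x = grad v x + F x" for x
  define f where "f x = v x - u x" for x
  define X where "X = flat_field a \<alpha>"
  define \<phi> where "\<phi> x = (if x \<in> V then sqpos (\<epsilon> - f x) else 0)" for x
  have S': "compact S'" "S' \<subseteq> V" using S by (auto simp: S'_def)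
  have "Ck_on 1 u V" "Ck_on 1 v V"
    using C2 Ck_on_Suc_imp[of 1] by (auto simp: numeral_2_eq_2 simp del: Ck_on.simps)
  then have C1f: "Ck_on 1 f V" unfolding f_def by (intro Ck_on_diff V)
  have C1X: "Ck_on 1 X V"
    unfolding X_def \<alpha>_def[abs_def] by (intro Ck_on_flat_field Ck_on_grad_add V C2 C1)
  \<comment> \<open>At a point of \<open>K\<close> one of the two fields vanishes, so
    \<open>X x\<close> or \<open>\<beta> x\<close> is zero; off \<open>K\<close> the agreement of
    normals makes \<open>\<beta> x\<close> a multiple of \<open>\<alpha> x\<close>, which is
    orthogonal to its own rotation.\<close>
  have orth: "(\<beta> x - \<alpha> x) \<bullet> X x = 0" if x: "x \<in> V" "f x < \<epsilon>" for x
  proof -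
    have "\<alpha> x \<bullet> X x = 0" unfolding X_def by (rule flat_field_inner_self[OF a])
    moreover have "\<beta> x \<bullet> X x = 0"
    proof (cases "x \<in> K")
      case True
      then consider "\<alpha> x = 0" | "\<beta> x = 0" using sing x(1) by (auto simp: \<alpha>_def \<beta>_def)
      then show ?thesis
      proof cases
        case 1
        then show ?thesis by (simp add: X_def flat_field_def zero_vec_def[symmetric])
      next
        case 2
        then show ?thesis by simp
      qed
    next
      case False
      then have "normal_field F v x = normal_field F u x"
        using x by (intro normal_fields_agree[OF V(1) C2 C1 S K reg curv]) (auto simp: f_def)
      then have "\<beta> x /\<^sub>R norm (\<beta> x) = \<alpha> x /\<^sub>R norm (\<alpha> x)"
        by (simp add: normal_field_def \<alpha>_def \<beta>_def)
      then have "norm (\<beta> x) *\<^sub>R (\<beta> x /\<^sub>R norm (\<beta> x)) = norm (\<beta> x) *\<^sub>R (\<alpha> x /\<^sub>R norm (\<alpha> x))"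
        by (rule arg_cong)
      moreover have "\<beta> x \<noteq> 0" using reg[of x] x False by (simp add: \<beta>_def)
      ultimately have "\<beta> x = (norm (\<beta> x) / norm (\<alpha> x)) *\<^sub>R \<alpha> x"
        by (simp add: divide_inverse)
      then show ?thesis
        unfolding X_def by (rule flat_field_inner_parallel[OF a])
    qed
    ultimately show ?thesis by (simp add: inner_diff_left)
  qed
  have \<phi>_C1: "Ck_on 1 \<phi> UNIV"
    unfolding \<phi>_def using Ck_on_bump[OF V(1) C1f, of \<epsilon>] S'(1) by (simp add: S'_def f_def compact_imp_closed)
  have \<phi>0: "0 \<le> \<phi> x" for x by (simp add: \<phi>_def sqpos_def)
  have \<phi>_out: "\<phi> x = 0" if "x \<notin> S'" for x
    using that by (auto simp: \<phi>_def S'_def f_def sqpos_def)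
  have \<phi>_der: "(\<phi> has_derivative (\<lambda>h. (- (2 * max 0 (\<epsilon> - f x)) *\<^sub>R (\<beta> x - \<alpha> x)) \<bullet> h)) (at x)" if x: "x \<in> V" for x
  proof -
    have "(f has_derivative (\<lambda>h. (\<beta> x - \<alpha> x) \<bullet> h)) (at x)"
      unfolding f_def
      by (rule has_derivative_eq_rhs[OF has_derivative_diff[OF C2_has_derivative_grad[OF C2(2) x] C2_has_derivative_grad[OF C2(1) x]]])
         (simp add: \<alpha>_def \<beta>_def inner_diff_left fun_eq_iff)
    from bump_has_derivative[OF V(1) x this] show ?thesis
      unfolding \<phi>_def .
  qed
  \<comment> \<open>The factor \<open>- \<sigma>\<close> fixes the sign: the divergence becomes
    \<open>- k\<close>, with \<open>k \<ge> 0\<close> on \<open>V\<close>.\<close>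
  define G where "G x = (- \<sigma> * \<phi> x) *\<^sub>R X x" for x
  define k where "k x = \<phi> x * (\<sigma> * divergence (flat_field a F) x)" for x
  have G_S: "G x = 0" if "x \<notin> S'" for x using \<phi>_out[OF that] by (simp add: G_def)
  have oS: "open (- S')" using S'(1) by (simp add: compact_imp_closed open_Compl)
  have G_C1: "Ck_on 1 G UNIV"
  proof -
    have "Ck_on 1 G V"
      unfolding G_def by (intro Ck_on_scaleR Ck_on_mult Ck_on_const V(1) C1X Ck_on_subset[OF \<phi>_C1]) auto
    moreover have "Ck_on 1 G (- S')"
      by (subst Ck_on_cong[OF oS, of _ "\<lambda>y. 0"]) (simp_all add: G_S Ck_on_const del: Ck_on.simps)
    moreover have "V \<union> - S' = UNIV" using S'(2) by blast
    ultimately show ?thesis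
      using Ck_on_Un[OF V(1) oS] by metis
  qed
  have div_V: "divergence G x = - k x" if x: "x \<in> V" for x
  proof -
    let ?g = "- (2 * max 0 (\<epsilon> - f x)) *\<^sub>R (\<beta> x - \<alpha> x)"
    have d: "((\<lambda>x. - \<sigma> * \<phi> x) has_derivative (\<lambda>h. (- \<sigma> *\<^sub>R ?g) \<bullet> h)) (at x)"
      using has_derivative_mult_right[OF \<phi>_der[OF x], of "- \<sigma>"] by (simp add: mult.assoc)
    have "divergence G x = (- \<sigma> * \<phi> x) * divergence X x + (- \<sigma> *\<^sub>R ?g) \<bullet> X x"
      unfolding G_def by (rule divergence_scaleR[OF d C1_has_derivative[OF C1X x]])
    \<comment> \<open>Where \<open>f x \<ge> \<epsilon>\<close> the factor
      \<open>max 0 (\<epsilon> - f x)\<close> vanishes; elsewhere the orthogonality above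
      applies.\<close>
    moreover have "?g \<bullet> X x = 0"
      using orth[OF x] by (cases "f x < \<epsilon>") auto
    moreover have "divergence X x = divergence (flat_field a F) x"
      unfolding X_def \<alpha>_def[abs_def] by (rule divergence_flat_field_grad_add[OF V(1) x C2(1) C1 a])
    ultimately show ?thesis by (simp add: k_def)
  qed
  have "continuous_on V k"
    unfolding k_def
    using Ck_on_continuous[OF \<phi>_C1] continuous_on_divergence[OF Ck_on_flat_field[OF V(1) C1]]
    by (intro continuous_intros) (auto intro: continuous_on_subset)
  then have k_tendsto: "(k \<longlongrightarrow> k p0) (nhds p0)"
    using V by (simp add: continuous_on_eq_continuous_at continuous_at tendsto_at_iff_tendsto_nhds)
  have kp: "k p0 > 0"
    using \<sigma>[OF V(2)] \<epsilon> V(2) by (simp add: k_def \<phi>_def f_def sqpos_def)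
  have "\<forall>\<^sub>F x in nhds p0. k p0 / 2 < k x"
    by (rule order_tendstoD(1)[OF k_tendsto]) (use kp in simp)
  with eventually_nhds_in_open[OF V] have "\<forall>\<^sub>F x in nhds p0. x \<in> V \<and> k p0 / 2 < k x"
    by eventually_elim auto
  then obtain \<rho> where \<rho>: "\<rho> > 0" "\<And>x. dist x p0 < \<rho> \<Longrightarrow> x \<in> V \<and> k p0 / 2 < k x"
    unfolding eventually_nhds_metric by blast
  \<comment> \<open>Unlike the normal fields, \<open>X\<close> is \<open>C^1\<close> across the
    singular points, so no cutoff enters and the family of error balls is empty.\<close>
  have div: "divergence G y \<le> - (k p0 / 2) * indicator (ball p0 \<rho>) y
      + (\<Sum>n\<in>{}. 0 * indicator (ball p0 0) y)" for y
  proof (cases "y \<in> V")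
    case True
    then have "k y \<ge> 0" using \<sigma>[OF True] \<phi>0 by (simp add: k_def)
    then show ?thesis
      using \<rho>(2)[of y] div_V[OF True] by (cases "y \<in> ball p0 \<rho>") (auto simp: dist_commute)
  next
    case False
    then have "divergence G y = 0"
      using S'(2) by (intro divergence_eq_0_locally[OF oS]) (auto simp: G_S)
    then show ?thesis using False \<rho>(2)[of y] by (auto simp: indicator_def dist_commute)
  qed
  have "k p0 / 2 * (unit_ball_vol (real CARD('m)) * \<rho> ^ CARD('m)) \<le> 0"
    using divergence_estimate[OF G_C1 compact_imp_bounded[OF S'(1)] G_S, of "k p0 / 2" p0 \<rho> "\<lambda>n. 0" "\<lambda>n. p0" "\<lambda>n. 0" "{}"] div \<rho>(1)
    by simp
  moreover have "0 < k p0 / 2 * (unit_ball_vol (real CARD('m)) * \<rho> ^ CARD('m))"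
    using kp \<rho>(1) by simp
  ultimately show False by linarith
qed

theorem theoremJ:
  fixes \<Omega> :: "(real ^ 'm) set"
    and F :: "real ^ 'm \<Rightarrow> real ^ 'm"
    and u v w w' :: "real ^ 'm \<Rightarrow> real"
    and a :: "real ^ 'm ^ 'm"
    and p0 :: "real ^ 'm"
  assumes m: "CARD('m) \<ge> 3"
    and dom: "open \<Omega>" "connected \<Omega>"
    and F: "Ck_on 1 F \<Omega>"
    and u: "Ck_on 2 u \<Omega>"
    and v: "Ck_on 2 v \<Omega>"
    and le: "\<And>x. x \<in> \<Omega> \<Longrightarrow> v x \<ge> u x"
    and a: "\<And>j k. a $ j $ k + a $ k $ j = 0"
    and ww': "(w, w') = (u, v) \<or> (w, w') = (v, u)"
    and sing: "\<Omega> \<inter> singular_set \<Omega> F w = {p0}"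
    and touch: "v p0 = u p0"
    and haus: "hausdorff_measure (CARD('m) - 1) (closure (singular_set \<Omega> F w')) = 0"
    and div: "(\<forall>x\<in>\<Omega>. divergence (flat_field a F) x > 0) \<or> (\<forall>x\<in>\<Omega>. divergence (flat_field a F) x < 0)"
    and curv: "\<And>x. x \<in> \<Omega> - ({p0} \<union> singular_set \<Omega> F w') \<Longrightarrow> mean_curvature F v x \<le> mean_curvature F u x"
    and rank: "\<And>q. q \<in> \<Omega> - {p0} \<Longrightarrow>
      \<exists>U N. open U \<and> q \<in> U \<and> U \<subseteq> \<Omega> - {p0} \<and>
            smooth_orthonormal_perp_frame U (normal_field F w) N \<and>
            (\<forall>x\<in>U. lie_rank U {N i |i. i \<in> {1..CARD('m) - 1}} x = CARD('m))"
  shows "\<forall>x\<in>\<Omega>. v x = u x"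
proof -
  have p0: "p0 \<in> \<Omega>" "grad w p0 + F p0 = 0"
    using sing by (auto simp: singular_set_def)
  have reg: "grad w x + F x \<noteq> 0" if "x \<in> \<Omega> - {p0}" for x
    using sing that by (auto simp: singular_set_def)
  have w: "w = u \<or> w = v" and w': "w' = u \<or> w' = v" and uv: "w = u \<and> w' = v \<or> w = v \<and> w' = u"
    using ww' by auto
  \<comment> \<open>Contact forces equal gradients, so \<open>p0\<close> is singular for
    \<open>w'\<close> as well. Inside \<Omega> the zeros of \<open>grad w' x + F x\<close> thus
    comprise all singular points of both functions.\<close>
  have "grad v p0 = grad u p0"
    using grad_eq_at_touching[OF dom(1) p0(1) u v le touch] .
  then have p0': "grad w' p0 + F p0 = 0"
    using p0(2) w w' by auto
  have "\<exists>q\<in>\<Omega> - {p0}. v q = u q"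
  proof (rule ccontr)
    assume no: "\<not> ?thesis"
    have gt: "u x < v x" if "x \<in> \<Omega> - {p0}" for x
      using no that le[of x] by force
    obtain r where r: "r > 0" "cball p0 r \<subseteq> \<Omega>"
      using dom(1) p0(1) open_contains_cball by blast
    have cont: "continuous_on (cball p0 r) (\<lambda>x. v x - u x)"
      using Ck_on_continuous u v r(2) by (intro continuous_on_diff) (blast intro: continuous_on_subset)+
    have "sphere p0 r \<noteq> {}" using r(1) by simp
    then obtain s where s: "s \<in> sphere p0 r" "\<And>x. x \<in> sphere p0 r \<Longrightarrow> v s - u s \<le> v x - u x"
      using continuous_attains_inf[of "sphere p0 r" "\<lambda>x. v x - u x"] continuous_on_subset[OF cont sphere_cball]
      by auto
    have "v s - u s > 0" using gt[of s] s(1) r by auto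
    \<comment> \<open>Half the minimum of \<open>v - u\<close> on the sphere: the sublevel set then
      stays off the sphere and is compact inside the open ball.\<close>
    define \<epsilon> where "\<epsilon> = (v s - u s) / 2"
    have \<epsilon>: "\<epsilon> > 0" "\<epsilon> < v s - u s" using \<open>v s - u s > 0\<close> by (auto simp: \<epsilon>_def)
    have "{x \<in> ball p0 r. v x - u x \<le> \<epsilon>} = cball p0 r \<inter> {x \<in> cball p0 r. v x - u x \<le> \<epsilon>}"
      using s(2) \<epsilon>(2) by (force simp: le_less)
    moreover have "closed {x \<in> cball p0 r. v x - u x \<le> \<epsilon>}"
      by (intro continuous_on_closed_Collect_le cont continuous_intros) auto
    ultimately have S: "compact {x \<in> ball p0 r. v x - u x \<le> \<epsilon>}"
      by (simp add: compact_Int_closed)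
    \<comment> \<open>The closed ball makes \<open>K\<close> compact while it still lies in
      \<Omega>, so that \<open>K\<close> inherits the Hausdorff null condition from the singular set
      of \<open>w'\<close>.\<close>
    define K where "K = {x \<in> cball p0 r. grad w' x + F x = 0}"
    have "Ck_on 2 w' \<Omega>" using w' u v by auto
    then have "continuous_on (cball p0 r) (\<lambda>x. grad w' x + F x)"
      using Ck_on_continuous[OF Ck_on_grad_add[OF dom(1) _ F]] r(2) by (blast intro: continuous_on_subset)
    then have "closed K"
      unfolding K_def by (rule continuous_closed_preimage_constant) auto
    then have K: "compact K"
      using compact_Int_closed[of "cball p0 r" K] by (simp add: K_def Int_absorb1 subset_eq)
    have KA: "K \<subseteq> closure (singular_set \<Omega> F w')"
      using r(2) closure_subset[of "singular_set \<Omega> F w'"] by (auto simp: K_def singular_set_def)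
    have V: "ball p0 r \<subseteq> \<Omega>" using r(2) by auto
    have "p0 \<in> K" using p0' r(1) by (simp add: K_def)
    have K_iff: "x \<in> K \<longleftrightarrow> grad w' x + F x = 0" if "x \<in> ball p0 r" for x
      using that by (auto simp: K_def)
    \<comment> \<open>\<sigma> is 1 or -1 according to the sign of the divergence, which merges the
      two cases.\<close>
    obtain \<sigma> :: real where \<sigma>: "\<And>x. x \<in> \<Omega> \<Longrightarrow> \<sigma> * divergence (flat_field a F) x > 0"
      using div by (metis mult_1 mult_minus1 neg_0_less_iff_less)
    show False
    proof (rule not_isolated_coincidence[OF open_ball _ _ _ _ S \<epsilon>(1) touch K KA haus _ _ _ a])
      show "p0 \<in> ball p0 r" using r(1) by simp
      show "Ck_on 2 u (ball p0 r)" "Ck_on 2 v (ball p0 r)" "Ck_on 1 F (ball p0 r)"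
        using u v F V Ck_on_subset by blast+
      show "grad u x + F x \<noteq> 0 \<and> grad v x + F x \<noteq> 0" if "x \<in> ball p0 r - K" for x
        using that K_iff[of x] reg[of x] V \<open>p0 \<in> K\<close> uv by (cases "x = p0") auto
      show "grad u x + F x = 0 \<or> grad v x + F x = 0" if "x \<in> ball p0 r \<inter> K" for x
        using that K_iff[of x] w' by auto
      show "mean_curvature F v x \<le> mean_curvature F u x" if "x \<in> ball p0 r - K" for x
        using that K_iff[of x] V \<open>p0 \<in> K\<close> by (intro curv) (auto simp: singular_set_def)
      show "\<sigma> * divergence (flat_field a F) x > 0" if "x \<in> ball p0 r" for x
        using \<sigma> V that by blast
    qed
  qed
  then obtain q where q: "q \<in> \<Omega> - {p0}" "v q = u q" by blast
  have "v x = u x" if x: "x \<in> \<Omega> - {p0}" for x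
  proof (rule coincidence_propagates[where \<Omega> = "\<Omega> - {p0}" and w = w, OF _ _ _ _ _ _ w _ _ _ q x])
    show "open (\<Omega> - {p0})" using dom(1) by (rule open_delete)
    \<comment> \<open>Deleting a point preserves connectedness in dimension at least 2, which
      \<open>m\<close> supplies.\<close>
    show "connected (\<Omega> - {p0})" by (rule connected_open_delete[OF dom]) (use m in simp)
    show "Ck_on 2 u (\<Omega> - {p0})" "Ck_on 2 v (\<Omega> - {p0})" "Ck_on 1 F (\<Omega> - {p0})"
      using u v F Ck_on_subset by blast+
    show "u x \<le> v x" if "x \<in> \<Omega> - {p0}" for x using le that by blast
    show "grad w x + F x \<noteq> 0" if "x \<in> \<Omega> - {p0}" for x using reg that .
    show "mean_curvature F v x \<le> mean_curvature F u x"
      if "x \<in> \<Omega> - {p0}" "grad u x + F x \<noteq> 0" "grad v x + F x \<noteq> 0" for x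
      using that w' by (intro curv) (auto simp: singular_set_def)
  qed (use rank in blast)
  then show ?thesis using touch by blast
qed

end
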